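(* Let $f=(f_1,\ldots,f_n)$ be an $n$-tuple of formal power series with the model property and let $M_Z:=(M_{Z_1},\ldots,M_{Z_n})$ be the universal model associated with the noncommutative domain $\mathbb B_f$. Given two invariant subspaces $\mathcal M,\mathcal N\subseteq\mathbb H^2(f)$ under $M_{Z_1},\ldots,M_{Z_n}$, the following statements hold. (i) If $\operatorname{rank}_f(M_Z|_{\mathcal M})<\infty$, then $\operatorname{curv}_f(M_Z|_{\mathcal M})=\operatorname{rank}_f(M_Z|_{\mathcal M})$. (ii) If $\operatorname{rank}_f(M_Z|_{\mathcal M})<\infty$ and $\operatorname{rank}_f(M_Z|_{\mathcal N})<\infty$, then $M_Z|_{\mathcal M}$ is unitarily equivalent to $M_Z|_{\mathcal N}$ if and only if $$\operatorname{curv}_f(M_Z|_{\mathcal M})=\operatorname{curv}_f(M_Z|_{\mathcal N}).$$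
   Context: Notation. $\mathbb F_n^+$ is the free semigroup on $g_1,\ldots,g_n$ with identity $g_0$ and length $|\cdot|$. For an $n$-tuple $X$ of elements of a unital algebra, $X_\alpha=X_{i_1}\cdots X_{i_k}$ if $\alpha=g_{i_1}\cdots g_{i_k}$, $X_{g_0}=I$; $[f(X)]_\alpha$ is the corresponding product of $f_1(X),\ldots,f_n(X)$. A tuple $X\in B(\mathcal H)^n$ is viewed as a row operator, so $\|X\|=\|\sum X_iX_i^*\|^{1/2}$; $[B(\mathcal H)^n]_\gamma=\{X:\|X\|<\gamma\}$. A free holomorphic function on $[B(\mathcal H)^n]_\gamma$ is a formal power series $\sum a_\alpha Z_\alpha$ in noncommuting indeterminates (complex coefficients) with radius of convergence $r$, $r^{-1}=\limsup_k(\sum_{|\alpha|=k}|a_\alpha|^2)^{1/2k}$, at least $\gamma$, identified with the map $X\mapsto\sum_k\sum_{|\alpha|=k}a_\alpha X_\alpha$ (norm convergence; $\mathcal H$ separable infinite-dimensional). $H^2_{\bf ball}$ is the Hilbert space of series with $\sum|a_\alpha|^2<\infty$ (the $Z_\alpha$ being orthonormal). Convergence sets. For an $n$-tuple $f$ of formal power series $f_j=\sum c^{(j)}_\alpha Z_\alpha$ and a Hilbert space $\mathcal H$: $\mathcal C_f^{SOT}(\mathcal H)$ is the set of $X\in B(\mathcal H)^n$ such that each series $f_j(X):=\sum_k\sum_{|\alpha|=k}c^{(j)}_\alpha X_\alpha$ is SOT-convergent; $\mathcal C_f^{rad}(\mathcal H)$ is the set of $X$ such that for some $\delta\in(0,1)$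 these series converge in norm at $rX$ for all $r\in(\delta,1)$ and $f_j(X):=\text{SOT-}\lim_{r\to1}f_j(rX)$ exists for each $j$. Model property. $f=(f_1,\ldots,f_n)$ has the model property if one of the following holds. (A) $f$ is an $n$-tuple of noncommutative polynomials for which there is an $n$-tuple $g$ of noncommutative polynomials with $f\circ g=g\circ f=\mathrm{id}$. Then $\{f_\alpha\}$ is a linear basis of $\mathbb C[Z_1,\ldots,Z_n]$ and $\mathbb H^2(f)$ is the completion of $\mathbb C[Z_1,\ldots,Z_n]$ for the inner product $\langle f_\alpha,f_\beta\rangle=\delta_{\alpha\beta}$. (S) $f$ is an $n$-tuple of formal power series with $f(0)=0$, nonzero radius of convergence and $\det J_f(0)\neq0$ ($J_f(0)_{ij}$ is the coefficient of $Z_j$ in $f_i$); $\mathbb H^2(f)$ is the Hilbert space of formal power series $\sum a_\alpha f_\alpha$, $\sum|a_\alpha|^2<\infty$, with $\{f_\alpha\}$ orthonormal; $Z_1,\ldots,Z_n\in\mathbb H^2(f)$; left multiplication $M_{Z_i}$ by $Z_i$ is bounded on $\mathbb H^2(f)$; and $M_Z=(M_{Z_1},\ldots,M_{Z_n})$ belongs to $\mathcal C_f^{SOT}(\mathbb H^2(f))$ or $\mathcal C_f^{rad}(\mathbb H^2(f))$ with $f_j(M_Z)=M_{f_j}$ (left multiplication by $f_j$), $j=1,\ldots,n$. (F) $f$ is an $n$-tuple of free holomorphic functions on some $[B(\mathcal H)^n]_\gamma$, $\gamma>0$, with range in $[B(\mathcal H)^n]_1$, such that $G\circ f\not\equiv0$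 for every nonzero free holomorphic $G$ on $[B(\mathcal H)^n]_1$; $\mathbb H^2(f)=\{G\circ f:G\in H^2_{\bf ball}\}$ with $\langle F\circ f,G\circ f\rangle=\langle F,G\rangle$; the coordinate functions $Z_1,\ldots,Z_n$ lie in $\mathbb H^2(f)$, left multiplications $M_{Z_i}$ by them are bounded on $\mathbb H^2(f)$, and $M_Z$ is in $\mathcal C_f^{SOT}(\mathbb H^2(f))$ or $\mathcal C_f^{rad}(\mathbb H^2(f))$ with $f_j(M_Z)=M_{f_j}$ for all $j$. In all cases $\{f_\alpha\}_{\alpha\in\mathbb F_n^+}$ is an orthonormal basis of $\mathbb H^2(f)$, and $M_Z$ is called the universal model. Writing $Z_i=\sum_\alpha a^{(i)}_\alpha f_\alpha$ in $\mathbb H^2(f)$, one has $M_{Z_i}f_\beta=\sum_\alpha a^{(i)}_\alpha f_{\alpha\beta}$, and $g_i:=\sum_\alpha a^{(i)}_\alpha Z_\alpha$ defines the inverse $g=(g_1,\ldots,g_n)$ of $f$ with respect to composition. Domain. $X\in B(\mathcal H)^n$ satisfies $g(f(X))=X$ if $X\in\mathcal C_f^{SOT}(\mathcal H)\cup\mathcal C_f^{rad}(\mathcal H)$ and either (for all $i$) $X_i=\sum_k\sum_{|\alpha|=k}a^{(i)}_\alpha[f(X)]_\alpha$ in the SOT, or (for all $i$) $X_i=\text{SOT-}\lim_{r\to1}\sum_k\sum_{|\alpha|=k}a^{(i)}_\alpha r^{|\alpha|}[f(X)]_\alpha$ (automatic in case (A)). Then $\mathbb B_f(\mathcal H):=\{X\in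 B(\mathcal H)^n:\ g(f(X))=X,\ \|f(X)\|\le1\}$. One has $M_Z\in\mathbb B_f(\mathbb H^2(f))$, and if $\mathcal M$ is a (closed) subspace invariant under all $M_{Z_i}$ then $M_Z|_{\mathcal M}:=(M_{Z_1}|_{\mathcal M},\ldots,M_{Z_n}|_{\mathcal M})\in\mathbb B_f(\mathcal M)$. Rank and curvature. For $T\in\mathbb B_f(\mathcal H)$: $\Delta_{f,T}:=(I-\sum_if_i(T)f_i(T)^* )^{1/2}$, $\mathcal D_{f,T}:=\overline{\Delta_{f,T}\mathcal H}$, $\operatorname{rank}_f(T):=\operatorname{rank}\Delta_{f,T}$; the Poisson kernel is $K_{f,T}:\mathcal H\to\mathbb H^2(f)\otimes\mathcal D_{f,T}$, $K_{f,T}h:=\sum_{\alpha\in\mathbb F_n^+}f_\alpha\otimes\Delta_{f,T}[f(T)]_\alpha^*h$; $Q_{\le m}$ is the orthogonal projection of $\mathbb H^2(f)$ onto $\operatorname{span}\{f_\alpha:|\alpha|\le m\}$. If $\operatorname{rank}_f(T)<\infty$, $$\operatorname{curv}_f(T):=\lim_{m\to\infty}\frac{\operatorname{trace}[K_{f,T}^*(Q_{\le m}\otimes I_{\mathcal D_{f,T}})K_{f,T}]}{\operatorname{trace}[K_{f,M_Z}^*Q_{\le m}K_{f,M_Z}]}$$ (the limit exists; the denominator equals $1+n+\cdots+n^m$). Tuples $(A_i)\subset B(\mathcal H)$, $(B_i)\subset B(\mathcal K)$ are unitarily equivalent if there is a unitary $U:\mathcal H\to\mathcal K$ with $A_i=U^*B_iU$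 for all $i$. *)

theory Defs
  imports "HOL-Analysis.Analysis"
begin

section \<open>Complex Hilbert spaces\<close>

text \<open>The complex inner product is linear in the \<^emph>\<open>first\<close> argument.  Its real part is the inner
  product of the underlying real Hilbert space, so the norm and topology are those of the library.\<close>

class complex_hilbert_space = real_inner + complete_space +
  fixes scaleC :: "complex \<Rightarrow> 'a \<Rightarrow> 'a" (infixr "*\<^sub>C" 75)
    and cinner :: "'a \<Rightarrow> 'a \<Rightarrow> complex"
  assumes scaleC_add_right: "c *\<^sub>C (x + y) = c *\<^sub>C x + c *\<^sub>C y"
    and scaleC_add_left: "(c + d) *\<^sub>C x = c *\<^sub>C x + d *\<^sub>C x"
    and scaleC_scaleC: "c *\<^sub>C d *\<^sub>C x = (c * d) *\<^sub>C x"
    and scaleC_one: "1 *\<^sub>C x = x"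
    and scaleR_scaleC: "r *\<^sub>R x = complex_of_real r *\<^sub>C x"
    and cinner_commute: "cinner x y = cnj (cinner y x)"
    and cinner_add_left: "cinner (x + y) z = cinner x z + cinner y z"
    and cinner_scaleC_left: "cinner (c *\<^sub>C x) y = c * cinner x y"
    and inner_cinner: "inner x y = Re (cinner x y)"

global_interpretation complex_vector: vector_space "scaleC :: complex \<Rightarrow> 'a::complex_hilbert_space \<Rightarrow> 'a"
  by unfold_locales (simp_all add: scaleC_add_right scaleC_add_left scaleC_scaleC scaleC_one)

lemma norm_scaleC: "norm (c *\<^sub>C (x::'a::complex_hilbert_space)) = cmod c * norm x"
proof -
  have "cinner (c *\<^sub>C x) (c *\<^sub>C x) = c * cnj (c * cinner x x)"
    by (metis cinner_commute cinner_scaleC_left)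
  also have "\<dots> = complex_of_real ((cmod c)\<^sup>2) * cinner x x"
    by (simp add: complex_norm_square cinner_commute[of x x, symmetric] del: of_real_power)
  finally have "inner (c *\<^sub>C x) (c *\<^sub>C x) = (cmod c)\<^sup>2 * inner x x"
    by (simp only: inner_cinner Re_complex_of_real times_complex.sel Im_complex_of_real)
  then show ?thesis
    by (simp add: norm_eq_sqrt_inner real_sqrt_mult)
qed

lemma Im_cinner: "Im (cinner x y) = - inner (\<i> *\<^sub>C x) (y::'a::complex_hilbert_space)"
  by (simp add: inner_cinner cinner_scaleC_left)

lemma norm_cinner_le: "cmod (cinner x y) \<le> 2 * (norm x * norm (y::'a::complex_hilbert_space))"
proof -
  have "\<bar>Re (cinner x y)\<bar> \<le> norm x * norm y"
    using Cauchy_Schwarz_ineq2[of x y] by (simp add: inner_cinner)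
  moreover have "\<bar>Im (cinner x y)\<bar> \<le> norm x * norm y"
    using Cauchy_Schwarz_ineq2[of "\<i> *\<^sub>C x" y] by (simp add: Im_cinner norm_scaleC)
  ultimately show ?thesis
    using cmod_le[of "cinner x y"] by linarith
qed

instantiation complex :: complex_hilbert_space
begin
definition "scaleC_complex c (z::complex) = c * z"
definition "cinner_complex (x::complex) y = x * cnj y"
instance
  by standard
    (simp_all add: scaleC_complex_def cinner_complex_def algebra_simps scaleR_conv_of_real
      inner_complex_def)
end


section \<open>Square-summable families\<close>

text \<open>\<open>('i, 'b) l2\<close> is the Hilbert space direct sum of copies of \<open>'b\<close> indexed by \<open>'i\<close>.  For
  \<open>'b = complex\<close> it is the space \<open>\<ell>\<^sup>2('i)\<close>; in general it is the Hilbert space tensor product of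
  \<open>\<ell>\<^sup>2('i)\<close> and \<open>'b\<close>.\<close>

typedef (overloaded) ('i, 'b::complex_hilbert_space) l2 =
    "{x :: 'i \<Rightarrow> 'b. (\<lambda>i. (norm (x i))\<^sup>2) summable_on UNIV}"
  morphisms l2_nth Abs_l2
  by (rule exI[of _ "\<lambda>_. 0"]) simp

setup_lifting type_definition_l2

lemma l2_nth_summable: "(\<lambda>i. (norm (l2_nth x i))\<^sup>2) summable_on UNIV"
  using l2_nth by auto

lemma sq_summable_add:
  fixes x y :: "'i \<Rightarrow> 'b::complex_hilbert_space"
  assumes "(\<lambda>i. (norm (x i))\<^sup>2) summable_on UNIV" "(\<lambda>i. (norm (y i))\<^sup>2) summable_on UNIV"
  shows "(\<lambda>i. (norm (x i + y i))\<^sup>2) summable_on UNIV"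
proof (rule summable_on_comparison_test)
  show "(\<lambda>i. 2 * (norm (x i))\<^sup>2 + 2 * (norm (y i))\<^sup>2) summable_on UNIV"
    by (intro summable_on_add summable_on_cmult_right assms)
  fix i
  have "(norm (x i + y i))\<^sup>2 \<le> (norm (x i) + norm (y i))\<^sup>2"
    by (intro power_mono norm_triangle_ineq) auto
  also have "\<dots> \<le> 2 * (norm (x i))\<^sup>2 + 2 * (norm (y i))\<^sup>2"
    using sum_squares_bound[of "norm (x i)" "norm (y i)"] by (simp add: power2_sum)
  finally show "(norm (x i + y i))\<^sup>2 \<le> 2 * (norm (x i))\<^sup>2 + 2 * (norm (y i))\<^sup>2" .
qed auto

lemma sq_summable_scale:
  fixes x :: "'i \<Rightarrow> 'b::complex_hilbert_space"
  assumes "(\<lambda>i. (norm (x i))\<^sup>2) summable_on UNIV"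
  shows "(\<lambda>i. (norm (c *\<^sub>C x i))\<^sup>2) summable_on UNIV"
  using summable_on_cmult_right[OF assms, of "(cmod c)\<^sup>2"]
  by (simp add: norm_scaleC power_mult_distrib)

lemma mult_le_squares: "2 * (a * b) \<le> a\<^sup>2 + (b::real)\<^sup>2"
  using sum_squares_bound[of a b] by simp

lemma l2_cinner_summable:
  "(\<lambda>i. cinner (l2_nth x i) (l2_nth y i)) summable_on UNIV"
proof (rule abs_summable_summable, rule summable_on_comparison_test)
  show "(\<lambda>i. (norm (l2_nth x i))\<^sup>2 + (norm (l2_nth y i))\<^sup>2) summable_on UNIV"
    by (intro summable_on_add l2_nth_summable)
  fix i
  show "norm (cinner (l2_nth x i) (l2_nth y i)) \<le> (norm (l2_nth x i))\<^sup>2 + (norm (l2_nth y i))\<^sup>2"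
    using norm_cinner_le[of "l2_nth x i" "l2_nth y i"]
      mult_le_squares[of "norm (l2_nth x i)" "norm (l2_nth y i)"] by linarith
qed auto

lemma l2_inner_summable: "(\<lambda>i. inner (l2_nth x i) (l2_nth y i)) summable_on UNIV"
  using l2_cinner_summable[of x y, THEN summable_on_Re] by (simp add: inner_cinner)

instantiation l2 :: (type, complex_hilbert_space) real_vector
begin

lift_definition zero_l2 :: "('a, 'b) l2" is "\<lambda>_. 0" by simp
lift_definition plus_l2 :: "('a, 'b) l2 \<Rightarrow> ('a, 'b) l2 \<Rightarrow> ('a, 'b) l2" is "\<lambda>x y i. x i + y i"
  by (rule sq_summable_add)
lift_definition uminus_l2 :: "('a, 'b) l2 \<Rightarrow> ('a, 'b) l2" is "\<lambda>x i. - x i" by simp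
lift_definition minus_l2 :: "('a, 'b) l2 \<Rightarrow> ('a, 'b) l2 \<Rightarrow> ('a, 'b) l2" is "\<lambda>x y i. x i - y i"
proof -
  fix x y :: "'a \<Rightarrow> 'b"
  assume "(\<lambda>i. (norm (x i))\<^sup>2) summable_on UNIV" "(\<lambda>i. (norm (y i))\<^sup>2) summable_on UNIV"
  then show "(\<lambda>i. (norm (x i - y i))\<^sup>2) summable_on UNIV"
    using sq_summable_add[of x "\<lambda>i. - y i"] by simp
qed
lift_definition scaleR_l2 :: "real \<Rightarrow> ('a, 'b) l2 \<Rightarrow> ('a, 'b) l2" is "\<lambda>r x i. r *\<^sub>R x i"
  by (simp add: scaleR_scaleC sq_summable_scale)
instance
proof
  fix x y z :: "('a, 'b) l2" and r s :: real
  show "x + y + z = x + (y + z)" by transfer (simp add: add.assoc)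
  show "x + y = y + x" by transfer (simp add: add.commute)
  show "0 + x = x" by transfer simp
  show "- x + x = 0" by transfer simp
  show "x - y = x + - y" by transfer simp
  show "r *\<^sub>R (x + y) = r *\<^sub>R x + r *\<^sub>R y" by transfer (simp add: scaleR_add_right)
  show "(r + s) *\<^sub>R x = r *\<^sub>R x + s *\<^sub>R x" by transfer (simp add: scaleR_add_left)
  show "r *\<^sub>R s *\<^sub>R x = (r * s) *\<^sub>R x" by transfer simp
  show "1 *\<^sub>R x = x" by transfer simp
qed

end

instantiation l2 :: (type, complex_hilbert_space) real_inner
begin

definition inner_l2 :: "('a, 'b) l2 \<Rightarrow> ('a, 'b) l2 \<Rightarrow> real" where
  "inner_l2 x y = (\<Sum>\<^sub>\<infinity>i. inner (l2_nth x i) (l2_nth y i))"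
definition norm_l2 :: "('a, 'b) l2 \<Rightarrow> real" where "norm_l2 x = sqrt (inner x x)"
definition sgn_l2 :: "('a, 'b) l2 \<Rightarrow> ('a, 'b) l2" where "sgn_l2 x = x /\<^sub>R norm x"
definition dist_l2 :: "('a, 'b) l2 \<Rightarrow> ('a, 'b) l2 \<Rightarrow> real" where "dist_l2 x y = norm (x - y)"
definition uniformity_l2 :: "(('a, 'b) l2 \<times> ('a, 'b) l2) filter" where
  "uniformity_l2 = (INF e\<in>{0<..}. principal {(x, y). dist x y < e})"
definition open_l2 :: "('a, 'b) l2 set \<Rightarrow> bool" where
  "open_l2 U \<longleftrightarrow> (\<forall>x\<in>U. \<forall>\<^sub>F (x', y) in uniformity. x' = x \<longrightarrow> y \<in> U)"

instance
proof
  fix x y z :: "('a, 'b) l2" and r s :: real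
  show "dist x y = norm (x - y)" by (rule dist_l2_def)
  show "sgn x = x /\<^sub>R norm x" by (rule sgn_l2_def)
  show "uniformity = (INF e\<in>{0<..}. principal {(x, y :: ('a, 'b) l2). dist x y < e})"
    by (rule uniformity_l2_def)
  show "open U \<longleftrightarrow> (\<forall>x\<in>U. \<forall>\<^sub>F (x', y) in uniformity. x' = x \<longrightarrow> y \<in> U)"
    for U :: "('a, 'b) l2 set" by (rule open_l2_def)
  show "norm x = sqrt (inner x x)" by (rule norm_l2_def)
  show "inner x y = inner y x" by (simp add: inner_l2_def inner_commute)
  show "inner (x + y) z = inner x z + inner y z"
    unfolding inner_l2_def
    by (subst infsum_add[symmetric]) (auto simp: l2_inner_summable plus_l2.rep_eq inner_add_left)
  show "inner (r *\<^sub>R x) y = r * inner x y"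
    unfolding inner_l2_def
    by (subst infsum_cmult_right[symmetric]) (auto simp: l2_inner_summable scaleR_l2.rep_eq)
  show "0 \<le> inner x x" unfolding inner_l2_def by (rule infsum_nonneg) simp
  show "inner x x = 0 \<longleftrightarrow> x = 0"
  proof
    assume "inner x x = 0"
    then have "inner (l2_nth x i) (l2_nth x i) = 0" for i
      using nonneg_infsum_le_0D[of "\<lambda>i. inner (l2_nth x i) (l2_nth x i)" UNIV i]
      by (simp add: inner_l2_def l2_inner_summable)
    then have "l2_nth x = (\<lambda>_. 0)" by auto
    then show "x = 0" by (metis l2_nth_inverse zero_l2_def)
  qed (simp add: inner_l2_def zero_l2.rep_eq)
qed

end

lemma l2_norm_sq: "(norm x)\<^sup>2 = (\<Sum>\<^sub>\<infinity>i. (norm (l2_nth x i))\<^sup>2)"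
  by (simp add: power2_norm_eq_inner inner_l2_def)

lemma l2_sum_le_norm_sq: "finite F \<Longrightarrow> (\<Sum>i\<in>F. (norm (l2_nth x i))\<^sup>2) \<le> (norm x)\<^sup>2"
  unfolding l2_norm_sq by (rule finite_sum_le_infsum) (auto simp: l2_nth_summable)

lemma l2_norm_nth_le: "norm (l2_nth x i) \<le> norm x"
  using l2_sum_le_norm_sq[of "{i}" x] by (simp add: power2_le_iff_abs_le)

instance l2 :: (type, complex_hilbert_space) complete_space
proof
  fix X :: "nat \<Rightarrow> ('a, 'b) l2"
  assume X: "Cauchy X"
  have "Cauchy (\<lambda>n. l2_nth (X n) i)" for i
  proof (rule CauchyI)
    fix e :: real assume "0 < e"
    then obtain n0 where n0: "\<And>m n. m \<ge> n0 \<Longrightarrow> n \<ge> n0 \<Longrightarrow> norm (X m - X n) < e"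
      using CauchyD[OF X] by blast
    show "\<exists>M. \<forall>m\<ge>M. \<forall>n\<ge>M. norm (l2_nth (X m) i - l2_nth (X n) i) < e"
      by (intro exI[of _ n0] allI impI)
         (metis n0 l2_norm_nth_le minus_l2.rep_eq order.strict_trans1)
  qed
  then have "\<exists>y. (\<lambda>n. l2_nth (X n) i) \<longlonglongrightarrow> y" for i
    by (simp add: Cauchy_convergent_iff convergent_def)
  then obtain y where y: "\<And>i. (\<lambda>n. l2_nth (X n) i) \<longlonglongrightarrow> y i" by metis
  have tail: "(\<Sum>i\<in>F. (norm (l2_nth (X m) i - y i))\<^sup>2) \<le> e\<^sup>2"
    if F: "finite F" and n0: "\<And>m n. m \<ge> n0 \<Longrightarrow> n \<ge> n0 \<Longrightarrow> norm (X m - X n) < e" and m: "m \<ge> n0"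
    for F e n0 m
  proof (rule LIMSEQ_le_const2)
    show "(\<lambda>n. \<Sum>i\<in>F. (norm (l2_nth (X m) i - l2_nth (X n) i))\<^sup>2)
            \<longlonglongrightarrow> (\<Sum>i\<in>F. (norm (l2_nth (X m) i - y i))\<^sup>2)"
      by (intro tendsto_intros y)
    have "(\<Sum>i\<in>F. (norm (l2_nth (X m) i - l2_nth (X n) i))\<^sup>2) \<le> e\<^sup>2" if "n \<ge> n0" for n
    proof -
      have "(\<Sum>i\<in>F. (norm (l2_nth (X m) i - l2_nth (X n) i))\<^sup>2) \<le> (norm (X m - X n))\<^sup>2"
        using l2_sum_le_norm_sq[OF F, of "X m - X n"] by (simp add: minus_l2.rep_eq)
      also have "\<dots> \<le> e\<^sup>2" using n0[OF m that] by (intro power_mono) auto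
      finally show ?thesis .
    qed
    then show "\<exists>N. \<forall>n\<ge>N. (\<Sum>i\<in>F. (norm (l2_nth (X m) i - l2_nth (X n) i))\<^sup>2) \<le> e\<^sup>2"
      by blast
  qed
  have diff: "(\<lambda>i. (norm (l2_nth (X m) i - y i))\<^sup>2) summable_on UNIV"
    if "\<And>m n. m \<ge> n0 \<Longrightarrow> n \<ge> n0 \<Longrightarrow> norm (X m - X n) < e" "m \<ge> n0" for e n0 m
    by (rule nonneg_bdd_above_summable_on)
       (auto intro!: bdd_aboveI[of _ "e\<^sup>2"] tail[OF _ that(1) that(2)])
  obtain n1 where n1: "\<And>m n. m \<ge> n1 \<Longrightarrow> n \<ge> n1 \<Longrightarrow> norm (X m - X n) < 1"
    using CauchyD[OF X, of 1] by auto
  have "(\<lambda>i. (norm (l2_nth (X n1) i + (y i - l2_nth (X n1) i)))\<^sup>2) summable_on UNIV"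
    using sq_summable_add[of "l2_nth (X n1)" "\<lambda>i. y i - l2_nth (X n1) i"]
      diff[OF n1 order_refl] by (simp add: l2_nth_summable norm_minus_commute)
  then have ysum: "(\<lambda>i. (norm (y i))\<^sup>2) summable_on UNIV" by simp
  define L where "L = Abs_l2 y"
  have L: "l2_nth L = y" unfolding L_def by (rule Abs_l2_inverse) (simp add: ysum)
  have "X \<longlonglongrightarrow> L"
  proof (rule LIMSEQ_I)
    fix e :: real assume e: "0 < e"
    then obtain n0 where n0: "\<And>m n. m \<ge> n0 \<Longrightarrow> n \<ge> n0 \<Longrightarrow> norm (X m - X n) < e / 2"
      using CauchyD[OF X, of "e/2"] by auto
    have "norm (X m - L) < e" if m: "m \<ge> n0" for m
    proof -
      have "(norm (X m - L))\<^sup>2 \<le> (e / 2)\<^sup>2"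
        unfolding l2_norm_sq minus_l2.rep_eq L
        by (rule infsum_le_finite_sums[OF diff[OF n0 m]]) (auto intro: tail[OF _ n0 m])
      then have "norm (X m - L) \<le> e / 2"
        using e by (simp add: power2_le_iff_abs_le)
      with e show ?thesis by simp
    qed
    then show "\<exists>no. \<forall>n\<ge>no. norm (X n - L) < e" by blast
  qed
  then show "convergent X" by (auto simp: convergent_def)
qed

instantiation l2 :: (type, complex_hilbert_space) complex_hilbert_space
begin

lift_definition scaleC_l2 :: "complex \<Rightarrow> ('a, 'b) l2 \<Rightarrow> ('a, 'b) l2" is "\<lambda>c x i. c *\<^sub>C x i"
  by (rule sq_summable_scale)
definition cinner_l2 :: "('a, 'b) l2 \<Rightarrow> ('a, 'b) l2 \<Rightarrow> complex" where
  "cinner_l2 x y = (\<Sum>\<^sub>\<infinity>i. cinner (l2_nth x i) (l2_nth y i))"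

instance
proof
  fix x y z :: "('a, 'b) l2" and c d :: complex and r :: real
  show "c *\<^sub>C (x + y) = c *\<^sub>C x + c *\<^sub>C y" by transfer (simp add: scaleC_add_right)
  show "(c + d) *\<^sub>C x = c *\<^sub>C x + d *\<^sub>C x" by transfer (simp add: scaleC_add_left)
  show "c *\<^sub>C d *\<^sub>C x = (c * d) *\<^sub>C x" by transfer (simp add: scaleC_scaleC)
  show "1 *\<^sub>C x = x" by transfer (simp add: scaleC_one)
  show "r *\<^sub>R x = complex_of_real r *\<^sub>C x" by transfer (simp add: scaleR_scaleC)
  show "cinner x y = cnj (cinner y x)"
    unfolding cinner_l2_def by (subst infsum_cnj[symmetric]) (simp add: cinner_commute[symmetric])
  show "cinner (x + y) z = cinner x z + cinner y z"
    unfolding cinner_l2_def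
    by (subst infsum_add[symmetric]) (auto simp: l2_cinner_summable plus_l2.rep_eq cinner_add_left)
  show "cinner (c *\<^sub>C x) y = c * cinner x y"
    unfolding cinner_l2_def
    by (subst infsum_cmult_right[symmetric])
       (auto simp: l2_cinner_summable scaleC_l2.rep_eq cinner_scaleC_left)
  show "inner x y = Re (cinner x y)"
    unfolding inner_l2_def cinner_l2_def
    by (subst infsum_Re[symmetric]) (auto simp: l2_cinner_summable inner_cinner)
qed

end

lift_definition l2_single :: "'i \<Rightarrow> 'b::complex_hilbert_space \<Rightarrow> ('i, 'b) l2" is
  "\<lambda>i d j. if j = i then d else 0"
proof -
  fix i :: 'i and d :: 'b
  have "(\<lambda>j. (norm (if j = i then d else 0))\<^sup>2) summable_on {i}" by simp
  then show "(\<lambda>j. (norm (if j = i then d else 0))\<^sup>2) summable_on UNIV"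
    by (subst summable_on_cong_neutral[where T = "{i}"]) auto
qed


section \<open>Operators on a closed subspace\<close>

text \<open>All Hilbert spaces below are closed complex subspaces \<open>H\<close> of a type of class
  \<^class>\<open>complex_hilbert_space\<close>.  An operator on \<open>H\<close> is a function on the whole type of which only the
  values on \<open>H\<close> matter.  Hence the restriction \<open>T|\<^sub>M\<close> of an operator to an invariant subspace is the
  same function \<open>T\<close>, considered on the space \<open>M\<close> instead of \<open>H\<close>.\<close>

definition bounded_op :: "'a::complex_hilbert_space set \<Rightarrow> ('a \<Rightarrow> 'a) \<Rightarrow> bool" where
  "bounded_op H A \<longleftrightarrow>
     A ` H \<subseteq> H \<and> (\<forall>x\<in>H. \<forall>y\<in>H. A (x + y) = A x + A y) \<and> (\<forall>c. \<forall>x\<in>H. A (c *\<^sub>C x) = c *\<^sub>C A x) \<and>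
     (\<exists>C. \<forall>x\<in>H. norm (A x) \<le> C * norm x)"

text \<open>The adjoint of an operator from \<open>H\<close> to another Hilbert space, evaluated at an element \<open>y\<close> of the
  latter.\<close>

definition adj :: "'a::complex_hilbert_space set \<Rightarrow> ('a \<Rightarrow> 'b::complex_hilbert_space) \<Rightarrow> 'b \<Rightarrow> 'a" where
  "adj H A y = (THE z. z \<in> H \<and> (\<forall>h\<in>H. cinner (A h) y = cinner h z))"

definition pos_sqrt :: "'a::complex_hilbert_space set \<Rightarrow> ('a \<Rightarrow> 'a) \<Rightarrow> 'a \<Rightarrow> 'a" where
  "pos_sqrt H A = (SOME S. bounded_op H S \<and> (\<forall>h\<in>H. cinner (S h) h \<in> \<real> \<and> 0 \<le> Re (cinner (S h) h)) \<and>
     (\<forall>h\<in>H. S (S h) = A h))"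

definition orthonormal_basis :: "'a::complex_hilbert_space set \<Rightarrow> 'a set \<Rightarrow> bool" where
  "orthonormal_basis H E \<longleftrightarrow> E \<subseteq> H \<and> (\<forall>x\<in>E. \<forall>y\<in>E. cinner x y = (if x = y then 1 else 0)) \<and>
     closure (complex_vector.span E) = H"

definition trace_op :: "'a::complex_hilbert_space set \<Rightarrow> ('a \<Rightarrow> 'a) \<Rightarrow> complex" where
  "trace_op H A = (\<Sum>\<^sub>\<infinity>e\<in>(SOME E. orthonormal_basis H E). cinner (A e) e)"

definition cdimension :: "'a::complex_hilbert_space set \<Rightarrow> enat" where
  "cdimension V =
     (if \<exists>B. finite B \<and> V \<subseteq> complex_vector.span B then enat (complex_vector.dim V) else \<infinity>)"

definition unitary_op ::
  "'a::complex_hilbert_space set \<Rightarrow> 'b::complex_hilbert_space set \<Rightarrow> ('a \<Rightarrow> 'b) \<Rightarrow> bool" where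
  "unitary_op H K U \<longleftrightarrow>
     (\<forall>x\<in>H. \<forall>y\<in>H. U (x + y) = U x + U y) \<and> (\<forall>c. \<forall>x\<in>H. U (c *\<^sub>C x) = c *\<^sub>C U x) \<and>
     (\<forall>x\<in>H. \<forall>y\<in>H. cinner (U x) (U y) = cinner x y) \<and> U ` H = K"

definition unitarily_equivalent ::
  "'a::complex_hilbert_space set \<Rightarrow> ('n \<Rightarrow> 'a \<Rightarrow> 'a) \<Rightarrow>
   'b::complex_hilbert_space set \<Rightarrow> ('n \<Rightarrow> 'b \<Rightarrow> 'b) \<Rightarrow> bool" where
  "unitarily_equivalent H A K B \<longleftrightarrow>
     (\<exists>U. unitary_op H K U \<and> (\<forall>i. \<forall>h\<in>H. A i h = adj H U (B i (U h))))"

definition invariant_subspace ::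
  "('n \<Rightarrow> 'a \<Rightarrow> 'a) \<Rightarrow> 'a::complex_hilbert_space set \<Rightarrow> bool" where
  "invariant_subspace T M \<longleftrightarrow>
     complex_vector.subspace M \<and> closed M \<and> (\<forall>i. T i ` M \<subseteq> M)"


section \<open>Noncommutative formal power series\<close>

text \<open>The free semigroup on \<open>n = CARD('n)\<close> generators is \<open>'n list\<close>; a formal power series
  \<open>\<Sum> c\<^sub>\<alpha> Z\<^sub>\<alpha>\<close> is its coefficient function.\<close>

type_synonym 'n ncseries = "'n list \<Rightarrow> complex"

definition nc_one :: "'n ncseries" where
  "nc_one \<gamma> = (if \<gamma> = [] then 1 else 0)"

definition nc_var :: "'n \<Rightarrow> 'n ncseries" where
  "nc_var i \<gamma> = (if \<gamma> = [i] then 1 else 0)"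

definition nc_mult :: "'n ncseries \<Rightarrow> 'n ncseries \<Rightarrow> 'n ncseries" where
  "nc_mult p q \<gamma> = (\<Sum>k\<le>length \<gamma>. p (take k \<gamma>) * q (drop k \<gamma>))"

definition nc_word :: "('n \<Rightarrow> 'n ncseries) \<Rightarrow> 'n list \<Rightarrow> 'n ncseries" where
  "nc_word f \<alpha> = foldr (\<lambda>i. nc_mult (f i)) \<alpha> nc_one"

text \<open>The substitution \<open>\<Sum> c\<^sub>\<alpha> f\<^sub>\<alpha>\<close>, computed coefficientwise.  It is only used if \<open>c\<close> has finite
  support or \<open>f\<close> has zero constant terms; then the coefficientwise sums are finite.\<close>

definition nc_subst :: "'n ncseries \<Rightarrow> ('n \<Rightarrow> 'n ncseries) \<Rightarrow> 'n ncseries" where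
  "nc_subst c f \<gamma> = (\<Sum>\<alpha> | c \<alpha> * nc_word f \<alpha> \<gamma> \<noteq> 0. c \<alpha> * nc_word f \<alpha> \<gamma>)"

definition nc_polynomial :: "'n ncseries \<Rightarrow> bool" where
  "nc_polynomial c \<longleftrightarrow> finite {\<alpha>. c \<alpha> \<noteq> 0}"

definition nc_radius :: "'n::finite ncseries \<Rightarrow> ereal" where
  "nc_radius c = conv_radius (\<lambda>k. sqrt (\<Sum>\<alpha> | length \<alpha> = k. (cmod (c \<alpha>))\<^sup>2))"


section \<open>Evaluation at operator tuples\<close>

definition op_word :: "('n \<Rightarrow> 'a \<Rightarrow> 'a) \<Rightarrow> 'n list \<Rightarrow> 'a \<Rightarrow> 'a" where
  "op_word X \<alpha> = foldr (\<lambda>i A. X i \<circ> A) \<alpha> id"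

definition hom_part ::
  "'n::finite ncseries \<Rightarrow> ('n \<Rightarrow> 'a \<Rightarrow> 'a) \<Rightarrow> nat \<Rightarrow> 'a \<Rightarrow> 'a::complex_hilbert_space" where
  "hom_part c X k h = (\<Sum>\<alpha> | length \<alpha> = k. c \<alpha> *\<^sub>C op_word X \<alpha> h)"

definition series_at ::
  "'n::finite ncseries \<Rightarrow> ('n \<Rightarrow> 'a \<Rightarrow> 'a) \<Rightarrow> 'a \<Rightarrow> 'a::complex_hilbert_space" where
  "series_at c X h = (\<Sum>k. hom_part c X k h)"

definition scale_tuple :: "real \<Rightarrow> ('n \<Rightarrow> 'a \<Rightarrow> 'a) \<Rightarrow> 'n \<Rightarrow> 'a \<Rightarrow> 'a::complex_hilbert_space" where
  "scale_tuple r X i h = r *\<^sub>R X i h"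

definition norm_summable ::
  "'a::complex_hilbert_space set \<Rightarrow> (nat \<Rightarrow> 'a \<Rightarrow> 'a) \<Rightarrow> bool" where
  "norm_summable H A \<longleftrightarrow> (\<exists>S. bounded_op H S \<and>
     (\<forall>\<epsilon>>0. \<forall>\<^sub>F N in sequentially. \<forall>h\<in>H. norm ((\<Sum>k<N. A k h) - S h) \<le> \<epsilon> * norm h))"

definition conv_SOT ::
  "('n \<Rightarrow> 'n::finite ncseries) \<Rightarrow> 'a set \<Rightarrow> ('n \<Rightarrow> 'a \<Rightarrow> 'a::complex_hilbert_space) set" where
  "conv_SOT f H = {X. (\<forall>i. bounded_op H (X i)) \<and> (\<forall>j. \<forall>h\<in>H. summable (\<lambda>k. hom_part (f j) X k h))}"

definition conv_rad ::
  "('n \<Rightarrow> 'n::finite ncseries) \<Rightarrow> 'a set \<Rightarrow> ('n \<Rightarrow> 'a \<Rightarrow> 'a::complex_hilbert_space) set" where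
  "conv_rad f H = {X. (\<forall>i. bounded_op H (X i)) \<and>
     (\<exists>\<delta>\<in>{0<..<1}. \<forall>r\<in>{\<delta><..<1}. \<forall>j. norm_summable H (hom_part (f j) (scale_tuple r X))) \<and>
     (\<forall>j. \<forall>h\<in>H. \<exists>y. ((\<lambda>r. series_at (f j) (scale_tuple r X) h) \<longlongrightarrow> y) (at_left 1))}"

text \<open>\<open>eval_tuple f H X\<close> is \<open>f(X)\<close> for \<open>X\<close> in one of the two convergence sets.  By Abel's theorem the
  two definitions agree on the intersection.\<close>

definition eval_tuple ::
  "('n \<Rightarrow> 'n::finite ncseries) \<Rightarrow> 'a set \<Rightarrow> ('n \<Rightarrow> 'a \<Rightarrow> 'a) \<Rightarrow> 'n \<Rightarrow> 'a \<Rightarrow> 'a::complex_hilbert_space" where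
  "eval_tuple f H X j h =
     (if X \<in> conv_SOT f H then series_at (f j) X h
      else Lim (at_left 1) (\<lambda>r. series_at (f j) (scale_tuple r X) h))"


section \<open>The model property\<close>

text \<open>In each of the three cases \<open>(f\<^sub>\<alpha>)\<close> is by construction an orthonormal basis of \<open>\<H>\<^sup>2(f)\<close>, and an
  element \<open>\<Sum> a\<^sub>\<alpha> f\<^sub>\<alpha>\<close> of \<open>\<H>\<^sup>2(f)\<close> is represented by its family \<open>a\<close> of coordinates.  The actual
  polynomial, power series or function that it stands for appears explicitly in the three definitions
  below, and the multiplication operators on \<open>\<H>\<^sup>2(f)\<close> are characterised in terms of it.\<close>

type_synonym 'n hardy = "('n list, complex) l2"

text \<open>The polynomial case: \<open>\<H>\<^sup>2(f)\<close> is the completion of the space of polynomials, which are the finite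
  sums \<open>\<Sum> a\<^sub>\<alpha> f\<^sub>\<alpha>\<close>, and \<open>M\<^sub>Z\<close> is the continuous extension of left multiplication on polynomials.\<close>

definition polynomial_model ::
  "('n \<Rightarrow> 'n::finite ncseries) \<Rightarrow> ('n \<Rightarrow> 'n hardy \<Rightarrow> 'n hardy) \<Rightarrow> bool" where
  "polynomial_model f MZ \<longleftrightarrow>
     (\<forall>j. nc_polynomial (f j)) \<and>
     (\<exists>g. (\<forall>j. nc_polynomial (g j)) \<and>
        (\<forall>j. nc_subst (f j) g = nc_var j) \<and> (\<forall>j. nc_subst (g j) f = nc_var j)) \<and>
     (\<forall>i. bounded_op UNIV (MZ i)) \<and>
     (\<forall>i u. nc_polynomial (l2_nth u) \<longrightarrow>
        nc_polynomial (l2_nth (MZ i u)) \<and>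
        nc_subst (l2_nth (MZ i u)) f = nc_mult (nc_var i) (nc_subst (l2_nth u) f))"

text \<open>The case of formal power series: \<open>\<H>\<^sup>2(f)\<close> is the set of power series
  \<open>range (\<lambda>u. nc_subst (l2_nth u) f)\<close>.\<close>

definition series_model ::
  "('n \<Rightarrow> 'n::finite ncseries) \<Rightarrow> ('n \<Rightarrow> 'n hardy \<Rightarrow> 'n hardy) \<Rightarrow> bool" where
  "series_model f MZ \<longleftrightarrow>
     (\<forall>j. f j [] = 0) \<and> (\<forall>j. nc_radius (f j) \<noteq> 0) \<and> det (\<chi> i j. f i [j]) \<noteq> 0 \<and>
     (\<forall>i. nc_var i \<in> range (\<lambda>u :: 'n hardy. nc_subst (l2_nth u) f)) \<and>
     (\<forall>i. bounded_op UNIV (MZ i)) \<and>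
     (\<forall>i u. nc_subst (l2_nth (MZ i u)) f = nc_mult (nc_var i) (nc_subst (l2_nth u) f)) \<and>
     MZ \<in> conv_SOT f UNIV \<union> conv_rad f UNIV \<and>
     (\<forall>j u. nc_subst (l2_nth (eval_tuple f UNIV MZ j u)) f = nc_mult (f j) (nc_subst (l2_nth u) f))"

text \<open>\<open>\<ell>\<^sup>2(\<nat>)\<close> serves as the separable infinite-dimensional Hilbert space on which free holomorphic
  functions are evaluated; \<open>op_ball \<gamma>\<close> is the open ball of radius \<open>\<gamma>\<close> with respect to the row norm.\<close>

type_synonym sep_op = "(nat, complex) l2 \<Rightarrow> (nat, complex) l2"

definition row_norm :: "('n::finite \<Rightarrow> sep_op) \<Rightarrow> real" where
  "row_norm X = sqrt (onorm (\<lambda>h. \<Sum>i\<in>UNIV. X i (adj UNIV (X i) h)))"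

definition op_ball :: "real \<Rightarrow> ('n::finite \<Rightarrow> sep_op) set" where
  "op_ball \<gamma> = {X. (\<forall>i. bounded_op UNIV (X i)) \<and> row_norm X < \<gamma>}"

definition free_holomorphic :: "real \<Rightarrow> 'n::finite ncseries \<Rightarrow> bool" where
  "free_holomorphic \<gamma> c \<longleftrightarrow> ereal \<gamma> \<le> nc_radius c"

definition tuple_at :: "('n \<Rightarrow> 'n::finite ncseries) \<Rightarrow> ('n \<Rightarrow> sep_op) \<Rightarrow> 'n \<Rightarrow> sep_op" where
  "tuple_at f X j = series_at (f j) X"

text \<open>The case of free holomorphic functions: \<open>u\<close> stands for the function \<open>G \<circ> f\<close> on \<open>op_ball \<gamma>\<close>,
  where \<open>G\<close> is the element of the Hardy space \<open>H\<^sup>2\<close> of the ball with coefficients \<open>l2_nth u\<close>.\<close>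

definition holomorphic_model ::
  "('n \<Rightarrow> 'n::finite ncseries) \<Rightarrow> ('n \<Rightarrow> 'n hardy \<Rightarrow> 'n hardy) \<Rightarrow> bool" where
  "holomorphic_model f MZ \<longleftrightarrow> (\<exists>\<gamma>>0.
     (\<forall>j. free_holomorphic \<gamma> (f j)) \<and>
     (\<forall>X\<in>op_ball \<gamma>. tuple_at f X \<in> op_ball 1) \<and>
     (\<forall>G. free_holomorphic 1 G \<longrightarrow> (\<exists>\<alpha>. G \<alpha> \<noteq> 0) \<longrightarrow>
        (\<exists>X\<in>op_ball \<gamma>. \<exists>h. series_at G (tuple_at f X) h \<noteq> 0)) \<and>
     (\<forall>i. \<exists>u :: 'n hardy. \<forall>X\<in>op_ball \<gamma>. series_at (l2_nth u) (tuple_at f X) = X i) \<and>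
     (\<forall>i. bounded_op UNIV (MZ i)) \<and>
     (\<forall>i u. \<forall>X\<in>op_ball \<gamma>.
        series_at (l2_nth (MZ i u)) (tuple_at f X) = X i \<circ> series_at (l2_nth u) (tuple_at f X)) \<and>
     MZ \<in> conv_SOT f UNIV \<union> conv_rad f UNIV \<and>
     (\<forall>j u. \<forall>X\<in>op_ball \<gamma>.
        series_at (l2_nth (eval_tuple f UNIV MZ j u)) (tuple_at f X) =
          tuple_at f X j \<circ> series_at (l2_nth u) (tuple_at f X)))"

text \<open>\<open>f\<close> has the model property, and \<open>MZ\<close> is its universal model.\<close>

definition universal_model ::
  "('n \<Rightarrow> 'n::finite ncseries) \<Rightarrow> ('n \<Rightarrow> 'n hardy \<Rightarrow> 'n hardy) \<Rightarrow> bool" where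
  "universal_model f MZ \<longleftrightarrow>
     polynomial_model f MZ \<or> series_model f MZ \<or> holomorphic_model f MZ"


section \<open>Rank and curvature\<close>

text \<open>These are stated as formulas in \<open>f(T)\<close>, for every tuple \<open>T\<close> on \<open>H\<close>; they are meaningful on the
  domain \<open>\<B>\<^sub>f(H)\<close>, which contains the restrictions of \<open>M\<^sub>Z\<close> to its invariant subspaces.\<close>

definition defect ::
  "('n \<Rightarrow> 'n::finite ncseries) \<Rightarrow> 'a set \<Rightarrow> ('n \<Rightarrow> 'a \<Rightarrow> 'a) \<Rightarrow> 'a \<Rightarrow> 'a::complex_hilbert_space" where
  "defect f H T = pos_sqrt H (\<lambda>h. h - (\<Sum>i\<in>UNIV. eval_tuple f H T i (adj H (eval_tuple f H T i) h)))"

definition rank_f ::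
  "('n \<Rightarrow> 'n::finite ncseries) \<Rightarrow> 'a set \<Rightarrow> ('n \<Rightarrow> 'a \<Rightarrow> 'a::complex_hilbert_space) \<Rightarrow> enat" where
  "rank_f f H T = cdimension (defect f H T ` H)"

text \<open>In \<open>\<H>\<^sup>2(f) \<otimes> \<D>\<close>, viewed inside \<open>('n list, 'a) l2\<close>, the vector \<open>f\<^sub>\<alpha> \<otimes> d\<close> is \<open>l2_single \<alpha> d\<close>.\<close>

definition poisson_kernel ::
  "('n \<Rightarrow> 'n::finite ncseries) \<Rightarrow> 'a set \<Rightarrow> ('n \<Rightarrow> 'a \<Rightarrow> 'a) \<Rightarrow> 'a \<Rightarrow>
   ('n list, 'a::complex_hilbert_space) l2" where
  "poisson_kernel f H T h =
     (\<Sum>\<^sub>\<infinity>\<alpha>. l2_single \<alpha> (defect f H T (adj H (op_word (eval_tuple f H T) \<alpha>) h)))"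

text \<open>\<open>Q\<^sub>\<le>\<^sub>m \<otimes> I\<close>.\<close>

lift_definition trunc :: "nat \<Rightarrow> ('n list, 'b::complex_hilbert_space) l2 \<Rightarrow> ('n list, 'b) l2" is
  "\<lambda>m x \<alpha>. if length \<alpha> \<le> m then x \<alpha> else 0"
  by (erule summable_on_comparison_test) auto

text \<open>The trace of \<open>K\<^sup>*(Q\<^sub>\<le>\<^sub>m \<otimes> I)K\<close> is real because the operator is positive.\<close>

definition poisson_trace ::
  "('n \<Rightarrow> 'n::finite ncseries) \<Rightarrow> 'a set \<Rightarrow> ('n \<Rightarrow> 'a \<Rightarrow> 'a::complex_hilbert_space) \<Rightarrow> nat \<Rightarrow> real" where
  "poisson_trace f H T m =
     Re (trace_op H (\<lambda>h. adj H (poisson_kernel f H T) (trunc m (poisson_kernel f H T h))))"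

definition curv_f ::
  "('n \<Rightarrow> 'n::finite ncseries) \<Rightarrow> ('n \<Rightarrow> 'n hardy \<Rightarrow> 'n hardy) \<Rightarrow>
   'a set \<Rightarrow> ('n \<Rightarrow> 'a \<Rightarrow> 'a::complex_hilbert_space) \<Rightarrow> real" where
  "curv_f f MZ H T = lim (\<lambda>m. poisson_trace f H T m / poisson_trace f UNIV MZ m)"

end

(* Under the identification of H^2(f) with the square-summable families indexed by words, each of the
   three cases of the model property yields the same two facts: f_j(M_Z) is the left creation operator
   L_j, and every M_{Z_i} commutes with the right creation operators (both because u |-> sum u_alpha
   f_alpha is injective).  An invariant subspace M of M_Z is L_j-invariant, as L_j is a limit of
   polynomials in M_Z.  By the Wold decomposition M is the orthogonal sum of the spaces L_alpha W over all
   words alpha, where W is the orthogonal complement of the sum of the L_j M in M.  The defect operator is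
   the projection onto W, so the rank is dim W, and Parseval's identity gives the trace
   dim W * (1 + n + ... + n^m), so the curvature is dim W as well.  A unitary W_M -> W_N extends to
   M -> N, intertwines the L_j, and intertwines M_{Z_i} because M_{Z_i} L_alpha w is a norm-convergent
   series of vectors L_beta w.  Conversely an intertwining unitary maps W_M onto W_N. *)
theory Submission
  imports Defs
begin

section \<open>Complex Hilbert spaces\<close>

\<comment> \<open>Knowing that \<open>f_j(M_Z)\<close> is left creation does not by itself make a
  unitary between wandering spaces intertwine the \<open>M_{Z_i}\<close>. The coefficients of
  \<open>Z_i\<close> in the basis are only square-summable, so the series of left creation operators
  with these coefficients is not known to converge on a general vector. On a shifted wandering
  vector it does, its terms being orthogonal; and its coefficients depend on the index
  \<open>i\<close> and the shifting word alone, not on the wandering vector. Commutation with right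
  creation supplies them: such an operator is determined by its value at one basis vector.
  Injectivity of the representation has a different source in each case: in (A), substituting the
  inverse \<open>g\<close> undoes substituting \<open>f\<close>; in (S), the coefficient matrix is
  triangular by degree, with tensor powers of the Jacobian on the diagonal; in (F), it is the
  nondegeneracy hypothesis. Restriction to a subspace has one hidden difficulty: the series may
  converge strongly there without doing so on the whole space, and \<open>eval_tuple\<close> then
  switches from the radial limit to the plain sum. Abel's theorem closes this gap.\<close>
subclass (in complex_hilbert_space) banach ..

lemma cinner_add_right: "cinner x (y + z) = cinner x y + cinner x (z :: 'a::complex_hilbert_space)"
  by (metis cinner_add_left cinner_commute complex_cnj_add)

lemma cinner_scaleC_right: "cinner x (c *\<^sub>C y) = cnj c * cinner x (y :: 'a::complex_hilbert_space)"
  by (metis cinner_commute cinner_scaleC_left complex_cnj_mult)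

lemma bounded_linear_cinner_left: "bounded_linear (\<lambda>x. cinner x (y :: 'a::complex_hilbert_space))"
  by (rule bounded_linear_intro[where K = "2 * norm y"])
     (use norm_cinner_le[of _ y] in \<open>auto simp: cinner_add_left scaleR_scaleC cinner_scaleC_left
       scaleR_scaleC scaleC_complex_def mult_ac\<close>)

lemma bounded_linear_cinner_right: "bounded_linear (cinner (x :: 'a::complex_hilbert_space))"
  by (rule bounded_linear_intro[where K = "2 * norm x"])
     (use norm_cinner_le[of x] in \<open>auto simp: cinner_add_right scaleR_scaleC cinner_scaleC_right
       scaleR_scaleC scaleC_complex_def mult_ac\<close>)

lemma bounded_linear_scaleC: "bounded_linear ((*\<^sub>C) c :: 'a::complex_hilbert_space \<Rightarrow> 'a)"
  by (rule bounded_linear_intro[where K = "cmod c"])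
     (auto simp: scaleC_add_right scaleR_scaleC scaleC_scaleC norm_scaleC mult_ac)

lemmas cinner_diff_left = linear_diff[OF bounded_linear.linear, OF bounded_linear_cinner_left]
lemmas cinner_diff_right = linear_diff[OF bounded_linear.linear, OF bounded_linear_cinner_right]
lemmas cinner_sum_left = linear_sum[OF bounded_linear.linear, OF bounded_linear_cinner_left]
lemmas cinner_sum_right = linear_sum[OF bounded_linear.linear, OF bounded_linear_cinner_right]

lemma cinner_zero_left [simp]: "cinner 0 (x :: 'a::complex_hilbert_space) = 0"
  by (rule linear_0) (rule bounded_linear.linear[OF bounded_linear_cinner_left])

lemma cinner_zero_right [simp]: "cinner (x :: 'a::complex_hilbert_space) 0 = 0"
  by (rule linear_0) (rule bounded_linear.linear[OF bounded_linear_cinner_right])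

lemma cinner_self: "cinner x x = complex_of_real ((norm (x :: 'a::complex_hilbert_space))\<^sup>2)"
proof (rule complex_eqI)
  show "Re (cinner x x) = Re (complex_of_real ((norm x)\<^sup>2))"
    by (simp only: Re_complex_of_real power2_norm_eq_inner inner_cinner)
  show "Im (cinner x x) = Im (complex_of_real ((norm x)\<^sup>2))"
    using cinner_commute[of x x] by (metis Im_complex_of_real complex_cnj_cancel_iff
      complex_eq_iff cnj.simps(2) equal_neg_zero)
qed

lemma cinner_self_eq_0_iff [simp]: "cinner x x = 0 \<longleftrightarrow> x = (0 :: 'a::complex_hilbert_space)"
  by (simp add: cinner_self)

lemma cmod_cinner_commute: "cmod (cinner x y) = cmod (cinner y (x :: 'a::complex_hilbert_space))"
  by (metis cinner_commute complex_mod_cnj)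

section \<open>Closed complex subspaces, Riesz representation and adjoints\<close>

lemma csubspace_diff:
  "complex_vector.subspace H \<Longrightarrow> x \<in> H \<Longrightarrow> y \<in> H \<Longrightarrow> x - y \<in> (H :: 'a::complex_hilbert_space set)"
  by (rule complex_vector.subspace_diff)

lemma csubspace_scaleR:
  "complex_vector.subspace H \<Longrightarrow> x \<in> H \<Longrightarrow> r *\<^sub>R x \<in> (H :: 'a::complex_hilbert_space set)"
  by (simp add: scaleR_scaleC complex_vector.subspace_scale)

lemma cinner_ext:
  assumes "complex_vector.subspace (H :: 'a::complex_hilbert_space set)" "x \<in> H" "y \<in> H"
    and "\<And>h. h \<in> H \<Longrightarrow> cinner h x = cinner h y"
  shows "x = y"
proof -
  have "cinner (x - y) (x - y) = 0"
    using assms(4)[OF csubspace_diff[OF assms(1-3)]] by (simp add: cinner_diff_right)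
  then show ?thesis by simp
qed

lemma csubspace_closure:
  assumes "complex_vector.subspace (H :: 'a::complex_hilbert_space set)"
  shows "complex_vector.subspace (closure H)"
proof (rule complex_vector.subspaceI)
  show "0 \<in> closure H"
    using assms closure_subset complex_vector.subspace_0 by blast
next
  fix x y assume "x \<in> closure H" "y \<in> closure H"
  then obtain xs ys where "\<And>n. xs n \<in> H" "xs \<longlonglongrightarrow> x" "\<And>n. ys n \<in> H" "ys \<longlonglongrightarrow> y"
    by (auto simp: closure_sequential)
  then show "x + y \<in> closure H"
    unfolding closure_sequential
    by (intro exI[of _ "\<lambda>n. xs n + ys n"])
       (auto intro!: tendsto_add complex_vector.subspace_add[OF assms])
next
  fix c x assume "x \<in> closure H"
  then obtain xs where "\<And>n. xs n \<in> H" "xs \<longlonglongrightarrow> x"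
    by (auto simp: closure_sequential)
  then show "c *\<^sub>C x \<in> closure H"
    unfolding closure_sequential
    by (intro exI[of _ "\<lambda>n. c *\<^sub>C xs n"])
       (auto intro!: bounded_linear.tendsto[OF bounded_linear_scaleC]
          complex_vector.subspace_scale[OF assms])
qed

text \<open>The representing vector is the minimiser over \<open>H\<close> of the quadratic
  functional \<open>J\<close>. Boundedness of \<open>\<phi>\<close> keeps \<open>J\<close> bounded
  below, the parallelogram law makes a minimising sequence Cauchy, and the vanishing first variation
  at the minimiser is the claimed identity.\<close>

lemma riesz_representation_real:
  fixes H :: "'a::complex_hilbert_space set" and \<phi> :: "'a \<Rightarrow> real"
  assumes H: "complex_vector.subspace H" "closed H"
    and add: "\<And>x y. x \<in> H \<Longrightarrow> y \<in> H \<Longrightarrow> \<phi> (x + y) = \<phi> x + \<phi> y"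
    and scale: "\<And>r x. x \<in> H \<Longrightarrow> \<phi> (r *\<^sub>R x) = r * \<phi> x"
    and bdd: "\<And>x. x \<in> H \<Longrightarrow> \<bar>\<phi> x\<bar> \<le> C * norm x"
  shows "\<exists>z\<in>H. \<forall>h\<in>H. \<phi> h = inner h z"
proof -
  define J where "J x = (norm x)\<^sup>2 - 2 * \<phi> x" for x
  define d where "d = Inf (J ` H)"
  have H0: "0 \<in> H" using H(1) complex_vector.subspace_0 by blast
  have diff: "\<phi> (x - y) = \<phi> x - \<phi> y" if "x \<in> H" "y \<in> H" for x y
    using add[of "x - y" y] csubspace_diff[OF H(1) that] that by simp
  have "J x \<ge> - C\<^sup>2" if "x \<in> H" for x
  proof -
    have "0 \<le> (norm x - C)\<^sup>2" by simp
    then show ?thesis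
      using bdd[OF that] by (simp add: J_def power2_diff abs_le_iff mult.commute)
  qed
  then have bb: "bdd_below (J ` H)" by (auto intro!: bdd_belowI[of _ "- C\<^sup>2"])
  then have dle: "d \<le> J x" if "x \<in> H" for x
    using that unfolding d_def by (intro cInf_lower) auto
  have "\<exists>x\<in>H. J x < d + 1 / real (Suc n)" for n
    using cInf_lessD[of "J ` H" "d + 1 / real (Suc n)"] H0 by (auto simp: d_def)
  then obtain xs where xs: "\<And>n. xs n \<in> H" "\<And>n. J (xs n) < d + 1 / real (Suc n)"
    by metis
  \<comment> \<open>The midpoint \<open>m\<close> lies in \<open>H\<close>, so \<open>J m\<close> is
    at least \<open>d\<close>; the linear terms of \<open>J\<close> cancel in the parallelogram
    law.\<close>
  have par: "(norm (x - y))\<^sup>2 \<le> 2 * (J x - d) + 2 * (J y - d)" if "x \<in> H" "y \<in> H" for x y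
  proof -
    define m where "m = (1/2) *\<^sub>R (x + y)"
    have "m \<in> H" unfolding m_def
      using that H(1) by (intro csubspace_scaleR complex_vector.subspace_add)
    have "\<phi> m = (\<phi> x + \<phi> y) / 2"
      unfolding m_def using that H(1)
      by (subst scale) (auto simp: add intro: complex_vector.subspace_add)
    moreover have "4 * (norm m)\<^sup>2 + (norm (x - y))\<^sup>2 = 2 * (norm x)\<^sup>2 + 2 * (norm y)\<^sup>2"
      unfolding m_def power2_norm_eq_inner
      by (simp add: inner_add_left inner_add_right inner_diff_left inner_diff_right inner_commute field_simps)
    ultimately have "(norm (x - y))\<^sup>2 = 2 * J x + 2 * J y - 4 * J m"
      by (simp add: J_def field_simps)
    with dle[OF \<open>m \<in> H\<close>] show ?thesis by simp
  qed
  have "Cauchy xs"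
  proof (rule metric_CauchyI)
    fix e :: real assume "e > 0"
    \<comment> \<open>Beyond index \<open>k\<close> each of the two excesses over \<open>d\<close>
      is below \<open>1 / Suc k\<close>, and \<open>par\<close> weights each of them by 2; hence the
      4.\<close>
    obtain k where k: "4 / e\<^sup>2 < real k" using reals_Archimedean2 by blast
    have "dist (xs m) (xs n) < e" if "m \<ge> k" "n \<ge> k" for m n
    proof -
      have le: "1 / real (Suc i) \<le> 1 / real (Suc k)" if "i \<ge> k" for i
        using that by (simp add: field_simps)
      have bd: "J (xs i) - d < 1 / real (Suc k)" if "i \<ge> k" for i
        using xs(2)[of i] le[OF that] by simp
      have "(norm (xs m - xs n))\<^sup>2 \<le> 2 * (J (xs m) - d) + 2 * (J (xs n) - d)"
        by (rule par) (simp_all add: xs)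
      also have "\<dots> < 4 / real (Suc k)"
        using bd[OF that(1)] bd[OF that(2)] by simp
      also have "\<dots> < e\<^sup>2"
      proof -
        have "4 < real k * e\<^sup>2" using k \<open>e > 0\<close> by (simp add: pos_divide_less_eq)
        also have "\<dots> \<le> real (Suc k) * e\<^sup>2" by (intro mult_right_mono) auto
        finally have "4 < e\<^sup>2 * real (Suc k)" by (simp only: mult.commute)
        then show ?thesis by (subst pos_divide_less_eq) simp_all
      qed
      finally show ?thesis
        unfolding dist_norm by (rule power2_less_imp_less) (use \<open>e > 0\<close> in simp)
    qed
    then show "\<exists>M. \<forall>m\<ge>M. \<forall>n\<ge>M. dist (xs m) (xs n) < e" by blast
  qed
  then obtain z where z: "xs \<longlonglongrightarrow> z" by (auto simp: Cauchy_convergent_iff convergent_def)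
  have zH: "z \<in> H" using closed_sequentially[OF H(2) xs(1) z] .
  have "(\<lambda>n. \<phi> (xs n)) \<longlonglongrightarrow> \<phi> z"
  proof (rule LIM_zero_cancel, rule Lim_null_comparison)
    show "\<forall>\<^sub>F n in sequentially. norm (\<phi> (xs n) - \<phi> z) \<le> C * norm (xs n - z)"
      using bdd csubspace_diff[OF H(1)] xs(1) zH by (auto simp: diff[symmetric])
    have "(\<lambda>n. C * norm (xs n - z)) \<longlonglongrightarrow> C * norm (z - z)" by (intro tendsto_intros z)
    then show "(\<lambda>n. C * norm (xs n - z)) \<longlonglongrightarrow> 0" by simp
  qed
  then have "(\<lambda>n. J (xs n)) \<longlonglongrightarrow> J z" unfolding J_def by (intro tendsto_intros z)
  moreover have "(\<lambda>n. d + 1 / real (Suc n)) \<longlonglongrightarrow> d + 0"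
    by (intro tendsto_intros LIMSEQ_Suc lim_1_over_n)
  ultimately have Jz: "J z \<le> d"
    using LIMSEQ_le[of "\<lambda>n. J (xs n)" "J z" "\<lambda>n. d + 1 / real (Suc n)" "d + 0"] xs(2)
    by (force intro: less_imp_le)
  have "\<phi> h = inner h z" if h: "h \<in> H" for h
  proof (cases "h = 0")
    case True
    then show ?thesis using scale[OF H0, of 0] by simp
  next
    case False
    define a where "a = \<phi> h - inner h z"
    \<comment> \<open>The step length at which the increment of \<open>J\<close> along
      \<open>h\<close> is smallest; there it equals \<open>- a\<^sup>2 / (norm h)\<^sup>2\<close>,
      which minimality of \<open>z\<close> forbids unless \<open>a = 0\<close>.\<close>
    define t where "t = a / (norm h)\<^sup>2"
    have th: "t *\<^sub>R h \<in> H" using csubspace_scaleR[OF H(1) h] .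
    have "J z \<le> J (z + t *\<^sub>R h)"
      using Jz dle[of "z + t *\<^sub>R h"] complex_vector.subspace_add[OF H(1) zH th] by simp
    also have "J (z + t *\<^sub>R h) = J z + t\<^sup>2 * (norm h)\<^sup>2 - 2 * t * a"
      unfolding J_def a_def add[OF zH th] scale[OF h] power2_norm_eq_inner
      by (simp add: inner_add_left inner_add_right inner_commute algebra_simps power2_eq_square)
    finally have "2 * t * a \<le> t\<^sup>2 * (norm h)\<^sup>2" by simp
    moreover have "t\<^sup>2 * (norm h)\<^sup>2 = t * a"
      using False by (simp add: t_def power2_eq_square)
    moreover have "t * a = a\<^sup>2 / (norm h)\<^sup>2" by (simp add: t_def power2_eq_square)
    ultimately have "a\<^sup>2 / (norm h)\<^sup>2 \<le> 0" by simp
    then have "a = 0" using False by (simp add: divide_le_0_iff)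
    then show ?thesis by (simp add: a_def)
  qed
  with zH show ?thesis by blast
qed

text \<open>The real part determines a complex-linear functional: its value at
  \<open>\<i> *\<^sub>C h\<close> has real part \<open>- Im (\<phi> h)\<close>.\<close>

lemma riesz_representation:
  fixes H :: "'a::complex_hilbert_space set" and \<phi> :: "'a \<Rightarrow> complex"
  assumes H: "complex_vector.subspace H" "closed H"
    and add: "\<And>x y. x \<in> H \<Longrightarrow> y \<in> H \<Longrightarrow> \<phi> (x + y) = \<phi> x + \<phi> y"
    and scale: "\<And>c x. x \<in> H \<Longrightarrow> \<phi> (c *\<^sub>C x) = c * \<phi> x"
    and bdd: "\<And>x. x \<in> H \<Longrightarrow> cmod (\<phi> x) \<le> C * norm x"
  shows "\<exists>z\<in>H. \<forall>h\<in>H. \<phi> h = cinner h z"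
proof -
  have "\<exists>z\<in>H. \<forall>h\<in>H. Re (\<phi> h) = inner h z"
  proof (rule riesz_representation_real[OF H, where C = C])
    fix x assume x: "x \<in> H"
    show "Re (\<phi> (r *\<^sub>R x)) = r * Re (\<phi> x)" for r using x by (simp add: scaleR_scaleC scale)
    show "\<bar>Re (\<phi> x)\<bar> \<le> C * norm x" using bdd[OF x] abs_Re_le_cmod[of "\<phi> x"] by linarith
  qed (simp add: add)
  then obtain z where z: "z \<in> H" "\<And>h. h \<in> H \<Longrightarrow> Re (\<phi> h) = inner h z" by blast
  have "\<phi> h = cinner h z" if h: "h \<in> H" for h
  proof (rule complex_eqI)
    show "Re (\<phi> h) = Re (cinner h z)" using z(2)[OF h] by (simp add: inner_cinner)
    have "Re (\<phi> (\<i> *\<^sub>C h)) = inner (\<i> *\<^sub>C h) z"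
      by (rule z(2)) (rule complex_vector.subspace_scale[OF H(1) h])
    then show "Im (\<phi> h) = Im (cinner h z)" by (simp add: scale[OF h] Im_cinner)
  qed
  with z(1) show ?thesis by blast
qed

text \<open>Riesz representation on \<open>H\<close> of the functional given by pairing with
  \<open>y\<close>. The vector \<open>y\<close> may lie outside \<open>H\<close>; \<open>p\<close>
  is its orthogonal projection.\<close>

lemma orthogonal_projection_exists:
  fixes H :: "'a::complex_hilbert_space set"
  assumes "complex_vector.subspace H" "closed H"
  shows "\<exists>p\<in>H. \<forall>h\<in>H. cinner h y = cinner h p"
proof (rule riesz_representation[OF assms, where C = "2 * norm y"])
  show "cmod (cinner x y) \<le> 2 * norm y * norm x" for x
    using norm_cinner_le[of x y] by (simp add: mult_ac)
qed (simp_all add: cinner_add_left cinner_scaleC_left)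

text \<open>\<open>adj\<close> is a definite description, so exhibiting one candidate inside
  \<open>H\<close> computes it. This also evaluates the adjoint of the Poisson kernel, whose
  boundedness is never established.\<close>

lemma adj_eqI:
  assumes "complex_vector.subspace H" "z \<in> H" "\<And>h. h \<in> H \<Longrightarrow> cinner (A h) y = cinner h z"
  shows "adj H A y = z"
  unfolding adj_def
proof (rule the_equality)
  fix w assume "w \<in> H \<and> (\<forall>h\<in>H. cinner (A h) y = cinner h w)"
  then show "w = z" using assms by (intro cinner_ext[OF assms(1)]) auto
qed (use assms in auto)

lemma
  assumes H: "complex_vector.subspace H" "closed H" and A: "bounded_op H A"
  shows adj_in: "adj H A y \<in> H"
    and cinner_adj: "h \<in> H \<Longrightarrow> cinner (A h) y = cinner h (adj H A y)"
proof -
  obtain C where C: "\<And>x. x \<in> H \<Longrightarrow> norm (A x) \<le> C * norm x"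
    using A unfolding bounded_op_def by blast
  have "\<exists>z\<in>H. \<forall>h\<in>H. cinner (A h) y = cinner h z"
  proof (rule riesz_representation[OF H, where C = "2 * C * norm y"])
    show "cmod (cinner (A x) y) \<le> 2 * C * norm y * norm x" if "x \<in> H" for x
      using norm_cinner_le[of "A x" y] mult_right_mono[OF C[OF that], of "norm y"]
      by (simp add: mult_ac)
  qed (use A in \<open>auto simp: bounded_op_def cinner_add_left cinner_scaleC_left\<close>)
  then obtain z where "z \<in> H" "\<And>h. h \<in> H \<Longrightarrow> cinner (A h) y = cinner h z" by blast
  moreover from this have "adj H A y = z" by (intro adj_eqI[OF H(1)])
  ultimately show "adj H A y \<in> H" "h \<in> H \<Longrightarrow> cinner (A h) y = cinner h (adj H A y)" by auto
qed

lemma adj_cong: "(\<And>h. h \<in> H \<Longrightarrow> A h = B h) \<Longrightarrow> adj H A y = adj H B y"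
  unfolding adj_def by (intro arg_cong[of _ _ The] ext) auto

lemma bounded_op_UNIV_bounded_linear:
  assumes "bounded_op UNIV A"
  shows "bounded_linear A"
proof -
  obtain C where "\<And>x. norm (A x) \<le> C * norm x" using assms unfolding bounded_op_def by blast
  then show ?thesis
    using assms by (intro bounded_linear_intro[where K = C])
      (auto simp: bounded_op_def scaleR_scaleC mult.commute)
qed

lemma bounded_op_scaleC: "bounded_op H A \<Longrightarrow> x \<in> H \<Longrightarrow> A (c *\<^sub>C x) = c *\<^sub>C A x"
  by (simp add: bounded_op_def)

lemma bounded_op_compose:
  assumes A: "bounded_op UNIV A" and B: "bounded_op UNIV B"
  shows "bounded_op UNIV (\<lambda>u. A (B u))"
proof -
  obtain K where "\<And>h. norm (A (B h)) \<le> norm h * K"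
    using bounded_linear.bounded[OF bounded_linear_compose[OF A[THEN bounded_op_UNIV_bounded_linear]
      B[THEN bounded_op_UNIV_bounded_linear]]] by blast
  then have "\<exists>C. \<forall>h. norm (A (B h)) \<le> C * norm h" by (auto simp: mult.commute)
  with A B show ?thesis by (simp add: bounded_op_def)
qed

lemma bounded_op_lincomb:
  assumes A: "\<And>i. i \<in> F \<Longrightarrow> bounded_op UNIV (A i)"
  shows "bounded_op UNIV (\<lambda>u. \<Sum>i\<in>F. c i *\<^sub>C A i u)"
proof -
  have "bounded_linear (\<lambda>u. \<Sum>i\<in>F. c i *\<^sub>C A i u)"
    by (intro bounded_linear_sum bounded_linear_compose[OF bounded_linear_scaleC]
        bounded_op_UNIV_bounded_linear A)
  then obtain K where "\<And>h. norm (\<Sum>i\<in>F. c i *\<^sub>C A i h) \<le> norm h * K"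
    using bounded_linear.bounded by blast
  then have "\<exists>C. \<forall>h. norm (\<Sum>i\<in>F. c i *\<^sub>C A i h) \<le> C * norm h" by (auto simp: mult.commute)
  with A show ?thesis
    by (auto simp: bounded_op_def scaleC_add_right sum.distrib complex_vector.scale_sum_right
        scaleC_scaleC mult.commute intro!: sum.cong)
qed

lemma bounded_op_adj:
  assumes "bounded_op UNIV A"
  shows "bounded_op UNIV (adj UNIV A)"
proof -
  have adj: "cinner (A h) y = cinner h (adj UNIV A y)" for h y
    by (rule cinner_adj[OF _ _ assms]) simp_all
  have eqI: "adj UNIV A y = z" if "\<And>h. cinner (A h) y = cinner h z" for y z
    using that by (intro adj_eqI) simp_all
  obtain K where K: "\<And>x. norm (A x) \<le> K * norm x" and "K > 0"
    using bounded_linear.pos_bounded[OF bounded_op_UNIV_bounded_linear[OF assms]]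
    by (auto simp: mult.commute)
  have "norm (adj UNIV A y) \<le> K * norm y" for y
  proof (cases "adj UNIV A y = 0")
    case False
    have "(norm (adj UNIV A y))\<^sup>2 = inner (A (adj UNIV A y)) y"
      unfolding inner_cinner adj cinner_self by simp
    also have "\<dots> \<le> norm (A (adj UNIV A y)) * norm y" by (rule norm_cauchy_schwarz)
    also have "\<dots> \<le> K * norm (adj UNIV A y) * norm y" by (intro mult_right_mono K) simp
    finally show ?thesis using False by (simp add: power2_eq_square mult_ac)
  qed (use \<open>K > 0\<close> in simp)
  then show ?thesis
    unfolding bounded_op_def
    by (auto intro!: eqI simp: cinner_add_right cinner_scaleC_right adj)
qed

section \<open>Orthonormal families\<close>

text \<open>Families rather than sets, because the bases used below are indexed by pairs of a word
  and a wandering vector, and two such bases are matched through a common index set. A set enters as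
  its identity family.\<close>

definition orthonormal_on :: "'i set \<Rightarrow> ('i \<Rightarrow> 'a::complex_hilbert_space) \<Rightarrow> bool" where
  "orthonormal_on I e \<longleftrightarrow> (\<forall>i\<in>I. \<forall>j\<in>I. cinner (e i) (e j) = (if i = j then 1 else 0))"

lemma orthonormal_on_inj: "orthonormal_on I e \<Longrightarrow> inj_on e I"
  unfolding orthonormal_on_def inj_on_def by (metis zero_neq_one)

lemma orthonormal_norm_sum:
  assumes "orthonormal_on I e" "finite F" "F \<subseteq> I"
  shows "(norm (\<Sum>i\<in>F. c i *\<^sub>C e i))\<^sup>2 = (\<Sum>i\<in>F. (cmod (c i))\<^sup>2)"
proof -
  have "cinner (\<Sum>i\<in>F. c i *\<^sub>C e i) (\<Sum>i\<in>F. c i *\<^sub>C e i)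
      = (\<Sum>i\<in>F. \<Sum>j\<in>F. if i = j then c i * cnj (c i) else 0)"
    unfolding cinner_sum_left unfolding cinner_sum_right
  proof (intro sum.cong refl)
    fix i j assume "i \<in> F" "j \<in> F"
    then have "cinner (e i) (e j) = (if i = j then 1 else 0)"
      using assms unfolding orthonormal_on_def by blast
    then show "cinner (c i *\<^sub>C e i) (c j *\<^sub>C e j) = (if i = j then c i * cnj (c i) else 0)"
      by (simp add: cinner_scaleC_left cinner_scaleC_right)
  qed
  also have "\<dots> = of_real (\<Sum>i\<in>F. (cmod (c i))\<^sup>2)"
    using assms(2) by (simp add: complex_norm_square[symmetric] del: of_real_power)
  finally show ?thesis unfolding cinner_self of_real_eq_iff .
qed

lemma bessel_inequality:
  assumes "orthonormal_on I e" "finite F" "F \<subseteq> I"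
  shows "(\<Sum>i\<in>F. (cmod (cinner h (e i)))\<^sup>2) \<le> (norm h)\<^sup>2"
proof -
  define s where "s = (\<Sum>i\<in>F. cinner h (e i) *\<^sub>C e i)"
  have hs: "cinner h s = of_real (\<Sum>i\<in>F. (cmod (cinner h (e i)))\<^sup>2)"
    unfolding s_def cinner_sum_right of_real_sum
    by (intro sum.cong refl) (simp add: cinner_scaleC_right complex_norm_square mult.commute del: of_real_power)
  have ss: "(norm s)\<^sup>2 = (\<Sum>i\<in>F. (cmod (cinner h (e i)))\<^sup>2)"
    unfolding s_def by (rule orthonormal_norm_sum[OF assms])
  have "0 \<le> (norm (h - s))\<^sup>2" by simp
  also have "(norm (h - s))\<^sup>2 = (norm h)\<^sup>2 - 2 * inner h s + (norm s)\<^sup>2"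
    by (simp add: power2_norm_eq_inner inner_diff_left inner_diff_right inner_commute)
  finally show ?thesis using hs ss by (simp add: inner_cinner)
qed

lemma summable_on_cinner_sq:
  assumes "orthonormal_on I e"
  shows "(\<lambda>i. (cmod (cinner h (e i)))\<^sup>2) summable_on I"
  by (rule nonneg_bdd_above_summable_on)
     (auto intro!: bdd_aboveI[of _ "(norm h)\<^sup>2"] bessel_inequality[OF assms])

text \<open>By Pythagoras the distance between two finite partial sums is a piece of the tail of the
  scalar series of squares, so the net of partial sums is Cauchy.\<close>

lemma orthonormal_summable:
  fixes e :: "'i \<Rightarrow> 'a::complex_hilbert_space"
  assumes e: "orthonormal_on I e" and c: "(\<lambda>i. (cmod (c i))\<^sup>2) summable_on I"
  shows "(\<lambda>i. c i *\<^sub>C e i) summable_on I"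
proof -
  define S where "S F = (\<Sum>i\<in>F. c i *\<^sub>C e i)" for F
  have "cauchy_filter (filtermap S (finite_subsets_at_top I))"
    unfolding cauchy_filter_metric_filtermap
  proof (intro allI impI)
    fix \<epsilon> :: real assume "\<epsilon> > 0"
    \<comment> \<open>Any value below \<open>(\<epsilon> / 2)\<^sup>2\<close> serves. The
      approximation gives only a weak inequality, so half of that bound leaves room for the strict
      one.\<close>
    define \<delta> where "\<delta> = \<epsilon>\<^sup>2 / 8"
    have "\<delta> > 0" using \<open>\<epsilon> > 0\<close> by (simp add: \<delta>_def)
    obtain F where F: "finite F" "F \<subseteq> I" "dist (\<Sum>i\<in>F. (cmod (c i))\<^sup>2) (\<Sum>\<^sub>\<infinity>i\<in>I. (cmod (c i))\<^sup>2) \<le> \<delta>"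
      using infsum_finite_approximation[OF c \<open>\<delta> > 0\<close>] by blast
    have near: "dist (S G) (S F) < \<epsilon> / 2" if G: "finite G" "F \<subseteq> G" "G \<subseteq> I" for G
    proof -
      have "S G - S F = (\<Sum>i\<in>G - F. c i *\<^sub>C e i)"
        unfolding S_def using G by (simp add: sum_diff)
      then have "(norm (S G - S F))\<^sup>2 = (\<Sum>i\<in>G - F. (cmod (c i))\<^sup>2)"
        using G by (simp only:) (rule orthonormal_norm_sum[OF e], auto)
      also have "\<dots> = (\<Sum>i\<in>G. (cmod (c i))\<^sup>2) - (\<Sum>i\<in>F. (cmod (c i))\<^sup>2)"
        using G by (simp add: sum_diff)
      also have "\<dots> \<le> \<delta>"
        using F(3) finite_sum_le_infsum[OF c G(1) G(3)] by (auto simp: dist_real_def)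
      also have "\<dots> < (\<epsilon> / 2)\<^sup>2" using \<open>\<epsilon> > 0\<close> by (simp add: \<delta>_def power2_eq_square field_simps)
      finally show ?thesis
        unfolding dist_norm by (rule power2_less_imp_less) (use \<open>\<epsilon> > 0\<close> in simp)
    qed
    have "dist (S G) (S G') < \<epsilon>" if "finite G" "F \<subseteq> G" "G \<subseteq> I" "finite G'" "F \<subseteq> G'" "G' \<subseteq> I" for G G'
      using near[OF that(1-3)] near[OF that(4-6)] dist_triangle2[of "S G" "S G'" "S F"] by linarith
    moreover have "\<forall>\<^sub>F G in finite_subsets_at_top I. finite G \<and> F \<subseteq> G \<and> G \<subseteq> I"
      unfolding eventually_finite_subsets_at_top by (intro exI[of _ F]) (use F in simp)
    ultimately show "\<exists>P. eventually P (finite_subsets_at_top I) \<and>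
        (\<forall>x y. P x \<and> P y \<longrightarrow> dist (S x) (S y) < \<epsilon>)"
      by (intro exI[of _ "\<lambda>G. finite G \<and> F \<subseteq> G \<and> G \<subseteq> I"]) simp
  qed
  then have "convergent_filter (filtermap S (finite_subsets_at_top I))"
    by (rule cauchy_filter_convergent)
  then show ?thesis
    unfolding convergent_filter_iff summable_on_def has_sum_def filterlim_def S_def .
qed

lemma has_sum_sum_finite:
  fixes f :: "'a \<Rightarrow> 'b \<Rightarrow> 'c::{comm_monoid_add, topological_comm_monoid_add}"
  assumes "finite A" "\<And>a. a \<in> A \<Longrightarrow> (f a has_sum s a) B"
  shows "((\<lambda>x. \<Sum>a\<in>A. f a x) has_sum (\<Sum>a\<in>A. s a)) B"
  using assms by (induction A) (auto intro!: has_sum_add)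

lemma has_sum_in_csubspace:
  assumes "complex_vector.subspace H" "closed (H :: 'a::complex_hilbert_space set)"
    and "(f has_sum s) I" "\<And>i. i \<in> I \<Longrightarrow> f i \<in> H"
  shows "s \<in> H"
proof -
  have "((sum f) \<longlongrightarrow> s) (finite_subsets_at_top I)" using assms(3) by (simp add: has_sum_def)
  moreover have "\<forall>\<^sub>F F in finite_subsets_at_top I. sum f F \<in> H"
    using assms(1,4) by (intro eventually_finite_subsets_at_top_weakI)
      (auto intro!: complex_vector.subspace_sum)
  ultimately show ?thesis using assms(2) by (intro Lim_in_closed_set[of H]) auto
qed

text \<open>The series has some sum \<open>s\<close> in the closed span. The remainder
  \<open>h - s\<close> is orthogonal to every \<open>e i\<close>, hence to the closed span, which
  contains it.\<close>

lemma orthonormal_expansion: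
  fixes e :: "'i \<Rightarrow> 'a::complex_hilbert_space"
  assumes e: "orthonormal_on I e" and h: "h \<in> closure (complex_vector.span (e ` I))"
  shows "((\<lambda>i. cinner h (e i) *\<^sub>C e i) has_sum h) I"
proof -
  let ?K = "closure (complex_vector.span (e ` I))"
  have K: "complex_vector.subspace ?K" "closed ?K"
    by (auto intro: csubspace_closure complex_vector.subspace_span)
  obtain s where s: "((\<lambda>i. cinner h (e i) *\<^sub>C e i) has_sum s) I"
    using orthonormal_summable[OF e summable_on_cinner_sq[OF e]] by (auto simp: summable_on_def)
  have "s \<in> ?K"
    by (intro has_sum_in_csubspace[OF K s] set_mp[OF closure_subset] complex_vector.span_scale
        complex_vector.span_base) auto
  have orth: "cinner (e i) (h - s) = 0" if "i \<in> I" for i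
  proof -
    have "((\<lambda>j. cinner (cinner h (e j) *\<^sub>C e j) (e i)) has_sum cinner s (e i)) I"
      by (rule has_sum_bounded_linear[OF bounded_linear_cinner_left s])
    moreover have "cinner (cinner h (e j) *\<^sub>C e j) (e i) = (if j = i then cinner h (e i) else 0)"
      if "j \<in> I" for j
      using e that \<open>i \<in> I\<close> by (simp add: orthonormal_on_def cinner_scaleC_left)
    ultimately have "((\<lambda>j. if j = i then cinner h (e i) else 0) has_sum cinner s (e i)) I"
      by (rule has_sum_cong[THEN iffD1, rotated])
    moreover have "((\<lambda>j. if j = i then cinner h (e i) else 0) has_sum cinner h (e i)) I"
      using that by (intro has_sum_finite_neutralI[where B = "{i}"]) auto
    ultimately have "cinner s (e i) = cinner h (e i)" by (rule has_sum_unique)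
    then have "cinner (h - s) (e i) = 0" by (simp add: cinner_diff_left)
    then show ?thesis by (metis cinner_commute complex_cnj_zero)
  qed
  have "closed {x. cinner x (h - s) = 0}"
    by (rule closed_Collect_eq[OF linear_continuous_on[OF bounded_linear_cinner_left]
        continuous_on_const])
  moreover have "complex_vector.span (e ` I) \<subseteq> {x. cinner x (h - s) = 0}"
    by (rule complex_vector.span_minimal)
       (auto simp: orth cinner_add_left cinner_scaleC_left intro!: complex_vector.subspaceI)
  ultimately have "?K \<subseteq> {x. cinner x (h - s) = 0}" by (rule closure_minimal[rotated])
  then have "cinner (h - s) (h - s) = 0" using csubspace_diff[OF K(1) h \<open>s \<in> ?K\<close>] by blast
  then show ?thesis using s by simp
qed

lemma parseval:
  assumes e: "orthonormal_on I e" and h: "h \<in> closure (complex_vector.span (e ` I))"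
  shows "((\<lambda>i. (cmod (cinner h (e i)))\<^sup>2) has_sum (norm h)\<^sup>2) I"
proof -
  have "((\<lambda>i. cinner (cinner h (e i) *\<^sub>C e i) h) has_sum cinner h h) I"
    by (rule has_sum_bounded_linear[OF bounded_linear_cinner_left orthonormal_expansion[OF assms]])
  moreover have "cinner (cinner h (e i) *\<^sub>C e i) h = of_real ((cmod (cinner h (e i)))\<^sup>2)" for i
    by (metis cinner_scaleC_left cinner_commute complex_norm_square)
  ultimately show ?thesis
    unfolding cinner_self by (simp only: has_sum_of_real_iff)
qed

text \<open>Subtracting from a vector of \<open>M\<close> its projection onto the closed span leaves
  a vector of \<open>M\<close> orthogonal to the family. This turns triviality of the orthogonal
  complement, which is what the Wold argument delivers, into density.\<close>

lemma orthonormal_complete: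
  fixes M :: "'a::complex_hilbert_space set"
  assumes M: "complex_vector.subspace M" "closed M" and "e ` I \<subseteq> M"
    and trivial: "\<And>h. h \<in> M \<Longrightarrow> (\<And>i. i \<in> I \<Longrightarrow> cinner h (e i) = 0) \<Longrightarrow> h = 0"
  shows "closure (complex_vector.span (e ` I)) = M"
proof
  let ?K = "closure (complex_vector.span (e ` I))"
  have K: "complex_vector.subspace ?K" "closed ?K"
    by (auto intro: csubspace_closure complex_vector.subspace_span)
  show KM: "?K \<subseteq> M"
    by (rule closure_minimal[OF complex_vector.span_minimal]) (use assms in auto)
  show "M \<subseteq> ?K"
  proof
    fix y assume "y \<in> M"
    obtain p where p: "p \<in> ?K" "\<And>h. h \<in> ?K \<Longrightarrow> cinner h y = cinner h p"
      using orthogonal_projection_exists[OF K] by blast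
    have "y - p = 0"
    proof (rule trivial)
      show "y - p \<in> M" using csubspace_diff[OF M(1) \<open>y \<in> M\<close>] p(1) KM by blast
      fix i assume "i \<in> I"
      then have "e i \<in> ?K"
        by (intro set_mp[OF closure_subset] complex_vector.span_base) auto
      then have "cinner (e i) (y - p) = 0" by (simp add: p(2) cinner_diff_right)
      then show "cinner (y - p) (e i) = 0" by (metis cinner_commute complex_cnj_zero)
    qed
    then show "y \<in> ?K" using p(1) by simp
  qed
qed

section \<open>Shift operators\<close>

lemma l2_eqI: "(\<And>i. l2_nth x i = l2_nth y i) \<Longrightarrow> x = y"
  by (simp add: l2_nth_inject[symmetric] fun_eq_iff)

lemma l2_nth_sum: "l2_nth (sum f F) i = (\<Sum>k\<in>F. l2_nth (f k) i)"
  by (induction F rule: infinite_finite_induct) (simp_all add: zero_l2.rep_eq plus_l2.rep_eq)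

lemma bounded_linear_l2_nth: "bounded_linear (\<lambda>x. l2_nth x i)"
  by (rule bounded_linear_intro[where K = 1])
     (simp_all add: plus_l2.rep_eq scaleR_l2.rep_eq l2_norm_nth_le)

lemma l2_single_complex: "l2_single i c = c *\<^sub>C l2_single i (1 :: complex)"
  by (rule l2_eqI) (simp add: l2_single.rep_eq scaleC_l2.rep_eq scaleC_complex_def)

text \<open>The squared norm of the remainder after a finite set \<open>F\<close> is exactly the
  total sum of squares minus its part over \<open>F\<close>.\<close>

lemma l2_single_has_sum:
  fixes x :: "('i, 'b::complex_hilbert_space) l2"
  shows "((\<lambda>i. l2_single i (l2_nth x i)) has_sum x) UNIV"
proof -
  define s where "s F = (\<Sum>i\<in>F. l2_single i (l2_nth x i))" for F
  have nth: "l2_nth (x - s F) i = (if i \<in> F then 0 else l2_nth x i)" if "finite F" for F i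
    using that by (simp add: s_def minus_l2.rep_eq l2_nth_sum l2_single.rep_eq if_distrib cong: if_cong)
  have norm: "(norm (x - s F))\<^sup>2 = (norm x)\<^sup>2 - (\<Sum>i\<in>F. (norm (l2_nth x i))\<^sup>2)" if F: "finite F" for F
  proof -
    have "(norm (x - s F))\<^sup>2 = (\<Sum>\<^sub>\<infinity>i\<in>UNIV - F. (norm (l2_nth x i))\<^sup>2)"
      unfolding l2_norm_sq by (rule infsum_cong_neutral) (auto simp: nth[OF F])
    also have "\<dots> = (norm x)\<^sup>2 - (\<Sum>\<^sub>\<infinity>i\<in>F. (norm (l2_nth x i))\<^sup>2)"
      unfolding l2_norm_sq using F by (intro infsum_Diff) (auto simp: l2_nth_summable)
    finally show ?thesis using F by simp
  qed
  have "((\<lambda>F. \<Sum>i\<in>F. (norm (l2_nth x i))\<^sup>2) \<longlongrightarrow> (norm x)\<^sup>2) (finite_subsets_at_top UNIV)"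
    using has_sum_infsum[OF l2_nth_summable[of x]] by (simp add: has_sum_def l2_norm_sq)
  from tendsto_diff[OF tendsto_const[of "(norm x)\<^sup>2"] this]
  have "((\<lambda>F. (norm x)\<^sup>2 - (\<Sum>i\<in>F. (norm (l2_nth x i))\<^sup>2)) \<longlongrightarrow> 0) (finite_subsets_at_top UNIV)"
    by simp
  then have "((\<lambda>F. (norm (x - s F))\<^sup>2) \<longlongrightarrow> 0) (finite_subsets_at_top UNIV)"
    by (rule Lim_transform_eventually)
       (auto intro!: eventually_finite_subsets_at_top_weakI simp: norm)
  then have "((\<lambda>F. sqrt ((norm (x - s F))\<^sup>2)) \<longlongrightarrow> sqrt 0) (finite_subsets_at_top UNIV)"
    by (rule tendsto_real_sqrt)
  then have "((\<lambda>F. norm (s F - x)) \<longlongrightarrow> 0) (finite_subsets_at_top UNIV)"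
    by (simp add: norm_minus_commute)
  then have "(s \<longlongrightarrow> x) (finite_subsets_at_top UNIV)"
    by (simp add: tendsto_norm_zero_iff LIM_zero_iff)
  then show ?thesis by (simp add: has_sum_def s_def[abs_def])
qed

lemma l2_basis_has_sum:
  "((\<lambda>i. l2_nth x i *\<^sub>C l2_single i (1 :: complex)) has_sum x) UNIV"
  using l2_single_has_sum[of x] by (simp add: l2_single_complex[of _ "l2_nth x _"])

text \<open>The polynomial case prescribes \<open>MZ\<close> on polynomials only, in particular on
  basis vectors; this carries identities over to the completion.\<close>

lemma bounded_op_eqI:
  fixes A B :: "('i, complex) l2 \<Rightarrow> ('i, complex) l2"
  assumes A: "bounded_op UNIV A" and B: "bounded_op UNIV B"
    and eq: "\<And>i. A (l2_single i 1) = B (l2_single i 1)"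
  shows "A x = B x"
proof -
  have "((\<lambda>i. A (l2_nth x i *\<^sub>C l2_single i 1)) has_sum A x) UNIV"
    by (rule has_sum_bounded_linear[OF bounded_op_UNIV_bounded_linear[OF A] l2_basis_has_sum])
  moreover have "((\<lambda>i. B (l2_nth x i *\<^sub>C l2_single i 1)) has_sum B x) UNIV"
    by (rule has_sum_bounded_linear[OF bounded_op_UNIV_bounded_linear[OF B] l2_basis_has_sum])
  ultimately show ?thesis
    by (simp add: bounded_op_scaleC[OF A] bounded_op_scaleC[OF B] eq has_sum_unique)
qed

text \<open>One construction for left and right creation: prepending and appending a fixed word are
  two injections of words. \<open>inv \<pi>\<close> is injective on the range of any
  \<open>\<pi>\<close>, so the definition is total.\<close>

lift_definition l2_push :: "('i \<Rightarrow> 'j) \<Rightarrow> ('i, 'b::complex_hilbert_space) l2 \<Rightarrow> ('j, 'b) l2" is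
  "\<lambda>\<pi> x j. if j \<in> range \<pi> then x (inv \<pi> j) else 0"
proof -
  fix \<pi> :: "'i \<Rightarrow> 'j" and x :: "'i \<Rightarrow> 'b"
  assume x: "(\<lambda>i. (norm (x i))\<^sup>2) summable_on UNIV"
  have "(\<lambda>i. (norm (x i))\<^sup>2) summable_on inv \<pi> ` range \<pi>"
    by (rule summable_on_subset_banach[OF x]) simp
  then have "(\<lambda>j. (norm (x (inv \<pi> j)))\<^sup>2) summable_on range \<pi>"
    by (subst (asm) summable_on_reindex) (auto simp: inj_on_inv_into o_def)
  then show "(\<lambda>j. (norm (if j \<in> range \<pi> then x (inv \<pi> j) else 0))\<^sup>2) summable_on UNIV"
    by (rule summable_on_cong_neutral[THEN iffD1, rotated -1]) auto
qed

lemma l2_nth_push [simp]: "inj \<pi> \<Longrightarrow> l2_nth (l2_push \<pi> x) (\<pi> i) = l2_nth x i"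
  by (simp add: l2_push.rep_eq)

lemma l2_nth_push_notin: "j \<notin> range \<pi> \<Longrightarrow> l2_nth (l2_push \<pi> x) j = 0"
  by (simp add: l2_push.rep_eq)

lemma l2_push_single: "inj \<pi> \<Longrightarrow> l2_push \<pi> (l2_single i d) = l2_single (\<pi> i) d"
  by (rule l2_eqI) (auto simp: l2_push.rep_eq l2_single.rep_eq)

lemma l2_push_push:
  assumes "inj \<pi>" "inj \<rho>"
  shows "l2_push \<pi> (l2_push \<rho> x) = l2_push (\<pi> \<circ> \<rho>) x"
proof (rule l2_eqI)
  fix k
  consider i where "k = \<pi> (\<rho> i)" | j where "k = \<pi> j" "j \<notin> range \<rho>" | "k \<notin> range \<pi>"
    by blast
  then show "l2_nth (l2_push \<pi> (l2_push \<rho> x)) k = l2_nth (l2_push (\<pi> \<circ> \<rho>) x) k"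
  proof cases
    case 1
    then show ?thesis
      using assms l2_nth_push[OF inj_compose[OF assms], of x i] by simp
  next
    case 2
    then have "k \<notin> range (\<pi> \<circ> \<rho>)" using assms by (auto dest: injD)
    with 2 assms show ?thesis by (simp add: l2_nth_push_notin)
  next
    case 3
    then have "k \<notin> range (\<pi> \<circ> \<rho>)" by auto
    with 3 show ?thesis by (simp add: l2_nth_push_notin)
  qed
qed

lemma cinner_l2_push:
  assumes "inj \<pi>"
  shows "cinner (l2_push \<pi> x) (l2_push \<pi> y) = cinner x y"
proof -
  have "cinner (l2_push \<pi> x) (l2_push \<pi> y)
      = (\<Sum>\<^sub>\<infinity>j\<in>range \<pi>. cinner (l2_nth (l2_push \<pi> x) j) (l2_nth (l2_push \<pi> y) j))"
    unfolding cinner_l2_def by (rule infsum_cong_neutral) (auto simp: l2_nth_push_notin)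
  also have "\<dots> = cinner x y"
    unfolding cinner_l2_def by (subst infsum_reindex[OF assms]) (simp add: o_def assms)
  finally show ?thesis .
qed

lemma norm_eq_of_cinner: "cinner x x = cinner y y \<Longrightarrow> norm x = norm y"
  unfolding cinner_self of_real_eq_iff by simp

lemma bounded_op_l2_push:
  assumes "inj (\<pi> :: 'i \<Rightarrow> 'i)" "l2_push \<pi> ` H \<subseteq> H"
  shows "bounded_op H (l2_push \<pi>)"
  unfolding bounded_op_def
proof (intro conjI ballI allI)
  show "l2_push \<pi> (x + y) = l2_push \<pi> x + l2_push \<pi> y" for x y
    by transfer (auto simp: fun_eq_iff)
  show "l2_push \<pi> (c *\<^sub>C x) = c *\<^sub>C l2_push \<pi> x" for c x
    by transfer (auto simp: fun_eq_iff)
  show "\<exists>C. \<forall>x\<in>H. norm (l2_push \<pi> x) \<le> C * norm x"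
    by (rule exI[of _ 1]) (simp add: norm_eq_of_cinner[OF cinner_l2_push[OF assms(1)]])
qed fact

text \<open>In the coordinates of the basis \<open>f_\<alpha>\<close> this is left multiplication by
  the product of \<open>f\<close> along the word, the left creation operator; \<open>rshift\<close>
  is the corresponding right multiplication.\<close>

definition lshift :: "'n list \<Rightarrow> 'n hardy \<Rightarrow> 'n hardy" where
  "lshift \<alpha> = l2_push ((@) \<alpha>)"

definition rshift :: "'n list \<Rightarrow> 'n hardy \<Rightarrow> 'n hardy" where
  "rshift \<beta> = l2_push (\<lambda>\<alpha>. \<alpha> @ \<beta>)"

lemma inj_append_left [simp]: "inj ((@) \<alpha>)"
  by (simp add: inj_def)

lemma inj_append_right [simp]: "inj (\<lambda>\<alpha>. \<alpha> @ \<beta>)"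
  by (simp add: inj_def)

lemma lshift_Nil [simp]: "lshift [] x = x"
  by (rule l2_eqI) (use l2_nth_push[of "(@) []" x] in \<open>simp add: lshift_def\<close>)

lemma rshift_Nil [simp]: "rshift [] x = x"
  by (rule l2_eqI) (use l2_nth_push[of "\<lambda>\<alpha>. \<alpha> @ []" x] in \<open>simp add: rshift_def\<close>)

lemma lshift_append: "lshift (\<alpha> @ \<beta>) x = lshift \<alpha> (lshift \<beta> x)"
  by (simp add: lshift_def l2_push_push o_def append_assoc[abs_def] cong: arg_cong[of _ _ l2_push])

lemma lshift_Cons: "lshift (j # \<alpha>) x = lshift [j] (lshift \<alpha> x)"
  using lshift_append[of "[j]" \<alpha> x] by simp

lemma rshift_append: "rshift (\<alpha> @ \<beta>) x = rshift \<beta> (rshift \<alpha> x)"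
  by (simp add: rshift_def l2_push_push o_def)

lemma lshift_single: "lshift \<alpha> (l2_single \<beta> d) = l2_single (\<alpha> @ \<beta>) d"
  by (simp add: lshift_def l2_push_single)

lemma rshift_single: "rshift \<beta> (l2_single \<alpha> d) = l2_single (\<alpha> @ \<beta>) d"
  by (simp add: rshift_def l2_push_single)

lemma bounded_op_lshift: "lshift \<alpha> ` H \<subseteq> H \<Longrightarrow> bounded_op H (lshift \<alpha>)"
  unfolding lshift_def by (rule bounded_op_l2_push) auto

lemma bounded_op_rshift: "bounded_op UNIV (rshift \<beta>)"
  unfolding rshift_def by (rule bounded_op_l2_push) auto

lemma bounded_linear_lshift: "bounded_linear (lshift \<alpha>)"
  by (rule bounded_op_UNIV_bounded_linear) (auto intro: bounded_op_lshift)

lemma cinner_lshift: "cinner (lshift \<alpha> x) (lshift \<alpha> y) = cinner x y"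
  by (simp add: lshift_def cinner_l2_push)

lemma lshift_scaleC: "lshift \<alpha> (c *\<^sub>C x) = c *\<^sub>C lshift \<alpha> x"
  by (rule bounded_op_scaleC[of UNIV]) (auto intro: bounded_op_lshift)

lemma l2_nth_lshift:
  "l2_nth (lshift \<alpha> x) \<gamma> = (if take (length \<alpha>) \<gamma> = \<alpha> then l2_nth x (drop (length \<alpha>) \<gamma>) else 0)"
proof (cases "take (length \<alpha>) \<gamma> = \<alpha>")
  case True
  then have "\<gamma> = \<alpha> @ drop (length \<alpha>) \<gamma>" by (metis append_take_drop_id)
  then show ?thesis
    using True l2_nth_push[of "(@) \<alpha>" x "drop (length \<alpha>) \<gamma>"] by (simp add: lshift_def)
next
  case False
  then have "\<gamma> \<notin> range ((@) \<alpha>)" by auto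
  then show ?thesis using False by (simp add: lshift_def l2_nth_push_notin)
qed

lemma l2_nth_rshift_append [simp]: "l2_nth (rshift \<beta> x) (\<alpha> @ \<beta>) = l2_nth x \<alpha>"
  using l2_nth_push[of "\<lambda>\<alpha>. \<alpha> @ \<beta>" x \<alpha>] by (simp add: rshift_def)

lemma l2_nth_rshift_eq_0: "(\<And>\<alpha>. \<gamma> \<noteq> \<alpha> @ \<beta>) \<Longrightarrow> l2_nth (rshift \<beta> x) \<gamma> = 0"
  unfolding rshift_def by (rule l2_nth_push_notin) auto

lemma cinner_lshift_disjoint:
  assumes "i \<noteq> j"
  shows "cinner (lshift (i # \<alpha>) x) (lshift (j # \<beta>) y) = 0"
proof -
  have "cinner (l2_nth (lshift (i # \<alpha>) x) \<gamma>) (l2_nth (lshift (j # \<beta>) y) \<gamma>) = 0" for \<gamma>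
    using assms by (cases \<gamma>) (auto simp: l2_nth_lshift)
  then show ?thesis by (simp add: cinner_l2_def)
qed

section \<open>Square roots and finite-dimensional subspaces\<close>

text \<open>\<open>pos_sqrt\<close> demands a nonnegative quadratic form but not self-adjointness.
  Over the complex numbers the latter follows by polarisation: the form is real at
  \<open>x + y\<close> and at \<open>x + \<i> *\<^sub>C y\<close>.\<close>

lemma positive_op_hermitian:
  assumes H: "complex_vector.subspace H" and S: "bounded_op H S"
    and pos: "\<And>h. h \<in> H \<Longrightarrow> cinner (S h) h \<in> \<real>" and x: "x \<in> H" and y: "y \<in> H"
  shows "cinner (S x) y = cinner x (S y)"
proof -
  define b where "b u v = cinner (S u) v" for u v
  have add: "S (u + v) = S u + S v" if "u \<in> H" "v \<in> H" for u v
    using S that by (simp add: bounded_op_def)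
  have real: "Im (b u u) = 0" if "u \<in> H" for u
    using pos[OF that] by (simp add: b_def complex_is_Real_iff)
  have iy: "\<i> *\<^sub>C y \<in> H" using H y by (rule complex_vector.subspace_scale)
  have 1: "b (x + y) (x + y) = b x x + b y y + (b x y + b y x)"
    by (simp add: b_def add x y cinner_add_left cinner_add_right)
  have 2: "b (x + \<i> *\<^sub>C y) (x + \<i> *\<^sub>C y) = b x x + b y y + \<i> * (b y x - b x y)"
    by (simp add: b_def add x y iy bounded_op_scaleC[OF S] cinner_add_left cinner_add_right
        cinner_scaleC_left cinner_scaleC_right algebra_simps)
  have "Im (b x y + b y x) = 0"
    using arg_cong[OF 1, of Im] real x y H by (simp add: complex_vector.subspace_add)
  moreover have "Re (b y x - b x y) = 0"
    using arg_cong[OF 2, of Im] real x y iy H by (simp add: complex_vector.subspace_add)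
  ultimately have "b x y = cnj (b y x)" by (simp add: complex_eq_iff)
  then show ?thesis by (simp add: b_def cinner_commute[of x "S y"])
qed

text \<open>\<open>pos_sqrt\<close> picks an arbitrary positive root \<open>S\<close>, so uniqueness
  of the root is needed, but only for a projection \<open>P\<close>, where it is elementary. On the
  range of \<open>P\<close> the operator \<open>S\<close> is an involution and positivity excludes
  the eigenvalue -1; on the kernel of \<open>P\<close> the norm of \<open>S k\<close> is zero
  because \<open>S (S k) = 0\<close>.\<close>

lemma pos_sqrt_projection:
  assumes H: "complex_vector.subspace H" and P: "bounded_op H P"
    and herm: "\<And>x y. x \<in> H \<Longrightarrow> y \<in> H \<Longrightarrow> cinner (P x) y = cinner x (P y)"
    and idem: "\<And>x. x \<in> H \<Longrightarrow> P (P x) = P x"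
    and T: "\<And>x. x \<in> H \<Longrightarrow> T x = P x" and h: "h \<in> H"
  shows "pos_sqrt H T h = P h"
proof -
  define good where "good S \<longleftrightarrow> bounded_op H S \<and>
    (\<forall>h\<in>H. cinner (S h) h \<in> \<real> \<and> 0 \<le> Re (cinner (S h) h)) \<and> (\<forall>h\<in>H. S (S h) = T h)" for S
  have PH: "P x \<in> H" if "x \<in> H" for x using P that by (auto simp: bounded_op_def)
  have "good P"
    unfolding good_def
  proof (intro conjI ballI P)
    fix x assume x: "x \<in> H"
    have "cinner (P x) x = cinner (P x) (P x)" using herm[OF x PH[OF x]] idem[OF x]
      by (metis herm PH x)
    then show "cinner (P x) x \<in> \<real>" "0 \<le> Re (cinner (P x) x)" by (simp_all add: cinner_self)
    show "P (P x) = T x" using idem T x by simp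
  qed
  then have "good (pos_sqrt H T)"
    unfolding pos_sqrt_def good_def[symmetric] by (rule someI[of good P])
  moreover define S where "S = pos_sqrt H T"
  ultimately have S: "bounded_op H S" "\<And>x. x \<in> H \<Longrightarrow> cinner (S x) x \<in> \<real>"
      "\<And>x. x \<in> H \<Longrightarrow> 0 \<le> Re (cinner (S x) x)" "\<And>x. x \<in> H \<Longrightarrow> S (S x) = P x"
    by (simp_all add: good_def T)
  have SH: "S x \<in> H" if "x \<in> H" for x using S(1) that by (auto simp: bounded_op_def)
  have diff: "A (x - y) = A x - A y" if "bounded_op H A" "x \<in> H" "y \<in> H" for A x y
  proof -
    have "A (x - y) + A y = A (x - y + y)"
      using that csubspace_diff[OF H that(2,3)] by (simp only: bounded_op_def)
    then show ?thesis by (simp add: eq_diff_eq)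
  qed
  \<comment> \<open>Since \<open>S (S (P h)) = P h\<close>, this vector satisfies
    \<open>S v = - v\<close>, so positivity of \<open>S\<close> forces it to vanish.\<close>
  define v where "v = S (P h) - P h"
  have v: "v \<in> H" unfolding v_def by (intro csubspace_diff[OF H] SH PH h)
  have "S v = - v"
    unfolding v_def diff[OF S(1) SH[OF PH[OF h]] PH[OF h]] by (simp add: S(4) PH h idem)
  then have "Re (cinner (S v) v) = - (norm v)\<^sup>2"
    using cinner_diff_left[of 0 v v] by (simp add: cinner_self)
  with S(3)[OF v] have SPh: "S (P h) = P h" by (simp add: v_def)
  define k where "k = h - P h"
  have k: "k \<in> H" unfolding k_def by (intro csubspace_diff[OF H] PH h)
  have "P k = 0" unfolding k_def diff[OF P h PH[OF h]] by (simp add: idem h)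
  have "cinner (S k) (S k) = cinner (S (S k)) k"
    by (rule positive_op_hermitian[OF H S(1,2) SH[OF k] k, symmetric])
  then have "S k = 0" by (simp add: S(4) k \<open>P k = 0\<close>)
  then have "S h = S (P h)" unfolding k_def diff[OF S(1) h PH[OF h]] by simp
  then show ?thesis by (simp only: SPh S_def[symmetric])
qed

section \<open>Orthonormal bases and dimension of finite-dimensional subspaces\<close>

lemma orthonormal_independent:
  assumes "orthonormal_on E (\<lambda>x. x)"
  shows "complex_vector.independent (E :: 'a::complex_hilbert_space set)"
  unfolding complex_vector.independent_explicit_finite_subsets
proof (intro allI impI ballI)
  fix F u v assume F: "F \<subseteq> E" "finite F" "(\<Sum>v\<in>F. u v *\<^sub>C v) = 0" "v \<in> F"
  have "(\<Sum>v\<in>F. (cmod (u v))\<^sup>2) = 0"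
    using orthonormal_norm_sum[OF assms F(2) F(1), of u] F(3) by simp
  then show "u v = 0" using F by (simp add: sum_nonneg_eq_0_iff)
qed

text \<open>Orthonormal subsets of \<open>W\<close> are independent, so their size is bounded by
  that of \<open>B\<close>. One of largest size spans \<open>W\<close>, since a Gram-Schmidt step
  from a vector outside its span would enlarge it.\<close>

lemma finite_orthonormal_basis_exists:
  fixes W :: "'a::complex_hilbert_space set"
  assumes W: "complex_vector.subspace W" and B: "finite B" "W \<subseteq> complex_vector.span B"
  obtains E where "finite E" "E \<subseteq> W" "orthonormal_on E (\<lambda>x. x)" "complex_vector.span E = W"
proof -
  define good where "good E \<longleftrightarrow> E \<subseteq> W \<and> orthonormal_on E (\<lambda>x. x)" for E
  have bound: "finite E \<and> card E \<le> card B" if "good E" for E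
    using that B complex_vector.independent_span_bound[OF B(1) orthonormal_independent]
    by (auto simp: good_def)
  have "good {}" by (simp add: good_def orthonormal_on_def)
  then have "\<exists>E. good E \<and> (\<forall>E'. good E' \<longrightarrow> card E' \<le> card E)"
    by (rule ex_has_greatest_nat[of good "{}" card "Suc (card B)"]) (auto dest: bound)
  then obtain E where E: "good E" and max: "\<And>E'. good E' \<Longrightarrow> card E' \<le> card E"
    by blast
  have fin: "finite E" and EW: "E \<subseteq> W" and on: "orthonormal_on E (\<lambda>x. x)"
    using E bound by (auto simp: good_def)
  have "W \<subseteq> complex_vector.span E"
  proof (rule ccontr)
    assume "\<not> W \<subseteq> complex_vector.span E"
    then obtain y where y: "y \<in> W" "y \<notin> complex_vector.span E" by blast
    define s where "s = (\<Sum>e\<in>E. cinner y e *\<^sub>C e)"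
    have sE: "s \<in> complex_vector.span E"
      unfolding s_def by (intro complex_vector.span_sum complex_vector.span_scale complex_vector.span_base)
    define v where "v = y - s"
    have "v \<noteq> 0" using sE y(2) by (auto simp: v_def)
    have sW: "s \<in> W" using sE complex_vector.span_minimal[OF EW W] by blast
    have ve: "cinner v e = 0" if "e \<in> E" for e
    proof -
      have "cinner s e = (\<Sum>e'\<in>E. if e' = e then cinner y e else 0)"
        unfolding s_def cinner_sum_left using on that
        by (intro sum.cong) (auto simp: orthonormal_on_def cinner_scaleC_left)
      then show ?thesis using that fin by (simp add: v_def cinner_diff_left)
    qed
    define u where "u = complex_of_real (1 / norm v) *\<^sub>C v"
    have uu: "cinner u u = 1"
      using \<open>v \<noteq> 0\<close> by (simp add: u_def cinner_self norm_scaleC norm_divide)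
    have ue: "cinner u e = 0" "cinner e u = 0" if "e \<in> E" for e
    proof -
      show *: "cinner u e = 0" by (simp add: u_def cinner_scaleC_left ve[OF that])
      then show "cinner e u = 0" by (metis cinner_commute complex_cnj_zero)
    qed
    have "u \<notin> E" using ue(1)[of u] uu by auto
    have "good (insert u E)"
      unfolding good_def orthonormal_on_def
    proof (intro conjI ballI)
      show "insert u E \<subseteq> W"
        using EW sW y(1) W by (auto simp: u_def v_def intro!: complex_vector.subspace_scale csubspace_diff)
      show "cinner x z = (if x = z then 1 else 0)" if "x \<in> insert u E" "z \<in> insert u E" for x z
        using that on uu ue \<open>u \<notin> E\<close> by (auto simp: orthonormal_on_def)
    qed
    then have "card (insert u E) \<le> card E" by (rule max)
    with fin \<open>u \<notin> E\<close> show False by simp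
  qed
  with complex_vector.span_minimal[OF EW W] have "complex_vector.span E = W" by blast
  with fin EW on that show ?thesis by blast
qed

lemma cdimension_span_orthonormal:
  assumes "finite E" "orthonormal_on E (\<lambda>x. x)"
  shows "cdimension (complex_vector.span E) = enat (card E)"
proof -
  have "\<exists>B. finite B \<and> complex_vector.span E \<subseteq> complex_vector.span B" using assms(1) by blast
  then show ?thesis
    unfolding cdimension_def
    by (simp add: complex_vector.dim_eq_card_independent[OF orthonormal_independent[OF assms(2)]])
qed

section \<open>Unitary operators\<close>

lemma unitary_op_diff:
  assumes "complex_vector.subspace H" "unitary_op H K U" "x \<in> H" "y \<in> H"
  shows "U (x - y) = U x - U y"
proof -
  have "U (x - y) + U y = U (x - y + y)"
    using assms csubspace_diff[OF assms(1,3,4)] by (simp only: unitary_op_def)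
  then show ?thesis by (simp add: eq_diff_eq)
qed

lemma unitary_op_sum:
  assumes "complex_vector.subspace H" "unitary_op H K U" "\<And>i. i \<in> F \<Longrightarrow> f i \<in> H"
  shows "U (sum f F) = (\<Sum>i\<in>F. U (f i))"
proof -
  have zero: "U 0 = 0"
    using unitary_op_diff[OF assms(1,2), of 0 0] complex_vector.subspace_0[OF assms(1)] by simp
  show ?thesis
    using assms(3)
  proof (induction F rule: infinite_finite_induct)
    case (insert i F)
    have "sum f F \<in> H"
      using insert.prems by (intro complex_vector.subspace_sum[OF assms(1)]) auto
    then show ?case
      using insert assms(2) by (simp add: unitary_op_def)
  qed (simp_all add: zero)
qed

lemma unitary_op_norm: "unitary_op H K U \<Longrightarrow> x \<in> H \<Longrightarrow> norm (U x) = norm x"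
  by (rule norm_eq_of_cinner) (simp add: unitary_op_def)

text \<open>\<open>U\<close> is linear and isometric only on \<open>H\<close>, so continuity is
  stated for limits of points that eventually stay in \<open>H\<close>, with the limit in
  \<open>H\<close> as well.\<close>

lemma unitary_op_tendsto:
  assumes "complex_vector.subspace H" "unitary_op H K U"
    and lim: "(f \<longlongrightarrow> x) F" and f: "\<forall>\<^sub>F i in F. f i \<in> H" and x: "x \<in> H"
  shows "((\<lambda>i. U (f i)) \<longlongrightarrow> U x) F"
proof -
  have "((\<lambda>i. norm (f i - x)) \<longlongrightarrow> 0) F"
    using lim by (simp add: tendsto_norm_zero_iff LIM_zero)
  moreover have "\<forall>\<^sub>F i in F. norm (f i - x) = norm (U (f i) - U x)"
    using f by eventually_elim
      (simp add: x unitary_op_diff[OF assms(1,2), symmetric] unitary_op_norm[OF assms(2)]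
        csubspace_diff[OF assms(1)])
  ultimately have "((\<lambda>i. norm (U (f i) - U x)) \<longlongrightarrow> 0) F"
    by (rule Lim_transform_eventually)
  then show ?thesis by (simp add: tendsto_norm_zero_iff LIM_zero_iff)
qed

lemma unitary_op_has_sum:
  assumes "complex_vector.subspace H" "closed H" "unitary_op H K U"
    and s: "(f has_sum s) I" and f: "\<And>i. i \<in> I \<Longrightarrow> f i \<in> H"
  shows "((\<lambda>i. U (f i)) has_sum U s) I"
proof -
  have "((\<lambda>F. U (sum f F)) \<longlongrightarrow> U s) (finite_subsets_at_top I)"
    using s f assms(1)
    by (intro unitary_op_tendsto[OF assms(1,3)] has_sum_in_csubspace[OF assms(1,2) s]
        eventually_finite_subsets_at_top_weakI)
       (auto simp: has_sum_def intro!: complex_vector.subspace_sum)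
  then show ?thesis
    unfolding has_sum_def
    by (rule Lim_transform_eventually)
       (use f in \<open>auto intro!: eventually_finite_subsets_at_top_weakI unitary_op_sum[OF assms(1,3)]\<close>)
qed

lemma adj_unitary:
  assumes "complex_vector.subspace H" "unitary_op H K U" "z \<in> H"
  shows "adj H U (U z) = z"
  by (rule adj_eqI[OF assms(1,3)]) (use assms in \<open>simp add: unitary_op_def\<close>)

lemma unitary_op_adj:
  assumes H: "complex_vector.subspace H" and U: "unitary_op H K U"
  shows "unitary_op K H (adj H U)"
proof -
  have inv: "adj H U (U z) = z" if "z \<in> H" for z by (rule adj_unitary[OF H U that])
  have K: "K = U ` H" using U by (simp add: unitary_op_def)
  have "adj H U (U x + U y) = x + y" if "x \<in> H" "y \<in> H" for x y
    using inv[OF complex_vector.subspace_add[OF H that]] U that by (simp add: unitary_op_def)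
  moreover have "adj H U (c *\<^sub>C U x) = c *\<^sub>C x" if "x \<in> H" for c x
    using inv[OF complex_vector.subspace_scale[OF H that]] U that by (simp add: unitary_op_def)
  moreover have "cinner (U x) (U y) = cinner x y" if "x \<in> H" "y \<in> H" for x y
    using U that by (simp add: unitary_op_def)
  ultimately show ?thesis unfolding unitary_op_def K by (auto simp: inv image_image)
qed

text \<open>\<open>adj H U\<close> inverts \<open>U\<close> only on its range \<open>K\<close>;
  invariance of \<open>K\<close> under \<open>B\<close> is what puts \<open>B i (U h)\<close>
  there.\<close>

lemma unitarily_equivalent_iff_intertwining:
  assumes H: "complex_vector.subspace H" and A: "\<And>i h. h \<in> H \<Longrightarrow> A i h \<in> H"
    and B: "\<And>i h. h \<in> K \<Longrightarrow> B i h \<in> K"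
  shows "unitarily_equivalent H A K B \<longleftrightarrow>
    (\<exists>U. unitary_op H K U \<and> (\<forall>i. \<forall>h\<in>H. U (A i h) = B i (U h)))"
proof -
  have "A i h = adj H U (B i (U h)) \<longleftrightarrow> U (A i h) = B i (U h)"
    if U: "unitary_op H K U" and h: "h \<in> H" for U i h
  proof -
    have "U h \<in> K" using U h by (auto simp: unitary_op_def)
    then have "B i (U h) \<in> U ` H" using B U by (auto simp: unitary_op_def)
    then show ?thesis using adj_unitary[OF H U] A[OF h] by (metis imageE)
  qed
  then show ?thesis unfolding unitarily_equivalent_def by blast
qed

text \<open>The expansion coefficients with respect to \<open>e\<close> are reused with
  \<open>e'\<close>; Bessel's inequality makes the new series converge. The formula for
  \<open>U\<close> makes sense on the whole type and is isometric on \<open>M\<close>.\<close>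

lemma unitary_op_of_bases:
  fixes e :: "'i \<Rightarrow> 'a::complex_hilbert_space" and e' :: "'i \<Rightarrow> 'b::complex_hilbert_space"
  assumes e: "orthonormal_on I e" "closure (complex_vector.span (e ` I)) = M"
    and e': "orthonormal_on I e'" "closure (complex_vector.span (e' ` I)) = N"
  shows "\<exists>U. unitary_op M N U \<and> (\<forall>i\<in>I. U (e i) = e' i)"
proof -
  have sub: "complex_vector.subspace M" "complex_vector.subspace N" and closed: "closed M" "closed N"
    using e(2) e'(2) by (auto intro: csubspace_closure)
  have inM: "e i \<in> M" and inN: "e' i \<in> N" if "i \<in> I" for i
    using that e(2) e'(2) by (auto intro!: set_mp[OF closure_subset] complex_vector.span_base)
  define U where "U h = (\<Sum>\<^sub>\<infinity>i\<in>I. cinner h (e i) *\<^sub>C e' i)" for h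
  have U: "((\<lambda>i. cinner h (e i) *\<^sub>C e' i) has_sum U h) I" for h
    unfolding U_def
    by (intro has_sum_infsum orthonormal_summable[OF e'(1)] summable_on_cinner_sq[OF e(1)])
  have coeff: "cinner (U h) (e' j) = cinner h (e j)" if "j \<in> I" for h j
  proof -
    have "((\<lambda>i. cinner (cinner h (e i) *\<^sub>C e' i) (e' j)) has_sum cinner (U h) (e' j)) I"
      by (rule has_sum_bounded_linear[OF bounded_linear_cinner_left U])
    then have "((\<lambda>i. if i = j then cinner h (e j) else 0) has_sum cinner (U h) (e' j)) I"
      by (rule has_sum_cong[THEN iffD1, rotated])
        (use e'(1) that in \<open>simp add: orthonormal_on_def cinner_scaleC_left\<close>)
    moreover have "((\<lambda>i. if i = j then cinner h (e j) else 0) has_sum cinner h (e j)) I"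
      using that by (intro has_sum_finite_neutralI[where B = "{j}"]) auto
    ultimately show ?thesis by (rule has_sum_unique)
  qed
  have UN: "U h \<in> N" for h
    by (rule has_sum_in_csubspace[OF sub(2) closed(2) U])
       (intro complex_vector.subspace_scale[OF sub(2)] inN)
  have "unitary_op M N U"
    unfolding unitary_op_def
  proof (intro conjI ballI allI)
    show "U (x + y) = U x + U y" for x y
      using has_sum_add[OF U[of x] U[of y]] U[of "x + y"]
      by (auto simp: cinner_add_left scaleC_add_left intro: has_sum_unique)
    show "U (c *\<^sub>C x) = c *\<^sub>C U x" for c x
      using has_sum_bounded_linear[OF bounded_linear_scaleC U, of c x] U[of "c *\<^sub>C x"]
      by (auto simp: cinner_scaleC_left scaleC_scaleC intro: has_sum_unique)
    show "cinner (U x) (U y) = cinner x y" if "x \<in> M" for x y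
    proof -
      have xy: "((\<lambda>i. cinner (cinner x (e i) *\<^sub>C e i) y) has_sum cinner x y) I"
        using orthonormal_expansion[OF e(1)] that e(2)
        by (intro has_sum_bounded_linear[OF bounded_linear_cinner_left]) simp
      have "((\<lambda>i. cinner (cinner x (e i) *\<^sub>C e' i) (U y)) has_sum cinner (U x) (U y)) I"
        by (rule has_sum_bounded_linear[OF bounded_linear_cinner_left U])
      moreover have "cinner (cinner x (e i) *\<^sub>C e' i) (U y) = cinner (cinner x (e i) *\<^sub>C e i) y"
        if "i \<in> I" for i
        using coeff[OF that, of y] cinner_commute[of "e' i" "U y"] cinner_commute[of "e i" y]
        by (simp add: cinner_scaleC_left)
      ultimately have "((\<lambda>i. cinner (cinner x (e i) *\<^sub>C e i) y) has_sum cinner (U x) (U y)) I"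
        by (simp cong: has_sum_cong)
      then show ?thesis using xy by (rule has_sum_unique)
    qed
    show "U ` M = N"
    proof
      show "N \<subseteq> U ` M"
      proof
        fix y assume y: "y \<in> N"
        \<comment> \<open>The preimage of \<open>y\<close>, obtained by the same construction with
          the two families exchanged.\<close>
        define h where "h = (\<Sum>\<^sub>\<infinity>i\<in>I. cinner y (e' i) *\<^sub>C e i)"
        have h: "((\<lambda>i. cinner y (e' i) *\<^sub>C e i) has_sum h) I"
          unfolding h_def
          by (intro has_sum_infsum orthonormal_summable[OF e(1)] summable_on_cinner_sq[OF e'(1)])
        have "h \<in> M"
          by (rule has_sum_in_csubspace[OF sub(1) closed(1) h])
             (intro complex_vector.subspace_scale[OF sub(1)] inM)
        have "cinner h (e j) = cinner y (e' j)" if "j \<in> I" for j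
        proof -
          have "((\<lambda>i. cinner (cinner y (e' i) *\<^sub>C e i) (e j)) has_sum cinner h (e j)) I"
            by (rule has_sum_bounded_linear[OF bounded_linear_cinner_left h])
          then have "((\<lambda>i. if i = j then cinner y (e' j) else 0) has_sum cinner h (e j)) I"
            by (rule has_sum_cong[THEN iffD1, rotated])
              (use e(1) that in \<open>simp add: orthonormal_on_def cinner_scaleC_left\<close>)
          moreover have "((\<lambda>i. if i = j then cinner y (e' j) else 0) has_sum cinner y (e' j)) I"
            using that by (intro has_sum_finite_neutralI[where B = "{j}"]) auto
          ultimately show ?thesis by (rule has_sum_unique)
        qed
        then have "((\<lambda>i. cinner y (e' i) *\<^sub>C e' i) has_sum U h) I"
          by (intro has_sum_cong[THEN iffD1, OF _ U[of h]]) simp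
        moreover have "((\<lambda>i. cinner y (e' i) *\<^sub>C e' i) has_sum y) I"
          using orthonormal_expansion[OF e'(1)] y e'(2) by simp
        ultimately have "U h = y" by (rule has_sum_unique)
        with \<open>h \<in> M\<close> show "y \<in> U ` M" by blast
      qed
    qed (use UN in blast)
  qed
  moreover have "U (e i) = e' i" if "i \<in> I" for i
  proof (rule has_sum_unique[OF U])
    show "((\<lambda>j. cinner (e i) (e j) *\<^sub>C e' j) has_sum e' i) I"
      using that e(1)
      by (intro has_sum_finite_neutralI[where B = "{i}"]) (auto simp: orthonormal_on_def scaleC_one)
  qed
  ultimately show ?thesis by blast
qed

section \<open>Wandering subspaces\<close>

text \<open>The Wold decomposition uses invariance under left creation and nothing about
  \<open>f\<close>. The same theory therefore serves the restrictions of \<open>MZ\<close> and the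
  whole space, which supplies the denominator of the curvature.\<close>

locale lshift_invariant =
  fixes M :: "'n::finite hardy set"
  assumes subspace: "complex_vector.subspace M" and closed: "closed M"
    and lshift_letter_in: "x \<in> M \<Longrightarrow> lshift [j] x \<in> M"
begin

lemma lshift_in: "x \<in> M \<Longrightarrow> lshift \<alpha> x \<in> M"
proof (induction \<alpha>)
  case (Cons j \<alpha>)
  then show ?case using lshift_letter_in[of "lshift \<alpha> x" j] by (simp add: lshift_Cons[of j \<alpha>])
qed simp

lemma bounded_op_lshift_M: "bounded_op M (lshift \<alpha>)"
  by (rule bounded_op_lshift) (auto intro: lshift_in)

text \<open>The adjoint of the restriction to \<open>M\<close>, that is, the adjoint on the whole
  space followed by projection onto \<open>M\<close>; the adjoint on the whole space need not leave
  \<open>M\<close> invariant.\<close>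

abbreviation ladj :: "'n list \<Rightarrow> 'n hardy \<Rightarrow> 'n hardy" where
  "ladj \<alpha> \<equiv> adj M (lshift \<alpha>)"

lemma ladj_in: "ladj \<alpha> h \<in> M"
  by (rule adj_in[OF subspace closed bounded_op_lshift_M])

lemma cinner_ladj: "g \<in> M \<Longrightarrow> cinner (lshift \<alpha> g) h = cinner g (ladj \<alpha> h)"
  by (rule cinner_adj[OF subspace closed bounded_op_lshift_M])

lemma cinner_ladj': "g \<in> M \<Longrightarrow> cinner h (lshift \<alpha> g) = cinner (ladj \<alpha> h) g"
  using cinner_ladj[of g \<alpha> h] by (metis cinner_commute)

lemma ladj_add: "ladj \<alpha> (x + y) = ladj \<alpha> x + ladj \<alpha> y"
  by (rule adj_eqI[OF subspace])
     (simp_all add: complex_vector.subspace_add[OF subspace] ladj_in cinner_ladj cinner_add_right)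

lemma ladj_scaleC: "ladj \<alpha> (c *\<^sub>C x) = c *\<^sub>C ladj \<alpha> x"
  by (rule adj_eqI[OF subspace])
     (simp_all add: complex_vector.subspace_scale[OF subspace] ladj_in cinner_ladj cinner_scaleC_right)

text \<open>The identity minus the sum of \<open>L_j L_j*\<close> for the restrictions of left
  creation to \<open>M\<close>. These are isometries with orthogonal ranges, so this is the
  orthogonal projection onto \<open>wandering\<close>; it is also the square of the defect
  operator.\<close>

definition proj :: "'n hardy \<Rightarrow> 'n hardy" where
  "proj h = h - (\<Sum>j\<in>UNIV. lshift [j] (ladj [j] h))"

definition wandering :: "'n hardy set" where
  "wandering = {w \<in> M. \<forall>j. \<forall>g\<in>M. cinner (lshift [j] g) w = 0}"

lemma proj_in: "h \<in> M \<Longrightarrow> proj h \<in> M"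
  unfolding proj_def
  by (intro csubspace_diff[OF subspace] complex_vector.subspace_sum[OF subspace] lshift_in ladj_in)

lemma proj_wandering: "h \<in> M \<Longrightarrow> proj h \<in> wandering"
proof -
  assume h: "h \<in> M"
  have "cinner (lshift [j] g) (proj h) = 0" if g: "g \<in> M" for j g
  proof -
    have "(\<Sum>i\<in>UNIV. cinner (lshift [j] g) (lshift [i] (ladj [i] h)))
        = (\<Sum>i\<in>UNIV. if i = j then cinner g (ladj [j] h) else 0)"
      by (rule sum.cong) (auto simp: cinner_lshift cinner_lshift_disjoint)
    then show ?thesis
      by (simp add: proj_def cinner_diff_right cinner_sum_right cinner_ladj[OF g])
  qed
  with proj_in[OF h] show ?thesis by (simp add: wandering_def)
qed

lemma proj_fixes_wandering:
  assumes "w \<in> wandering"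
  shows "proj w = w"
proof -
  have "ladj [j] w = 0" for j
    using assms by (intro adj_eqI[OF subspace])
      (auto simp: wandering_def complex_vector.subspace_0[OF subspace])
  moreover have "lshift [j] 0 = 0" for j :: 'n
    by (rule linear_0[OF bounded_linear.linear[OF bounded_linear_lshift]])
  ultimately show ?thesis by (simp add: proj_def)
qed

lemma proj_image: "proj ` M = wandering"
  using proj_wandering proj_fixes_wandering by (force simp: wandering_def image_iff)

lemma proj_hermitian: "cinner (proj x) y = cinner x (proj y)"
proof -
  have "cinner (proj x) y = cinner x y - (\<Sum>j\<in>UNIV. cinner (ladj [j] x) (ladj [j] y))"
    by (simp add: proj_def cinner_diff_left cinner_sum_left cinner_ladj ladj_in)
  also have "\<dots> = cinner x (proj y)"
    by (simp add: proj_def cinner_diff_right cinner_sum_right cinner_ladj' ladj_in)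
  finally show ?thesis .
qed

lemma bounded_op_proj: "bounded_op M proj"
  unfolding bounded_op_def
proof (intro conjI ballI allI)
  show "proj ` M \<subseteq> M" using proj_in by blast
  have add: "lshift \<alpha> (x + y) = lshift \<alpha> x + lshift \<alpha> y" for \<alpha> :: "'n list" and x y
    by (rule linear_add[OF bounded_linear.linear[OF bounded_linear_lshift]])
  show "proj (x + y) = proj x + proj y" for x y
    by (simp add: proj_def ladj_add add sum.distrib)
  show "proj (c *\<^sub>C x) = c *\<^sub>C proj x" for c x
    by (simp add: proj_def ladj_scaleC lshift_scaleC complex_vector.scale_sum_right
        complex_vector.scale_right_diff_distrib)
  show "\<exists>C. \<forall>x\<in>M. norm (proj x) \<le> C * norm x"
  proof (intro exI[of _ 1] ballI)
    fix x assume "x \<in> M"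
    then have "cinner (proj x) (proj x) = cinner (proj x) x"
      by (simp add: proj_hermitian[of x "proj x"] proj_hermitian[of x x] proj_fixes_wandering proj_wandering)
    then have "norm (proj x) * norm (proj x) = inner (proj x) x"
      unfolding inner_cinner by (metis Re_complex_of_real cinner_self power2_eq_square)
    also have "\<dots> \<le> norm (proj x) * norm x" by (rule norm_cauchy_schwarz)
    finally have "norm (proj x) \<le> norm x"
      by (cases "proj x = 0") auto
    then show "norm (proj x) \<le> 1 * norm x" by simp
  qed
qed

lemma subspace_wandering: "complex_vector.subspace wandering"
  by (rule complex_vector.subspaceI)
     (auto simp: wandering_def cinner_add_right cinner_scaleC_right complex_vector.subspace_0[OF subspace]
       complex_vector.subspace_add[OF subspace] complex_vector.subspace_scale[OF subspace])

text \<open>Common first letters cancel because left creation is isometric, and different first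
  letters give orthogonal ranges. If only one word is exhausted, a wandering vector meets the range
  of a left creation operator on \<open>M\<close>.\<close>

lemma cinner_lshift_wandering:
  assumes "w \<in> wandering" "w' \<in> wandering"
  shows "cinner (lshift \<alpha> w) (lshift \<beta> w') = (if \<alpha> = \<beta> then cinner w w' else 0)"
proof (induction \<alpha> \<beta> rule: list_induct2')
  case (2 j \<alpha>)
  have "lshift \<alpha> w \<in> M" using assms by (simp add: wandering_def lshift_in)
  then show ?case using assms by (simp add: wandering_def lshift_Cons[of j \<alpha>])
next
  case (3 j \<beta>)
  have "lshift \<beta> w' \<in> M" using assms by (simp add: wandering_def lshift_in)
  then have "cinner (lshift (j # \<beta>) w') w = 0" using assms by (simp add: wandering_def lshift_Cons[of j \<beta>])
  then have "cinner w (lshift (j # \<beta>) w') = 0" by (metis cinner_commute complex_cnj_zero)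
  then show ?case by simp
next
  case (4 i \<alpha> j \<beta>)
  then show ?case
    by (cases "i = j") (simp_all add: cinner_lshift_disjoint lshift_Cons[of j \<alpha>] lshift_Cons[of j \<beta>] cinner_lshift)
qed simp

lemma orthonormal_lshift_wandering:
  assumes "E \<subseteq> wandering" "orthonormal_on E (\<lambda>x. x)"
  shows "orthonormal_on (UNIV \<times> E) (\<lambda>(\<alpha>, b). lshift \<alpha> b)"
  using assms by (auto simp: orthonormal_on_def cinner_lshift_wandering subset_iff)

text \<open>If \<open>h \<in> M\<close> is orthogonal to all \<open>L\<^sub>\<alpha> W\<close>, then \<open>h = \<Sum> L\<^sub>j h\<^sub>j\<close> with all \<open>h\<^sub>j\<close> of the same kind; hence
  the coordinates of \<open>h\<close> vanish by induction on the word.\<close>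

lemma orthogonal_lshift_wandering:
  assumes "h \<in> M" "\<And>\<alpha> w. w \<in> wandering \<Longrightarrow> cinner h (lshift \<alpha> w) = 0"
  shows "h = 0"
proof (rule l2_eqI)
  fix \<gamma>
  show "l2_nth h \<gamma> = l2_nth 0 \<gamma>"
    using assms
  proof (induction \<gamma> arbitrary: h)
    have proj0: "h = (\<Sum>j\<in>UNIV. lshift [j] (ladj [j] h))"
      if h: "h \<in> M" "\<And>\<alpha> w. w \<in> wandering \<Longrightarrow> cinner h (lshift \<alpha> w) = 0" for h
    proof -
      have "cinner (proj h) (proj h) = cinner h (proj h)"
        by (simp add: proj_hermitian[of h "proj h"] proj_fixes_wandering proj_wandering h(1))
      also have "\<dots> = 0" using h(2)[OF proj_wandering[OF h(1)], of "[]"] by simp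
      finally show ?thesis by (simp add: proj_def)
    qed
    {
      case Nil
      show ?case
        by (subst proj0[OF Nil]) (simp_all add: l2_nth_sum l2_nth_lshift zero_l2.rep_eq)
    next
      case (Cons i \<gamma>)
      have "cinner (ladj [i] h) (lshift \<alpha> w) = 0" if "w \<in> wandering" for \<alpha> w
      proof -
        have "lshift \<alpha> w \<in> M" using that by (simp add: wandering_def lshift_in)
        then show ?thesis
          using Cons.prems(2)[OF that, of "i # \<alpha>"] by (simp add: lshift_Cons[of i \<alpha>] cinner_ladj')
      qed
      then have "l2_nth (ladj [i] h) \<gamma> = 0"
        using Cons.IH[OF ladj_in] by (simp add: zero_l2.rep_eq)
      moreover have "l2_nth h (i # \<gamma>) = (\<Sum>j\<in>UNIV. if j = i then l2_nth (ladj [i] h) \<gamma> else 0)"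
        by (subst proj0[OF Cons.prems])
           (auto simp: l2_nth_sum l2_nth_lshift intro!: sum.cong)
      ultimately show ?case by (simp add: zero_l2.rep_eq)
    }
  qed
qed

lemma lshift_wandering_complete:
  assumes "complex_vector.span E = wandering"
  shows "closure (complex_vector.span ((\<lambda>(\<alpha>, b). lshift \<alpha> b) ` (UNIV \<times> E))) = M"
proof (rule orthonormal_complete[OF subspace closed])
  have E: "E \<subseteq> wandering" using assms complex_vector.span_superset by blast
  then show "(\<lambda>(\<alpha>, b). lshift \<alpha> b) ` (UNIV \<times> E) \<subseteq> M"
    by (auto simp: wandering_def intro!: lshift_in)
  fix h assume h: "h \<in> M" and orth: "\<And>i. i \<in> UNIV \<times> E \<Longrightarrow> cinner h (case i of (\<alpha>, b) \<Rightarrow> lshift \<alpha> b) = 0"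
  have "wandering \<subseteq> {w. cinner h (lshift \<alpha> w) = 0}" for \<alpha>
    unfolding assms[symmetric]
  proof (rule complex_vector.span_minimal)
    show "E \<subseteq> {w. cinner h (lshift \<alpha> w) = 0}" using orth[of "(\<alpha>, _)"] by auto
    show "complex_vector.subspace {w. cinner h (lshift \<alpha> w) = 0}"
      by (rule complex_vector.subspaceI)
         (auto simp: lshift_scaleC cinner_scaleC_right cinner_add_right
           linear_add[OF bounded_linear.linear[OF bounded_linear_lshift]]
           linear_0[OF bounded_linear.linear[OF bounded_linear_lshift]])
  qed
  then show "h = 0" by (intro orthogonal_lshift_wandering[OF h]) auto
qed

end

section \<open>Evaluation of the power series at the model\<close>

text \<open>Abel's theorem for vector series, with the radial sums and the existence of their limit
  given. It reconciles the two formulas in \<open>eval_tuple\<close> when passing to an invariant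
  subspace.\<close>

lemma abel_limit:
  fixes a :: "nat \<Rightarrow> 'a::real_normed_vector"
  assumes a: "a sums s"
    and g: "\<And>r. \<delta> < r \<Longrightarrow> r < 1 \<Longrightarrow> (\<lambda>k. r ^ k *\<^sub>R a k) sums g r"
    and \<delta>: "0 < \<delta>" "\<delta> < 1" and y: "(g \<longlongrightarrow> y) (at_left 1)"
  shows "y = s"
proof -
  define d where "d n = (\<Sum>k<n. a k) - s" for n
  have d0: "d \<longlonglongrightarrow> 0"
    using a unfolding d_def sums_def by (rule LIM_zero)
  \<comment> \<open>Summation by parts against the errors \<open>d\<close> of the partial sums; the
    last summand is the boundary term.\<close>
  have identity: "(\<Sum>k<n. r ^ k *\<^sub>R a k) - s = (1 - r) *\<^sub>R (\<Sum>k<n. r ^ k *\<^sub>R d (Suc k)) + r ^ n *\<^sub>R d n"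
    for r n
  proof (induction n)
    case (Suc n)
    have "d (Suc n) = d n + a n" by (simp add: d_def)
    then have "(1 - r) *\<^sub>R (\<Sum>k<Suc n. r ^ k *\<^sub>R d (Suc k)) + r ^ Suc n *\<^sub>R d (Suc n)
        = ((1 - r) *\<^sub>R (\<Sum>k<n. r ^ k *\<^sub>R d (Suc k)) + r ^ n *\<^sub>R d n) + r ^ n *\<^sub>R a n"
      by (simp add: algebra_simps)
    also have "\<dots> = (\<Sum>k<Suc n. r ^ k *\<^sub>R a k) - s" unfolding Suc.IH[symmetric] by simp
    finally show ?case by simp
  qed (simp add: d_def)
  have "norm (y - s) \<le> 2 * \<epsilon>" if "\<epsilon> > 0" for \<epsilon>
  proof -
    obtain N where N: "\<And>n. n \<ge> N \<Longrightarrow> norm (d n) \<le> \<epsilon>"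
      using LIMSEQ_D[OF d0 \<open>\<epsilon> > 0\<close>] by (auto intro: less_imp_le)
    \<comment> \<open>The contribution of the finitely many errors not yet below
      \<open>\<epsilon>\<close>; its weight \<open>1 - r\<close> tends to 0. The two
      \<open>\<epsilon>\<close> in the bound come from the remaining errors and from the boundary
      term.\<close>
    define C where "C = (\<Sum>k<N. norm (d (Suc k)))"
    have bound: "norm (g r - s) \<le> (1 - r) * C + 2 * \<epsilon>" if r: "\<delta> < r" "r < 1" for r
    proof (rule Lim_bounded[where M = N])
      show "(\<lambda>n. norm ((\<Sum>k<n. r ^ k *\<^sub>R a k) - s)) \<longlonglongrightarrow> norm (g r - s)"
        using g[OF r] unfolding sums_def by (intro tendsto_intros)
      show "\<forall>n\<ge>N. norm ((\<Sum>k<n. r ^ k *\<^sub>R a k) - s) \<le> (1 - r) * C + 2 * \<epsilon>"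
      proof (intro allI impI)
        fix n assume "n \<ge> N"
        have r0: "0 \<le> r" using r \<delta> by simp
        have le1: "r ^ k \<le> 1" for k using r r0 by (simp add: power_le_one)
        have "norm (\<Sum>k<n. r ^ k *\<^sub>R d (Suc k)) \<le> (\<Sum>k<n. (if k < N then norm (d (Suc k)) else 0) + r ^ k * \<epsilon>)"
        proof (rule sum_norm_le)
          fix k
          have "r ^ k * norm (d (Suc k)) \<le> 1 * norm (d (Suc k))"
            by (intro mult_right_mono le1) auto
          moreover have "r ^ k * norm (d (Suc k)) \<le> r ^ k * \<epsilon>" if "k \<ge> N"
            using N[of "Suc k"] that r0 by (intro mult_left_mono) auto
          ultimately show "norm (r ^ k *\<^sub>R d (Suc k)) \<le> (if k < N then norm (d (Suc k)) else 0) + r ^ k * \<epsilon>"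
            using r0 \<open>\<epsilon> > 0\<close> by (auto simp: add_increasing2)
        qed
        also have "\<dots> = C + (\<Sum>k<n. r ^ k) * \<epsilon>"
        proof -
          have "(\<Sum>k<n. if k < N then norm (d (Suc k)) else 0) = C"
            unfolding C_def using \<open>n \<ge> N\<close> by (intro sum.mono_neutral_cong_right) auto
          then show ?thesis by (simp add: sum.distrib sum_distrib_right)
        qed
        finally have "(1 - r) * norm (\<Sum>k<n. r ^ k *\<^sub>R d (Suc k)) \<le> (1 - r) * (C + (\<Sum>k<n. r ^ k) * \<epsilon>)"
          using r by (intro mult_left_mono) auto
        also have "\<dots> = (1 - r) * C + (1 - r ^ n) * \<epsilon>"
          unfolding one_diff_power_eq[of r n] by (simp add: algebra_simps)
        also have "\<dots> \<le> (1 - r) * C + \<epsilon>"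
          using r0 \<open>\<epsilon> > 0\<close> by (simp add: algebra_simps)
        finally have "(1 - r) * norm (\<Sum>k<n. r ^ k *\<^sub>R d (Suc k)) \<le> (1 - r) * C + \<epsilon>" .
        moreover have "r ^ n * norm (d n) \<le> 1 * \<epsilon>"
          using r0 N[OF \<open>n \<ge> N\<close>] by (intro mult_mono le1) auto
        ultimately show "norm ((\<Sum>k<n. r ^ k *\<^sub>R a k) - s) \<le> (1 - r) * C + 2 * \<epsilon>"
          unfolding identity
          using norm_triangle_ineq[of "(1 - r) *\<^sub>R (\<Sum>k<n. r ^ k *\<^sub>R d (Suc k))" "r ^ n *\<^sub>R d n"] r r0
          by simp
      qed
    qed
    have "((\<lambda>r. norm (g r - s)) \<longlongrightarrow> norm (y - s)) (at_left 1)" by (intro tendsto_intros y)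
    moreover have "((\<lambda>r. (1 - r) * C + 2 * \<epsilon>) \<longlongrightarrow> (1 - 1) * C + 2 * \<epsilon>) (at_left 1)"
      by (intro tendsto_intros)
    moreover have "\<forall>\<^sub>F r in at_left 1. norm (g r - s) \<le> (1 - r) * C + 2 * \<epsilon>"
      using eventually_at_left_real[OF \<delta>(2)] by eventually_elim (simp add: bound)
    ultimately have "norm (y - s) \<le> (1 - 1) * C + 2 * \<epsilon>"
      by (intro tendsto_le[OF trivial_limit_at_left_real])
    then show ?thesis by simp
  qed
  note small = this
  have "norm (y - s) \<le> 0"
    by (rule field_le_epsilon) (use small[of "_ / 2"] in simp)
  then show ?thesis by simp
qed

section \<open>Words and homogeneous parts of operator tuples\<close>

lemma op_word_Nil [simp]: "op_word X [] = id"
  by (simp add: op_word_def)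

lemma op_word_Cons [simp]: "op_word X (j # \<alpha>) h = X j (op_word X \<alpha> h)"
  by (simp add: op_word_def)

lemma op_word_snoc: "op_word X (\<alpha> @ [j]) h = op_word X \<alpha> (X j h)"
  by (induction \<alpha>) simp_all

lemma op_word_in: "(\<And>i h. h \<in> H \<Longrightarrow> X i h \<in> H) \<Longrightarrow> h \<in> H \<Longrightarrow> op_word X \<alpha> h \<in> H"
  by (induction \<alpha>) simp_all

lemma op_word_cong:
  assumes "\<And>i h. h \<in> H \<Longrightarrow> X i h = Y i h" "\<And>i h. h \<in> H \<Longrightarrow> Y i h \<in> H" "h \<in> H"
  shows "op_word X \<alpha> h = op_word Y \<alpha> h"
  by (induction \<alpha>) (simp_all add: assms op_word_in[of H])

lemma bounded_op_op_word:
  assumes "\<And>i. bounded_op UNIV (X i)"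
  shows "bounded_op UNIV (op_word X \<alpha>)"
proof (induction \<alpha>)
  case Nil
  then show ?case by (auto simp: bounded_op_def intro!: exI[of _ 1])
next
  case (Cons j \<alpha>)
  have "op_word X (j # \<alpha>) = (\<lambda>u. X j (op_word X \<alpha> u))" by (rule ext) simp
  then show ?case using bounded_op_compose[OF assms Cons.IH] by simp
qed

lemma op_word_scale_tuple:
  assumes "\<And>i. bounded_op UNIV (X i)"
  shows "op_word (scale_tuple r X) \<alpha> h = r ^ length \<alpha> *\<^sub>R op_word X \<alpha> h"
  by (induction \<alpha>)
     (simp_all add: scale_tuple_def scaleR_scaleC bounded_op_scaleC[OF assms] scaleC_scaleC)

lemma hom_part_scale_tuple:
  assumes "\<And>i. bounded_op UNIV (X i)"
  shows "hom_part c (scale_tuple r X) k h = r ^ k *\<^sub>R hom_part c X k h"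
  unfolding hom_part_def
  by (simp add: op_word_scale_tuple[OF assms] complex_vector.scale_sum_right scaleR_scaleC scaleC_scaleC mult.commute)

lemma hom_part_in:
  assumes "complex_vector.subspace H" "\<And>i h. h \<in> H \<Longrightarrow> X i h \<in> H" "h \<in> H"
  shows "hom_part c X k h \<in> H"
  unfolding hom_part_def
  by (intro complex_vector.subspace_sum complex_vector.subspace_scale op_word_in assms)

lemma
  assumes A: "norm_summable H A"
  shows norm_summable_sums: "h \<in> H \<Longrightarrow> (\<lambda>k. A k h) sums (\<Sum>k. A k h)"
    and norm_summable_uniform:
      "\<epsilon> > 0 \<Longrightarrow> \<exists>N. \<forall>h\<in>H. norm ((\<Sum>k<N. A k h) - (\<Sum>k. A k h)) \<le> \<epsilon> * norm h"
proof -
  obtain S where S: "\<And>\<epsilon>. \<epsilon> > 0 \<Longrightarrow>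
      \<forall>\<^sub>F N in sequentially. \<forall>h\<in>H. norm ((\<Sum>k<N. A k h) - S h) \<le> \<epsilon> * norm h"
    using A unfolding norm_summable_def by blast
  have sums: "(\<lambda>k. A k h) sums S h" if h: "h \<in> H" for h
    unfolding sums_def
  proof (rule metric_LIMSEQ_I)
    fix e :: real assume "e > 0"
    then have "e / (norm h + 1) > 0" by (simp add: add_nonneg_pos)
    from S[OF this] obtain N0 where N0: "\<And>N. N \<ge> N0 \<Longrightarrow>
        norm ((\<Sum>k<N. A k h) - S h) \<le> e / (norm h + 1) * norm h"
      using h unfolding eventually_sequentially by blast
    have "e / (norm h + 1) * norm h < e"
      using \<open>e > 0\<close> by (simp add: pos_divide_less_eq add_nonneg_pos)
    then show "\<exists>N0. \<forall>N\<ge>N0. dist (\<Sum>k<N. A k h) (S h) < e"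
      unfolding dist_norm using N0 by (meson order.strict_trans1)
  qed
  then have suminf: "(\<Sum>k. A k h) = S h" if "h \<in> H" for h
    using that by (simp add: sums_iff)
  show "h \<in> H \<Longrightarrow> (\<lambda>k. A k h) sums (\<Sum>k. A k h)" using sums suminf by simp
  show "\<exists>N. \<forall>h\<in>H. norm ((\<Sum>k<N. A k h) - (\<Sum>k. A k h)) \<le> \<epsilon> * norm h" if "\<epsilon> > 0"
    using S[OF that] unfolding eventually_sequentially by (auto simp: suminf)
qed

text \<open>The common interface of the three cases. \<open>MZ_conv\<close> belongs to it because
  \<open>eval_MZ\<close> only identifies the value \<open>f_j(MZ)\<close>; the mode of convergence
  is what transfers invariance and intertwining from \<open>MZ\<close> to left creation.\<close>

locale hardy_model =
  fixes f :: "'n::finite \<Rightarrow> 'n ncseries" and MZ :: "'n \<Rightarrow> 'n hardy \<Rightarrow> 'n hardy"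
  assumes bounded_MZ: "bounded_op UNIV (MZ i)"
    and rshift_commute: "MZ i (rshift [j] u) = rshift [j] (MZ i u)"
    and MZ_conv: "MZ \<in> conv_SOT f UNIV \<union> conv_rad f UNIV"
    and eval_MZ: "eval_tuple f UNIV MZ j u = lshift [j] u"
begin

text \<open>Both kinds of convergence reduced to one form: pointwise limits of polynomials in
  \<open>MZ\<close> whose weights and cutoffs do not depend on \<open>u\<close>. That uniformity
  allows the same polynomials to be used at a vector and at its image under a unitary.\<close>

lemma lshift_polynomial_limit:
  "\<exists>c N. \<forall>u. (\<lambda>n. \<Sum>k<N n. c n k *\<^sub>R hom_part (f j) MZ k u) \<longlonglongrightarrow> lshift [j] u"
proof (cases "MZ \<in> conv_SOT f UNIV")
  case True
  have "(\<lambda>n. \<Sum>k<n. 1 *\<^sub>R hom_part (f j) MZ k u) \<longlonglongrightarrow> lshift [j] u" for u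
  proof -
    have "summable (\<lambda>k. hom_part (f j) MZ k u)" using True by (simp add: conv_SOT_def)
    then have "(\<lambda>n. \<Sum>k<n. hom_part (f j) MZ k u) \<longlonglongrightarrow> series_at (f j) MZ u"
      unfolding series_at_def by (rule summable_LIMSEQ)
    then show ?thesis using True eval_MZ[of j u] by (simp add: eval_tuple_def)
  qed
  then show ?thesis by (intro exI[of _ "\<lambda>n k. 1"] exI[of _ "\<lambda>n. n"]) simp
next
  case False
  then have "MZ \<in> conv_rad f UNIV" using MZ_conv by blast
  then obtain \<delta> where \<delta>: "0 < \<delta>" "\<delta> < 1"
    and ns: "\<And>r j. \<delta> < r \<Longrightarrow> r < 1 \<Longrightarrow> norm_summable UNIV (hom_part (f j) (scale_tuple r MZ))"
    and lim: "\<And>j h. \<exists>y. ((\<lambda>r. series_at (f j) (scale_tuple r MZ) h) \<longlongrightarrow> y) (at_left 1)"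
    unfolding conv_rad_def by auto
  have lim': "((\<lambda>r. series_at (f j) (scale_tuple r MZ) u) \<longlongrightarrow> lshift [j] u) (at_left 1)" for u
  proof -
    obtain y where y: "((\<lambda>r. series_at (f j) (scale_tuple r MZ) u) \<longlongrightarrow> y) (at_left 1)"
      using lim by blast
    have "lshift [j] u = y"
      using tendsto_Lim[OF _ y] False eval_MZ[of j u] by (simp add: eval_tuple_def)
    with y show ?thesis by simp
  qed
  \<comment> \<open>The double \<open>Suc\<close> keeps \<open>r n\<close> strictly above
    \<open>\<delta>\<close> already for \<open>n = 0\<close>.\<close>
  define r where "r n = 1 - (1 - \<delta>) / real (Suc (Suc n))" for n
  have r: "\<delta> < r n" "r n < 1" for n
  proof -
    have "(1 - \<delta>) / real (Suc (Suc n)) < 1 - \<delta>"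
      using \<delta> by (simp add: pos_divide_less_eq)
    then show "\<delta> < r n" by (simp add: r_def)
    show "r n < 1" using \<delta> by (simp add: r_def)
  qed
  have "r \<longlonglongrightarrow> 1 - (1 - \<delta>) * 0"
    unfolding r_def divide_inverse
    by (intro tendsto_intros LIMSEQ_Suc[OF LIMSEQ_inverse_real_of_nat])
  then have r1: "filterlim r (at_left 1) sequentially"
    using r by (simp add: filterlim_at less_imp_neq)
  \<comment> \<open>Norm convergence at the radius \<open>r n\<close> gives one cutoff for all
    \<open>u\<close>, so the truncation error vanishes along this diagonal sequence while the radial
    sums tend to \<open>lshift [j] u\<close>.\<close>
  have "\<exists>N. \<forall>u. norm ((\<Sum>k<N. hom_part (f j) (scale_tuple (r n) MZ) k u)
      - series_at (f j) (scale_tuple (r n) MZ) u) \<le> 1 / real (Suc n) * norm u" for n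
    using norm_summable_uniform[OF ns[OF r], of "1 / real (Suc n)"] by (simp add: series_at_def)
  then obtain N where N: "\<And>n u. norm ((\<Sum>k<N n. hom_part (f j) (scale_tuple (r n) MZ) k u)
      - series_at (f j) (scale_tuple (r n) MZ) u) \<le> 1 / real (Suc n) * norm u"
    by metis
  have "(\<lambda>n. \<Sum>k<N n. r n ^ k *\<^sub>R hom_part (f j) MZ k u) \<longlonglongrightarrow> lshift [j] u" for u
  proof -
    let ?p = "\<lambda>n. \<Sum>k<N n. hom_part (f j) (scale_tuple (r n) MZ) k u"
    let ?s = "\<lambda>n. series_at (f j) (scale_tuple (r n) MZ) u"
    have "(\<lambda>n. ?p n - ?s n) \<longlonglongrightarrow> 0"
    proof (rule Lim_null_comparison)
      show "\<forall>\<^sub>F n in sequentially. norm (?p n - ?s n) \<le> 1 / real (Suc n) * norm u"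
        using N by simp
      show "(\<lambda>n. 1 / real (Suc n) * norm u) \<longlonglongrightarrow> 0"
        using tendsto_mult_right[OF LIMSEQ_Suc[OF lim_1_over_n], of "norm u"] by simp
    qed
    moreover have "?s \<longlonglongrightarrow> lshift [j] u" by (rule filterlim_compose[OF lim' r1])
    ultimately have "(\<lambda>n. ?p n - ?s n + ?s n) \<longlonglongrightarrow> 0 + lshift [j] u" by (rule tendsto_add)
    then show ?thesis by (simp add: hom_part_scale_tuple[OF bounded_MZ])
  qed
  then show ?thesis by (intro exI[of _ "\<lambda>n k. r n ^ k"] exI[of _ N]) simp
qed

lemma lshift_invariant:
  assumes "invariant_subspace MZ M"
  shows "lshift_invariant M"
proof
  show M: "complex_vector.subspace M" "closed M"
    using assms by (auto simp: invariant_subspace_def)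
  fix x j assume x: "x \<in> M"
  obtain c N where lim: "\<And>u. (\<lambda>n. \<Sum>k<N n. c n k *\<^sub>R hom_part (f j) MZ k u) \<longlonglongrightarrow> lshift [j] u"
    using lshift_polynomial_limit by blast
  have "(\<Sum>k<N n. c n k *\<^sub>R hom_part (f j) MZ k x) \<in> M" for n
    using assms by (intro complex_vector.subspace_sum csubspace_scaleR hom_part_in x M(1))
      (auto simp: invariant_subspace_def)
  then show "lshift [j] x \<in> M" using closed_sequentially[OF M(2) _ lim] by blast
qed

text \<open>\<open>U\<close> commutes with every polynomial in \<open>MZ\<close>; evaluate one
  approximating sequence at \<open>h\<close> and at \<open>U h\<close> and pass to the
  limit.\<close>

lemma unitary_lshift_commute:
  assumes "invariant_subspace MZ M" and U: "unitary_op M N U"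
    and comm: "\<And>i h. h \<in> M \<Longrightarrow> U (MZ i h) = MZ i (U h)" and h: "h \<in> M"
  shows "U (lshift [j] h) = lshift [j] (U h)"
proof -
  have M: "complex_vector.subspace M" and inv: "\<And>i h. h \<in> M \<Longrightarrow> MZ i h \<in> M"
    using assms(1) by (auto simp: invariant_subspace_def)
  interpret lshift_invariant M by (rule lshift_invariant[OF assms(1)])
  obtain c N where lim: "\<And>u. (\<lambda>n. \<Sum>k<N n. c n k *\<^sub>R hom_part (f j) MZ k u) \<longlonglongrightarrow> lshift [j] u"
    using lshift_polynomial_limit by blast
  have word: "U (op_word MZ \<alpha> h) = op_word MZ \<alpha> (U h)" for \<alpha>
    by (induction \<alpha>) (simp_all add: comm op_word_in[OF inv h])
  have scale: "U (a *\<^sub>C x) = a *\<^sub>C U x" if "x \<in> M" for a x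
    using U that by (simp add: unitary_op_def)
  have hom: "U (hom_part (f j) MZ k h) = hom_part (f j) MZ k (U h)" for k
    unfolding hom_part_def
    by (subst unitary_op_sum[OF M U])
       (simp_all add: scale word op_word_in[OF inv h] complex_vector.subspace_scale[OF M])
  have hM: "hom_part (f j) MZ k h \<in> M" for k by (rule hom_part_in[OF M inv h])
  have "U (\<Sum>k<N n. c n k *\<^sub>R hom_part (f j) MZ k h) = (\<Sum>k<N n. c n k *\<^sub>R hom_part (f j) MZ k (U h))" for n
    by (subst unitary_op_sum[OF M U])
       (simp_all add: scaleR_scaleC scale hM hom complex_vector.subspace_scale[OF M])
  moreover have "(\<lambda>n. U (\<Sum>k<N n. c n k *\<^sub>R hom_part (f j) MZ k h)) \<longlonglongrightarrow> U (lshift [j] h)"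
    by (intro unitary_op_tendsto[OF M U lim] always_eventually allI complex_vector.subspace_sum[OF M]
        csubspace_scaleR[OF M] hM lshift_in h)
  ultimately show ?thesis using lim[of "U h"] by (auto intro: LIMSEQ_unique)
qed

text \<open>Strong convergence passes from the whole space to \<open>M\<close>, but not conversely.
  If it holds on \<open>M\<close> only, \<open>eval_tuple\<close> takes the plain sum on
  \<open>M\<close> and the radial limit on the whole space; \<open>abel_limit\<close> shows that
  they agree.\<close>

lemma eval_tuple_restrict:
  assumes "invariant_subspace MZ M" and h: "h \<in> M"
  shows "eval_tuple f M MZ j h = lshift [j] h"
proof (cases "MZ \<in> conv_SOT f UNIV")
  case True
  have "bounded_op M (MZ i)" for i
    using bounded_MZ[of i] assms(1) by (auto simp: bounded_op_def invariant_subspace_def)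
  with True have "MZ \<in> conv_SOT f M" by (simp add: conv_SOT_def)
  with True show ?thesis using eval_MZ[of j h] by (simp add: eval_tuple_def)
next
  case False
  then have lim: "Lim (at_left 1) (\<lambda>r. series_at (f j) (scale_tuple r MZ) h) = lshift [j] h"
    using eval_MZ[of j h] by (simp add: eval_tuple_def)
  show ?thesis
  proof (cases "MZ \<in> conv_SOT f M")
    case True
    have "MZ \<in> conv_rad f UNIV" using MZ_conv False by blast
    then obtain \<delta> where \<delta>: "0 < \<delta>" "\<delta> < 1"
      and ns: "\<And>r. \<delta> < r \<Longrightarrow> r < 1 \<Longrightarrow> norm_summable UNIV (hom_part (f j) (scale_tuple r MZ))"
      and ex: "\<exists>y. ((\<lambda>r. series_at (f j) (scale_tuple r MZ) h) \<longlongrightarrow> y) (at_left 1)"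
      unfolding conv_rad_def by auto
    from ex obtain y where y: "((\<lambda>r. series_at (f j) (scale_tuple r MZ) h) \<longlongrightarrow> y) (at_left 1)"
      by blast
    have "y = series_at (f j) MZ h"
    proof (rule abel_limit[OF _ _ \<delta> y])
      show "(\<lambda>k. hom_part (f j) MZ k h) sums series_at (f j) MZ h"
        using True h unfolding series_at_def conv_SOT_def by (auto intro: summable_sums)
      show "(\<lambda>k. r ^ k *\<^sub>R hom_part (f j) MZ k h) sums series_at (f j) (scale_tuple r MZ) h"
        if "\<delta> < r" "r < 1" for r
        using norm_summable_sums[OF ns[OF that], of h]
        by (simp add: series_at_def hom_part_scale_tuple[OF bounded_MZ])
    qed
    then show ?thesis using True lim tendsto_Lim[OF _ y] by (simp add: eval_tuple_def)
  qed (simp add: eval_tuple_def lim)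
qed

end

section \<open>Rank, curvature and unitary equivalence\<close>

lemma inj_on_take: "inj_on (\<lambda>k. take k \<gamma>) {..length \<gamma>}"
  by (rule inj_on_inverseI[of _ length]) simp

lemma inj_on_drop: "inj_on (\<lambda>k. drop k \<gamma>) {..length \<gamma>}"
  by (rule inj_on_inverseI[of _ "\<lambda>\<delta>. length \<gamma> - length \<delta>"]) simp

text \<open>The Cauchy product grouped by prefixes of the word; the next lemma groups it by
  suffixes. Comparing both readings identifies a series of left shifts with a series of right
  shifts, coordinate by coordinate.\<close>

lemma nc_mult_has_sum_lshift:
  "((\<lambda>\<beta>. a \<beta> * l2_nth (lshift \<beta> w) \<gamma>) has_sum nc_mult a (l2_nth w) \<gamma>) UNIV"
proof (rule has_sum_finite_neutralI[where B = "(\<lambda>k. take k \<gamma>) ` {..length \<gamma>}"])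
  show "nc_mult a (l2_nth w) \<gamma> = (\<Sum>\<beta>\<in>(\<lambda>k. take k \<gamma>) ` {..length \<gamma>}. a \<beta> * l2_nth (lshift \<beta> w) \<gamma>)"
    unfolding nc_mult_def sum.reindex[OF inj_on_take] by (rule sum.cong) (auto simp: l2_nth_lshift)
  fix \<beta> assume "\<beta> \<in> UNIV - (\<lambda>k. take k \<gamma>) ` {..length \<gamma>}"
  then have "\<beta> \<noteq> take (length \<beta>) \<gamma>"
    by (metis DiffD2 atMost_iff image_eqI length_take min.cobounded1)
  then show "a \<beta> * l2_nth (lshift \<beta> w) \<gamma> = 0" by (simp add: l2_nth_lshift)
qed auto

lemma nc_mult_has_sum_rshift:
  "((\<lambda>\<delta>. w \<delta> * l2_nth (rshift \<delta> a) \<gamma>) has_sum nc_mult (l2_nth a) w \<gamma>) UNIV"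
proof (rule has_sum_finite_neutralI[where B = "(\<lambda>k. drop k \<gamma>) ` {..length \<gamma>}"])
  have "l2_nth (rshift (drop k \<gamma>) a) \<gamma> = l2_nth a (take k \<gamma>)" for k
    using l2_nth_rshift_append[of "drop k \<gamma>" a "take k \<gamma>"] by simp
  then show "nc_mult (l2_nth a) w \<gamma> = (\<Sum>\<delta>\<in>(\<lambda>k. drop k \<gamma>) ` {..length \<gamma>}. w \<delta> * l2_nth (rshift \<delta> a) \<gamma>)"
    unfolding nc_mult_def sum.reindex[OF inj_on_drop] by (simp add: mult.commute)
  fix \<delta> assume "\<delta> \<in> UNIV - (\<lambda>k. drop k \<gamma>) ` {..length \<gamma>}"
  then have "\<gamma> \<noteq> \<alpha> @ \<delta>" for \<alpha>
    by (metis DiffD2 append_eq_conv_conj atMost_iff image_eqI le_add1 length_append)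
  then show "w \<delta> * l2_nth (rshift \<delta> a) \<gamma> = 0" by (simp add: l2_nth_rshift_eq_0)
qed auto

lemma rshift_commute_word:
  assumes "\<And>j u. A (rshift [j] u) = rshift [j] (A u)"
  shows "A (rshift \<beta> u) = rshift \<beta> (A u)"
  by (induction \<beta> rule: rev_induct) (simp_all add: rshift_append assms)

text \<open>An operator commuting with the right shifts acts by left convolution with a square-summable
  family \<open>a\<close>.  On a wandering vector \<open>w\<close> the series \<open>\<Sum> a\<^sub>\<beta> L\<^sub>\<beta> w\<close> converges in norm, because its terms
  are orthogonal.\<close>

lemma (in lshift_invariant) rshift_commuting_on_wandering:
  assumes A: "bounded_op UNIV A" and comm: "\<And>j u. A (rshift [j] u) = rshift [j] (A u)"
    and w: "w \<in> wandering" "cinner w w = 1"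
  shows "((\<lambda>\<beta>. l2_nth (A (l2_single \<alpha> 1)) \<beta> *\<^sub>C lshift \<beta> w) has_sum A (lshift \<alpha> w)) UNIV"
proof -
  define a where "a = A (l2_single \<alpha> 1)"
  have on: "orthonormal_on UNIV (\<lambda>\<beta>. lshift \<beta> w)"
    by (simp add: orthonormal_on_def cinner_lshift_wandering w)
  have "(\<lambda>\<beta>. (cmod (l2_nth a \<beta>))\<^sup>2) summable_on UNIV" using l2_nth_summable[of a] by simp
  then obtain s where s: "((\<lambda>\<beta>. l2_nth a \<beta> *\<^sub>C lshift \<beta> w) has_sum s) UNIV"
    using orthonormal_summable[OF on, of "l2_nth a"] by (auto simp: summable_on_def)
  have "((\<lambda>\<delta>. lshift \<alpha> (l2_nth w \<delta> *\<^sub>C l2_single \<delta> 1)) has_sum lshift \<alpha> w) UNIV"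
    by (rule has_sum_bounded_linear[OF bounded_linear_lshift l2_basis_has_sum])
  then have "((\<lambda>\<delta>. A (l2_nth w \<delta> *\<^sub>C l2_single (\<alpha> @ \<delta>) 1)) has_sum A (lshift \<alpha> w)) UNIV"
    by (intro has_sum_bounded_linear[OF bounded_op_UNIV_bounded_linear[OF A]])
       (simp add: lshift_scaleC lshift_single)
  \<comment> \<open>The basis vector at \<open>\<alpha> @ \<delta>\<close> is the right shift by
    \<open>\<delta>\<close> of the one at \<open>\<alpha>\<close>, so commutation expresses all
    these values through the single vector \<open>a\<close>.\<close>
  moreover have "A (l2_single (\<alpha> @ \<delta>) 1) = rshift \<delta> a" for \<delta>
    unfolding a_def rshift_commute_word[of A, OF comm, symmetric] by (simp add: rshift_single)
  ultimately have A_w: "((\<lambda>\<delta>. l2_nth w \<delta> *\<^sub>C rshift \<delta> a) has_sum A (lshift \<alpha> w)) UNIV"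
    by (simp add: bounded_op_scaleC[OF A])
  have "s = A (lshift \<alpha> w)"
  proof (rule l2_eqI)
    fix \<gamma>
    have "l2_nth s \<gamma> = nc_mult (l2_nth a) (l2_nth w) \<gamma>"
      using has_sum_bounded_linear[OF bounded_linear_l2_nth s, of \<gamma>] nc_mult_has_sum_lshift
      by (auto simp: scaleC_l2.rep_eq scaleC_complex_def intro: has_sum_unique)
    also have "\<dots> = l2_nth (A (lshift \<alpha> w)) \<gamma>"
      using has_sum_bounded_linear[OF bounded_linear_l2_nth A_w, of \<gamma>] nc_mult_has_sum_rshift
      by (auto simp: scaleC_l2.rep_eq scaleC_complex_def intro: has_sum_unique)
    finally show "l2_nth s \<gamma> = l2_nth (A (lshift \<alpha> w)) \<gamma>" .
  qed
  with s show ?thesis by (simp add: a_def)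
qed

section \<open>Defect operator, rank and Poisson trace on an invariant subspace\<close>

context lshift_invariant
begin

text \<open>The operator under the square root agrees on \<open>M\<close> with \<open>proj\<close>,
  a projection and hence its own positive square root.\<close>

lemma defect_eq_proj:
  assumes eval: "\<And>j h. h \<in> M \<Longrightarrow> eval_tuple f M X j h = lshift [j] h" and h: "h \<in> M"
  shows "defect f M X h = proj h"
  unfolding defect_def
proof (rule pos_sqrt_projection[OF subspace bounded_op_proj proj_hermitian _ _ h])
  show "proj (proj x) = proj x" if "x \<in> M" for x
    using that by (intro proj_fixes_wandering proj_wandering)
  have "adj M (eval_tuple f M X i) x = ladj [i] x" for i x
    by (rule adj_cong) (rule eval)
  then show "x - (\<Sum>i\<in>UNIV. eval_tuple f M X i (adj M (eval_tuple f M X i) x)) = proj x" for x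
    by (simp add: proj_def eval ladj_in)
qed

lemma rank_f_eq_cdimension:
  assumes "\<And>j h. h \<in> M \<Longrightarrow> eval_tuple f M X j h = lshift [j] h"
  shows "rank_f f M X = cdimension wandering"
proof -
  have "defect f M X ` M = proj ` M"
    by (rule image_cong) (simp_all add: defect_eq_proj assms)
  then show ?thesis by (simp add: rank_f_def proj_image)
qed

lemma finite_wandering_basis:
  assumes "cdimension wandering < \<infinity>"
  obtains E where "finite E" "orthonormal_on E (\<lambda>x. x)" "complex_vector.span E = wandering"
proof -
  from assms obtain B where B: "finite B" "wandering \<subseteq> complex_vector.span B"
    unfolding cdimension_def by (auto split: if_splits)
  obtain E where "finite E" "E \<subseteq> wandering" "orthonormal_on E (\<lambda>x. x)"
    "complex_vector.span E = wandering"
    by (rule finite_orthonormal_basis_exists[OF subspace_wandering B])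
  with that show ?thesis by blast
qed

text \<open>Parseval in the finite-dimensional space \<open>wandering\<close>: \<open>proj\<close>
  fixes \<open>b\<close>, so moving \<open>proj\<close> and then the adjoint to the other side gives
  the coefficient of \<open>h\<close> at \<open>lshift \<alpha> b\<close>.\<close>

lemma norm_proj_ladj:
  assumes "finite E" "orthonormal_on E (\<lambda>x. x)" "complex_vector.span E = wandering"
  shows "(norm (proj (ladj \<alpha> h)))\<^sup>2 = (\<Sum>b\<in>E. (cmod (cinner h (lshift \<alpha> b)))\<^sup>2)"
proof -
  let ?v = "proj (ladj \<alpha> h)"
  have "?v \<in> closure (complex_vector.span ((\<lambda>x. x) ` E))"
    unfolding image_ident assms(3) by (rule set_mp[OF closure_subset proj_wandering[OF ladj_in]])
  then have "((\<lambda>b. (cmod (cinner ?v b))\<^sup>2) has_sum (norm ?v)\<^sup>2) E"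
    by (rule parseval[OF assms(2)])
  then have "(norm ?v)\<^sup>2 = (\<Sum>b\<in>E. (cmod (cinner ?v b))\<^sup>2)"
    using has_sum_finite[OF assms(1)] by (rule has_sum_unique)
  also have "\<dots> = (\<Sum>b\<in>E. (cmod (cinner h (lshift \<alpha> b)))\<^sup>2)"
  proof (rule sum.cong)
    fix b assume "b \<in> E"
    then have b: "b \<in> wandering" using assms(3) complex_vector.span_base by blast
    then have "cinner ?v b = cinner h (lshift \<alpha> b)"
      by (simp add: proj_hermitian proj_fixes_wandering cinner_ladj' wandering_def)
    then show "(cmod (cinner ?v b))\<^sup>2 = (cmod (cinner h (lshift \<alpha> b)))\<^sup>2" by simp
  qed simp
  finally show ?thesis .
qed

text \<open>\<open>trace_op\<close> sums over a basis chosen by \<open>SOME\<close>; without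
  existence nothing could be said about that choice.\<close>

lemma orthonormal_basis_exists:
  assumes "orthonormal_on E (\<lambda>x. x)" "complex_vector.span E = wandering"
  shows "\<exists>B. orthonormal_basis M B"
proof -
  let ?e = "\<lambda>(\<alpha>, b). lshift \<alpha> b"
  have E: "E \<subseteq> wandering" using assms(2) complex_vector.span_superset by blast
  have on: "orthonormal_on (UNIV \<times> E) ?e" by (rule orthonormal_lshift_wandering[OF E assms(1)])
  have cl: "closure (complex_vector.span (?e ` (UNIV \<times> E))) = M"
    by (rule lshift_wandering_complete[OF assms(2)])
  have "orthonormal_basis M (?e ` (UNIV \<times> E))"
    unfolding orthonormal_basis_def
  proof (intro conjI ballI)
    show "?e ` (UNIV \<times> E) \<subseteq> M"
      using E by (auto simp: wandering_def intro: lshift_in)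
    show "cinner x y = (if x = y then 1 else 0)"
      if "x \<in> ?e ` (UNIV \<times> E)" "y \<in> ?e ` (UNIV \<times> E)" for x y
    proof -
      from that obtain i j where ij: "i \<in> UNIV \<times> E" "x = ?e i" "j \<in> UNIV \<times> E" "y = ?e j" by blast
      have "x = y \<longleftrightarrow> i = j"
        by (simp only: ij inj_on_eq_iff[OF orthonormal_on_inj[OF on] ij(1) ij(3)])
      with on ij show ?thesis unfolding orthonormal_on_def by presburger
    qed
  qed (rule cl)
  then show ?thesis ..
qed

text \<open>The operator under the trace is the sum over words of length at most \<open>m\<close> of
  the projections onto \<open>lshift \<alpha>\<close> of the wandering space. These have orthonormal
  bases formed by the vectors \<open>lshift \<alpha> b\<close>, so the trace counts pairs of a word
  and an element of \<open>E\<close>.\<close>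

lemma poisson_trace_eq:
  assumes eval: "\<And>j h. h \<in> M \<Longrightarrow> eval_tuple f M X j h = lshift [j] h"
    and E: "finite E" "orthonormal_on E (\<lambda>x. x)" "complex_vector.span E = wandering"
  shows "poisson_trace f M X m = real (card {\<alpha> :: 'n list. length \<alpha> \<le> m}) * real (card E)"
proof -
  let ?A = "{\<alpha> :: 'n list. length \<alpha> \<le> m}"
  have finA: "finite ?A" using finite_lists_length_le[of "UNIV :: 'n set" m] by simp
  have Ew: "E \<subseteq> wandering" using E(3) complex_vector.span_superset by blast
  note on = orthonormal_lshift_wandering[OF Ew E(2)]
  have adj_word: "adj M (op_word (eval_tuple f M X) \<alpha>) h = ladj \<alpha> h" for \<alpha> h
  proof (rule adj_cong)
    fix g assume g: "g \<in> M"
    have "op_word (eval_tuple f M X) \<alpha> g = op_word (\<lambda>j. lshift [j]) \<alpha> g"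
      by (rule op_word_cong[where H = M]) (simp_all add: eval g lshift_letter_in)
    also have "\<dots> = lshift \<alpha> g" by (induction \<alpha>) (simp_all add: lshift_Cons[symmetric])
    finally show "op_word (eval_tuple f M X) \<alpha> g = lshift \<alpha> g" .
  qed
  \<comment> \<open>Bessel's inequality for the shifted basis; it makes the coordinates of the
    Poisson kernel a genuine element of \<open>l2\<close>, so that \<open>Abs_l2\<close> can be
    unfolded.\<close>
  have "(\<lambda>\<alpha>. (norm (proj (ladj \<alpha> h)))\<^sup>2) summable_on UNIV" for h
  proof (rule nonneg_bdd_above_summable_on)
    have "(\<Sum>\<alpha>\<in>F. (norm (proj (ladj \<alpha> h)))\<^sup>2) \<le> (norm h)\<^sup>2" if "finite F" for F
      unfolding norm_proj_ladj[OF E] sum.cartesian_product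
      using bessel_inequality[OF on, of "F \<times> E" h] that E(1) by (auto simp: case_prod_unfold)
    then show "bdd_above (sum (\<lambda>\<alpha>. (norm (proj (ladj \<alpha> h)))\<^sup>2) ` {F. F \<subseteq> UNIV \<and> finite F})"
      by (auto intro!: bdd_aboveI[of _ "(norm h)\<^sup>2"])
  qed simp
  then have nth: "l2_nth (Abs_l2 (\<lambda>\<alpha>. proj (ladj \<alpha> h))) \<alpha> = proj (ladj \<alpha> h)" for h \<alpha>
    by (subst Abs_l2_inverse) simp_all
  have kernel: "l2_nth (poisson_kernel f M X h) \<alpha> = proj (ladj \<alpha> h)" for h \<alpha>
  proof -
    have "poisson_kernel f M X h = (\<Sum>\<^sub>\<infinity>\<alpha>. l2_single \<alpha> (proj (ladj \<alpha> h)))"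
      unfolding poisson_kernel_def adj_word by (simp add: defect_eq_proj[OF eval] ladj_in)
    also have "\<dots> = Abs_l2 (\<lambda>\<alpha>. proj (ladj \<alpha> h))"
      using l2_single_has_sum[of "Abs_l2 (\<lambda>\<alpha>. proj (ladj \<alpha> h))"] by (intro infsumI) (simp add: nth)
    finally show ?thesis by (simp add: nth)
  qed
  define T where "T h = adj M (poisson_kernel f M X) (trunc m (poisson_kernel f M X h))" for h
  have T: "T h = (\<Sum>\<alpha>\<in>?A. lshift \<alpha> (proj (ladj \<alpha> h)))" for h
    unfolding T_def
  proof (rule adj_eqI[OF subspace])
    show "(\<Sum>\<alpha>\<in>?A. lshift \<alpha> (proj (ladj \<alpha> h))) \<in> M"
      by (intro complex_vector.subspace_sum[OF subspace] lshift_in proj_in ladj_in)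
    fix g assume g: "g \<in> M"
    have "cinner (poisson_kernel f M X g) (trunc m (poisson_kernel f M X h))
        = (\<Sum>\<^sub>\<infinity>\<alpha>\<in>?A. cinner (proj (ladj \<alpha> g)) (proj (ladj \<alpha> h)))"
      unfolding cinner_l2_def[of "poisson_kernel f M X g"]
      by (rule infsum_cong_neutral) (auto simp: kernel trunc.rep_eq)
    also have "\<dots> = (\<Sum>\<alpha>\<in>?A. cinner g (lshift \<alpha> (proj (ladj \<alpha> h))))"
      using finA by (simp add: proj_hermitian proj_fixes_wandering proj_wandering ladj_in
          cinner_ladj' proj_in)
    finally show "cinner (poisson_kernel f M X g) (trunc m (poisson_kernel f M X h))
        = cinner g (\<Sum>\<alpha>\<in>?A. lshift \<alpha> (proj (ladj \<alpha> h)))"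
      by (simp add: cinner_sum_right)
  qed
  have diag: "cinner (T e) e = of_real (\<Sum>\<alpha>\<in>?A. \<Sum>b\<in>E. (cmod (cinner (lshift \<alpha> b) e))\<^sup>2)" for e
  proof -
    have "cinner (lshift \<alpha> (proj (ladj \<alpha> e))) e = of_real ((norm (proj (ladj \<alpha> e)))\<^sup>2)" for \<alpha>
      by (simp add: cinner_ladj proj_in ladj_in cinner_self[symmetric] proj_hermitian
          proj_fixes_wandering proj_wandering del: of_real_power)
    then show ?thesis
      unfolding T cinner_sum_left
      by (simp add: norm_proj_ladj[OF E] cmod_cinner_commute[of e] del: of_real_power)
  qed
  \<comment> \<open>Nothing is known about the basis chosen in \<open>trace_op\<close>. Parseval
    with respect to \<open>B\<close> is therefore applied to each unit vector
    \<open>lshift \<alpha> b\<close>, after exchanging the sum over \<open>B\<close> with the finite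
    sums.\<close>
  define B where "B = (SOME B. orthonormal_basis M B)"
  have "orthonormal_basis M B"
    unfolding B_def by (rule someI_ex[OF orthonormal_basis_exists[OF E(2,3)]])
  then have B: "orthonormal_on B (\<lambda>x. x)" "closure (complex_vector.span ((\<lambda>x. x) ` B)) = M"
    by (simp_all add: orthonormal_basis_def orthonormal_on_def)
  have "((\<lambda>e. \<Sum>\<alpha>\<in>?A. \<Sum>b\<in>E. (cmod (cinner (lshift \<alpha> b) e))\<^sup>2)
      has_sum (\<Sum>\<alpha>\<in>?A. \<Sum>b\<in>E. (norm (lshift \<alpha> b))\<^sup>2)) B"
    using Ew by (intro has_sum_sum_finite finA E(1) parseval[OF B(1)], unfold B(2))
      (auto simp: wandering_def intro!: lshift_in)
  also have "(\<Sum>\<alpha>\<in>?A. \<Sum>b\<in>E. (norm (lshift \<alpha> b))\<^sup>2) = real (card ?A) * real (card E)"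
  proof -
    have "(norm (lshift \<alpha> b))\<^sup>2 = 1" if "b \<in> E" for \<alpha> b
    proof -
      have "cinner (lshift \<alpha> b) (lshift \<alpha> b) = 1"
        using E(2) that by (simp add: cinner_lshift orthonormal_on_def)
      then show ?thesis by (metis cinner_self of_real_eq_1_iff)
    qed
    then show ?thesis by simp
  qed
  finally have "((\<lambda>e. cinner (T e) e) has_sum of_real (real (card ?A) * real (card E))) B"
    unfolding diag by (rule has_sum_of_real)
  then have "trace_op M T = of_real (real (card ?A) * real (card E))"
    unfolding trace_op_def B_def[symmetric] by (rule infsumI)
  then show ?thesis
    unfolding poisson_trace_def T_def[symmetric, abs_def] by simp
qed

end

lemma lshift_invariant_UNIV: "lshift_invariant UNIV"
  by unfold_locales auto

text \<open>A vector orthogonal to all basis vectors of nonempty words is supported on the empty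
  word. The denominator of the curvature is thus the Poisson trace for a one-dimensional wandering
  space.\<close>

lemma wandering_UNIV:
  "lshift_invariant.wandering UNIV = complex_vector.span {l2_single [] 1 :: 'n::finite hardy}"
proof -
  interpret lshift_invariant "UNIV :: 'n hardy set" by (rule lshift_invariant_UNIV)
  show ?thesis
  proof
    show "wandering \<subseteq> complex_vector.span {l2_single [] 1}"
    proof
      fix w assume w: "w \<in> wandering"
      have "l2_nth w (j # \<alpha>) = 0" for j \<alpha>
      proof -
        have "cinner w (l2_single (j # \<alpha>) 1) = (\<Sum>\<^sub>\<infinity>\<beta>\<in>{j # \<alpha>}. l2_nth w \<beta>)"
          unfolding cinner_l2_def
          by (rule infsum_cong_neutral) (auto simp: l2_single.rep_eq cinner_complex_def)
        moreover have "cinner (l2_single (j # \<alpha>) 1) w = 0"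
          using w lshift_single[of "[j]" \<alpha> 1] by (simp add: wandering_def) (metis append_Cons append_Nil)
        ultimately show ?thesis by (metis cinner_commute complex_cnj_zero finite.intros infsum_finite
            sum.empty sum.insert empty_iff add_0_right)
      qed
      then have "l2_nth w \<gamma> = l2_nth (l2_nth w [] *\<^sub>C l2_single [] 1) \<gamma>" for \<gamma>
        by (cases \<gamma>) (simp_all add: scaleC_l2.rep_eq l2_single.rep_eq scaleC_complex_def)
      then have "w = l2_nth w [] *\<^sub>C l2_single [] 1" by (rule l2_eqI)
      then show "w \<in> complex_vector.span {l2_single [] 1}"
        by (metis complex_vector.span_base complex_vector.span_scale singletonI)
    qed
    have "l2_single [] 1 \<in> wandering"
      by (auto simp: wandering_def cinner_l2_def cinner_complex_def l2_single.rep_eq l2_nth_lshift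
        intro!: infsum_0)
    then show "complex_vector.span {l2_single [] 1} \<subseteq> wandering"
      by (intro complex_vector.span_minimal subspace_wandering) auto
  qed
qed

section \<open>Curvature and unitary equivalence of restrictions of the model\<close>

context hardy_model
begin

text \<open>The number of words cancels, so the quotient defining the curvature is constant in
  \<open>m\<close>.\<close>

lemma
  assumes inv: "invariant_subspace MZ M"
    and E: "finite E" "orthonormal_on E (\<lambda>x. x)" "complex_vector.span E = lshift_invariant.wandering M"
  shows curv_f_eq_card: "curv_f f MZ M MZ = real (card E)"
    and rank_f_eq_card: "rank_f f M MZ = enat (card E)"
proof -
  interpret lshift_invariant M by (rule lshift_invariant[OF inv])
  have eval: "eval_tuple f M MZ j h = lshift [j] h" if "h \<in> M" for j h
    by (rule eval_tuple_restrict[OF inv that])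
  interpret U: lshift_invariant "UNIV :: 'n hardy set" by (rule lshift_invariant_UNIV)
  have "orthonormal_on {l2_single [] 1 :: 'n hardy} (\<lambda>x. x)"
  proof -
    have "cinner (l2_single [] 1) (l2_single [] 1 :: 'n hardy) = (\<Sum>\<^sub>\<infinity>\<beta>\<in>{[] :: 'n list}. 1)"
      unfolding cinner_l2_def
      by (rule infsum_cong_neutral) (auto simp: l2_single.rep_eq cinner_complex_def)
    then show ?thesis by (simp add: orthonormal_on_def)
  qed
  then have "poisson_trace f UNIV MZ m = real (card {\<alpha> :: 'n list. length \<alpha> \<le> m})" for m
    using U.poisson_trace_eq[of f MZ "{l2_single [] 1}" m] by (simp add: eval_MZ wandering_UNIV)
  moreover have "card {\<alpha> :: 'n list. length \<alpha> \<le> m} \<noteq> 0" for m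
    using finite_lists_length_le[of "UNIV :: 'n set" m] by (auto simp: card_eq_0_iff intro: exI[of _ "[]"])
  ultimately have "poisson_trace f M MZ m / poisson_trace f UNIV MZ m = real (card E)" for m
    using poisson_trace_eq[OF eval E] by simp
  then show "curv_f f MZ M MZ = real (card E)" by (simp add: curv_f_def)
  show "rank_f f M MZ = enat (card E)"
    using rank_f_eq_cdimension[OF eval] cdimension_span_orthonormal[OF E(1,2)] E(3) by simp
qed

lemma finite_rank_basis:
  assumes "invariant_subspace MZ M" "rank_f f M MZ < \<infinity>"
  obtains E where "finite E" "orthonormal_on E (\<lambda>x. x)"
    "complex_vector.span E = lshift_invariant.wandering M"
proof -
  interpret lshift_invariant M by (rule lshift_invariant[OF assms(1)])
  have "cdimension wandering < \<infinity>"
    using assms(2) rank_f_eq_cdimension[OF eval_tuple_restrict[OF assms(1)]] by simp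
  from finite_wandering_basis[OF this] that show ?thesis by blast
qed

text \<open>A bijection between the bases of the wandering spaces extends along all words to
  orthonormal bases of \<open>M\<close> and \<open>N\<close>. The resulting unitary is checked
  against \<open>MZ i\<close> on the basis, then everywhere by continuity.\<close>

lemma intertwining_of_card_eq:
  assumes inv: "invariant_subspace MZ M" "invariant_subspace MZ N"
    and E: "finite E" "orthonormal_on E (\<lambda>x. x)" "complex_vector.span E = lshift_invariant.wandering M"
    and E': "finite E'" "orthonormal_on E' (\<lambda>x. x)" "complex_vector.span E' = lshift_invariant.wandering N"
    and card: "card E = card E'"
  shows "\<exists>U. unitary_op M N U \<and> (\<forall>i. \<forall>h\<in>M. U (MZ i h) = MZ i (U h))"
proof -
  interpret M: lshift_invariant M by (rule lshift_invariant[OF inv(1)])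
  interpret N: lshift_invariant N by (rule lshift_invariant[OF inv(2)])
  obtain \<sigma> where \<sigma>: "bij_betw \<sigma> E E'"
    using finite_same_card_bij[OF E(1) E'(1) card] by blast
  have EM: "E \<subseteq> M.wandering" and EN: "E' \<subseteq> N.wandering"
    using E(3) E'(3) complex_vector.span_superset by blast+
  define e where "e = (\<lambda>(\<alpha>, b :: 'n hardy). lshift \<alpha> b)"
  define e' where "e' = (\<lambda>(\<alpha>, b). lshift \<alpha> (\<sigma> b))"
  let ?I = "(UNIV :: 'n list set) \<times> E"
  have on: "orthonormal_on ?I e" unfolding e_def by (rule M.orthonormal_lshift_wandering[OF EM E(2)])
  have cl: "closure (complex_vector.span (e ` ?I)) = M"
    unfolding e_def by (rule M.lshift_wandering_complete[OF E(3)])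
  have \<sigma>E: "\<sigma> b \<in> E'" if "b \<in> E" for b using \<sigma> that by (auto simp: bij_betw_def)
  have \<sigma>w: "\<sigma> b \<in> N.wandering" if "b \<in> E" for b using \<sigma>E[OF that] EN by blast
  have "cinner (\<sigma> b) (\<sigma> b') = (if b = b' then 1 else 0)" if "b \<in> E" "b' \<in> E" for b b'
    using \<sigma>E[OF that(1)] \<sigma>E[OF that(2)] E'(2) \<sigma> that
    by (auto simp: orthonormal_on_def bij_betw_def dest: inj_onD)
  then have on': "orthonormal_on ?I e'"
    by (auto simp: orthonormal_on_def e'_def N.cinner_lshift_wandering \<sigma>w)
  have "e' ` ?I = (\<lambda>(\<alpha>, b). lshift \<alpha> b) ` (UNIV \<times> E')"
    using \<sigma> by (force simp: e'_def bij_betw_def image_iff)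
  then have cl': "closure (complex_vector.span (e' ` ?I)) = N"
    using N.lshift_wandering_complete[OF E'(3)] by simp
  obtain U where U: "unitary_op M N U" "\<And>i. i \<in> ?I \<Longrightarrow> U (e i) = e' i"
    using unitary_op_of_bases[OF on cl on' cl'] by blast
  have eM: "e i \<in> M" if "i \<in> ?I" for i
    using that EM by (auto simp: e_def M.wandering_def intro: M.lshift_in)
  have MZM: "MZ i h \<in> M" if "h \<in> M" for i h
    using inv(1) that by (auto simp: invariant_subspace_def)
  have scale: "U (c *\<^sub>C x) = c *\<^sub>C U x" if "x \<in> M" for c x
    using U(1) that by (simp add: unitary_op_def)
  have basis: "U (MZ i (lshift \<alpha> b)) = MZ i (lshift \<alpha> (\<sigma> b))" if b: "b \<in> E" for i \<alpha> b
  proof -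
    have bw: "b \<in> M.wandering" "cinner b b = 1" and \<sigma>b: "cinner (\<sigma> b) (\<sigma> b) = 1"
      using b EM E(2) E'(2) \<sigma>E[OF b] by (auto simp: orthonormal_on_def)
    have bM: "lshift \<beta> b \<in> M" for \<beta> using bw(1) by (simp add: M.wandering_def M.lshift_in)
    \<comment> \<open>These coefficients depend on \<open>i\<close> and \<open>\<alpha>\<close> but
      not on the wandering vector, so the expansions at \<open>b\<close> and at
      \<open>\<sigma> b\<close> have the same ones.\<close>
    let ?a = "l2_nth (MZ i (l2_single \<alpha> 1))"
    have "((\<lambda>\<beta>. U (?a \<beta> *\<^sub>C lshift \<beta> b)) has_sum U (MZ i (lshift \<alpha> b))) UNIV"
      by (rule unitary_op_has_sum[OF M.subspace M.closed U(1)
            M.rshift_commuting_on_wandering[OF bounded_MZ rshift_commute bw]])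
         (intro complex_vector.subspace_scale[OF M.subspace] bM)
    moreover have "U (?a \<beta> *\<^sub>C lshift \<beta> b) = ?a \<beta> *\<^sub>C lshift \<beta> (\<sigma> b)" for \<beta>
      using U(2)[of "(\<beta>, b)"] b by (simp add: scale bM e_def e'_def)
    ultimately have "((\<lambda>\<beta>. ?a \<beta> *\<^sub>C lshift \<beta> (\<sigma> b)) has_sum U (MZ i (lshift \<alpha> b))) UNIV" by simp
    then show ?thesis
      using N.rshift_commuting_on_wandering[OF bounded_MZ rshift_commute \<sigma>w[OF b] \<sigma>b]
      by (rule has_sum_unique)
  qed
  have "U (MZ i h) = MZ i (U h)" if h: "h \<in> M" for i h
  proof -
    note lin = bounded_op_UNIV_bounded_linear[OF bounded_MZ[of i]]
    have s: "((\<lambda>k. cinner h (e k) *\<^sub>C e k) has_sum h) ?I"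
      using h by (intro orthonormal_expansion[OF on]) (simp add: cl)
    have "((\<lambda>k. MZ i (cinner h (e k) *\<^sub>C e k)) has_sum MZ i h) ?I"
      by (rule has_sum_bounded_linear[OF lin s])
    then have "((\<lambda>k. U (MZ i (cinner h (e k) *\<^sub>C e k))) has_sum U (MZ i h)) ?I"
      by (rule unitary_op_has_sum[OF M.subspace M.closed U(1)])
         (intro MZM complex_vector.subspace_scale[OF M.subspace] eM)
    moreover have MZ_U: "((\<lambda>k. MZ i (U (cinner h (e k) *\<^sub>C e k))) has_sum MZ i (U h)) ?I"
      by (intro has_sum_bounded_linear[OF lin] unitary_op_has_sum[OF M.subspace M.closed U(1) s]
          complex_vector.subspace_scale[OF M.subspace] eM)
    moreover have "U (MZ i (cinner h (e k) *\<^sub>C e k)) = MZ i (U (cinner h (e k) *\<^sub>C e k))" if "k \<in> ?I" for k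
    proof -
      have "U (MZ i (e k)) = MZ i (U (e k))"
        using basis U(2)[OF that] that by (auto simp: e_def e'_def)
      then show ?thesis by (simp add: bounded_op_scaleC[OF bounded_MZ] scale eM[OF that] MZM)
    qed
    ultimately have "((\<lambda>k. MZ i (U (cinner h (e k) *\<^sub>C e k))) has_sum U (MZ i h)) ?I"
      by (simp cong: has_sum_cong)
    then show ?thesis using MZ_U by (rule has_sum_unique)
  qed
  with U(1) show ?thesis by blast
qed

text \<open>Only one inequality; the other comes from applying the lemma to the adjoint of
  \<open>U\<close>. Since \<open>U\<close> maps \<open>M\<close> onto \<open>N\<close> and commutes
  with left creation, it sends wandering vectors to wandering vectors, and \<open>E\<close> to an
  independent set in the span of \<open>E'\<close>.\<close>

lemma card_eq_of_intertwining:
  assumes inv: "invariant_subspace MZ M" "invariant_subspace MZ N"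
    and E: "finite E" "orthonormal_on E (\<lambda>x. x)" "complex_vector.span E = lshift_invariant.wandering M"
    and E': "finite E'" "orthonormal_on E' (\<lambda>x. x)" "complex_vector.span E' = lshift_invariant.wandering N"
    and U: "unitary_op M N U" "\<And>i h. h \<in> M \<Longrightarrow> U (MZ i h) = MZ i (U h)"
  shows "card E \<le> card E'"
proof -
  interpret M: lshift_invariant M by (rule lshift_invariant[OF inv(1)])
  interpret N: lshift_invariant N by (rule lshift_invariant[OF inv(2)])
  have EM: "E \<subseteq> M" "E \<subseteq> M.wandering"
    using E(3) complex_vector.span_superset[of E] by (auto simp: M.wandering_def)
  have pres: "cinner (U x) (U y) = cinner x y" if "x \<in> M" "y \<in> M" for x y
    using U(1) that by (simp add: unitary_op_def)
  have on: "orthonormal_on E U"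
    using E(2) EM(1) by (auto simp: orthonormal_on_def pres subset_iff)
  have "U w \<in> N.wandering" if w: "w \<in> M.wandering" for w
  proof -
    have "cinner (lshift [j] g) (U w) = 0" if "g \<in> N" for j g
    proof -
      obtain x where x: "x \<in> M" "g = U x" using U(1) \<open>g \<in> N\<close> by (auto simp: unitary_op_def)
      have "cinner (lshift [j] g) (U w) = cinner (U (lshift [j] x)) (U w)"
        using unitary_lshift_commute[OF inv(1) U x(1)] x(2) by simp
      also have "\<dots> = 0"
        using w x(1) by (simp add: pres M.wandering_def M.lshift_in)
      finally show ?thesis .
    qed
    moreover have "U w \<in> N" using U(1) w by (auto simp: unitary_op_def M.wandering_def)
    ultimately show ?thesis by (simp add: N.wandering_def)
  qed
  then have "U ` E \<subseteq> complex_vector.span E'" using EM(2) E'(3) by auto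
  moreover have "orthonormal_on (U ` E) (\<lambda>x. x)"
    using on orthonormal_on_inj[OF on] by (auto simp: orthonormal_on_def inj_on_eq_iff)
  ultimately have "card (U ` E) \<le> card E'"
    using complex_vector.independent_span_bound[OF E'(1) orthonormal_independent] by blast
  then show ?thesis by (simp add: card_image orthonormal_on_inj[OF on])
qed

lemma rank_curvature_unitary_equivalence:
  assumes inv: "invariant_subspace MZ M" "invariant_subspace MZ N"
  shows "(rank_f f M MZ < \<infinity> \<longrightarrow> ereal (curv_f f MZ M MZ) = ereal_of_enat (rank_f f M MZ)) \<and>
    (rank_f f M MZ < \<infinity> \<and> rank_f f N MZ < \<infinity> \<longrightarrow>
      (unitarily_equivalent M MZ N MZ \<longleftrightarrow> curv_f f MZ M MZ = curv_f f MZ N MZ))"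
proof (intro conjI impI)
  assume "rank_f f M MZ < \<infinity>"
  then obtain E where E: "finite E" "orthonormal_on E (\<lambda>x. x)"
      "complex_vector.span E = lshift_invariant.wandering M"
    by (rule finite_rank_basis[OF inv(1)])
  show "ereal (curv_f f MZ M MZ) = ereal_of_enat (rank_f f M MZ)"
    by (simp add: curv_f_eq_card[OF inv(1) E] rank_f_eq_card[OF inv(1) E])
next
  assume fin: "rank_f f M MZ < \<infinity> \<and> rank_f f N MZ < \<infinity>"
  obtain E where E: "finite E" "orthonormal_on E (\<lambda>x. x)"
      "complex_vector.span E = lshift_invariant.wandering M"
    using finite_rank_basis[OF inv(1)] fin by blast
  obtain E' where E': "finite E'" "orthonormal_on E' (\<lambda>x. x)"
      "complex_vector.span E' = lshift_invariant.wandering N"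
    using finite_rank_basis[OF inv(2)] fin by blast
  have M: "complex_vector.subspace M" "\<And>i h. h \<in> M \<Longrightarrow> MZ i h \<in> M"
    and N: "complex_vector.subspace N" "\<And>i h. h \<in> N \<Longrightarrow> MZ i h \<in> N"
    using inv unfolding invariant_subspace_def by blast+
  have "unitarily_equivalent M MZ N MZ \<longleftrightarrow>
      (\<exists>U. unitary_op M N U \<and> (\<forall>i. \<forall>h\<in>M. U (MZ i h) = MZ i (U h)))"
    by (rule unitarily_equivalent_iff_intertwining[OF M(1) M(2) N(2)])
  also have "\<dots> \<longleftrightarrow> card E = card E'"
  proof
    assume "\<exists>U. unitary_op M N U \<and> (\<forall>i. \<forall>h\<in>M. U (MZ i h) = MZ i (U h))"
    then obtain U where U: "unitary_op M N U" "\<And>i h. h \<in> M \<Longrightarrow> U (MZ i h) = MZ i (U h)" by blast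
    have "card E \<le> card E'" by (rule card_eq_of_intertwining[OF inv E E' U])
    moreover have "card E' \<le> card E"
    proof (rule card_eq_of_intertwining[OF inv(2,1) E' E])
      show "unitary_op N M (adj M U)" by (rule unitary_op_adj[OF M(1) U(1)])
      show "adj M U (MZ i h) = MZ i (adj M U h)" if h: "h \<in> N" for i h
      proof -
        obtain x where x: "x \<in> M" "h = U x" using U(1) h by (auto simp: unitary_op_def)
        have "adj M U (U x) = x" "adj M U (U (MZ i x)) = MZ i x"
          using adj_unitary[OF M(1) U(1)] x(1) M(2) by auto
        then show ?thesis using x U(2) by simp
      qed
    qed
    ultimately show "card E = card E'" by simp
  next
    assume "card E = card E'"
    then show "\<exists>U. unitary_op M N U \<and> (\<forall>i. \<forall>h\<in>M. U (MZ i h) = MZ i (U h))"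
      by (rule intertwining_of_card_eq[OF inv E E'])
  qed
  finally show "unitarily_equivalent M MZ N MZ \<longleftrightarrow> curv_f f MZ M MZ = curv_f f MZ N MZ"
    by (simp add: curv_f_eq_card[OF inv(1) E] curv_f_eq_card[OF inv(2) E'])
qed

end

section \<open>Substitution into noncommutative power series\<close>

lemma nc_mult_Nil: "nc_mult p q [] = p [] * q []"
  by (simp add: nc_mult_def)

lemma nc_mult_Cons: "nc_mult p q (x # \<gamma>) = p [] * q (x # \<gamma>) + nc_mult (\<lambda>\<delta>. p (x # \<delta>)) q \<gamma>"
  by (simp add: nc_mult_def sum.atMost_Suc_shift del: sum.atMost_Suc)

lemma nc_mult_cong:
  assumes "\<And>\<delta>. length \<delta> \<le> length \<gamma> \<Longrightarrow> p \<delta> = p' \<delta>" "\<And>\<delta>. length \<delta> \<le> length \<gamma> \<Longrightarrow> q \<delta> = q' \<delta>"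
  shows "nc_mult p q \<gamma> = nc_mult p' q' \<gamma>"
  unfolding nc_mult_def by (intro sum.cong refl) (simp add: assms)

lemma nc_mult_sum_left:
  "nc_mult (\<lambda>\<delta>. \<Sum>i\<in>F. c i * p i \<delta>) q \<gamma> = (\<Sum>i\<in>F. c i * nc_mult (p i) q \<gamma>)"
  unfolding nc_mult_def sum_distrib_left sum_distrib_right
  by (subst sum.swap) (simp add: mult_ac)

lemma nc_mult_sum_right:
  "nc_mult p (\<lambda>\<delta>. \<Sum>i\<in>F. c i * q i \<delta>) \<gamma> = (\<Sum>i\<in>F. c i * nc_mult p (q i) \<gamma>)"
  unfolding nc_mult_def sum_distrib_left sum_distrib_right
  by (subst sum.swap) (simp add: mult_ac)

lemma nc_mult_add_left: "nc_mult (\<lambda>\<delta>. a * p \<delta> + p' \<delta>) q \<gamma> = a * nc_mult p q \<gamma> + nc_mult p' q \<gamma>"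
  by (simp add: nc_mult_def sum.distrib sum_distrib_left algebra_simps)

text \<open>Induction on the word by removing its first letter. This replaces the left factor by its
  series of tails, up to a multiple of a tail of \<open>q\<close>, so \<open>p\<close> must be
  arbitrary.\<close>

lemma nc_mult_assoc: "nc_mult (nc_mult p q) r = nc_mult p (nc_mult q r)"
proof
  fix \<gamma>
  show "nc_mult (nc_mult p q) r \<gamma> = nc_mult p (nc_mult q r) \<gamma>"
  proof (induction \<gamma> arbitrary: p)
    case Nil
    then show ?case by (simp add: nc_mult_Nil)
  next
    case (Cons x \<gamma>)
    have "nc_mult (nc_mult p q) r (x # \<gamma>) = p [] * q [] * r (x # \<gamma>) +
        (p [] * nc_mult (\<lambda>\<delta>. q (x # \<delta>)) r \<gamma> + nc_mult (nc_mult (\<lambda>\<delta>. p (x # \<delta>)) q) r \<gamma>)"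
      unfolding nc_mult_Cons[of "nc_mult p q"] nc_mult_Nil nc_mult_Cons[of p q]
      by (simp only: nc_mult_add_left)
    also have "\<dots> = nc_mult p (nc_mult q r) (x # \<gamma>)"
      unfolding Cons.IH nc_mult_Cons[of p] nc_mult_Cons[of q] by (simp add: algebra_simps)
    finally show ?case .
  qed
qed

lemma nc_mult_zero_left: "nc_mult (\<lambda>_. 0) q = (\<lambda>_. 0)"
  by (rule ext) (simp add: nc_mult_def)

lemma nc_mult_one_left [simp]: "nc_mult nc_one q = q"
proof
  fix \<gamma>
  have "(\<lambda>\<delta>. nc_one (x # \<delta>)) = (\<lambda>_. 0)" for x :: 'a by (simp add: nc_one_def fun_eq_iff)
  then show "nc_mult nc_one q \<gamma> = q \<gamma>"
    by (cases \<gamma>) (simp_all add: nc_mult_Nil nc_mult_Cons nc_mult_zero_left, simp_all add: nc_one_def)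
qed

lemma nc_mult_one_right [simp]: "nc_mult p nc_one = p"
proof
  fix \<gamma>
  show "nc_mult p nc_one \<gamma> = p \<gamma>"
    by (induction \<gamma> arbitrary: p) (simp_all add: nc_mult_Nil nc_mult_Cons, simp_all add: nc_one_def)
qed

lemma nc_mult_var_left [simp]:
  "nc_mult (nc_var j) q [] = 0" "nc_mult (nc_var j) q (x # \<gamma>) = (if x = j then q \<gamma> else 0)"
proof -
  have "(\<lambda>\<delta>. nc_var j (x # \<delta>)) = (if x = j then nc_one else (\<lambda>_. 0))"
    by (auto simp: nc_var_def nc_one_def fun_eq_iff)
  then show "nc_mult (nc_var j) q (x # \<gamma>) = (if x = j then q \<gamma> else 0)"
    by (simp add: nc_mult_Cons nc_mult_zero_left nc_var_def[of j "[]"])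
qed (simp add: nc_mult_Nil nc_var_def)

lemma nc_mult_var_right [simp]:
  "nc_mult p (nc_var j) [] = 0" "nc_mult p (nc_var j) (\<gamma> @ [x]) = (if x = j then p \<gamma> else 0)"
proof -
  show "nc_mult p (nc_var j) (\<gamma> @ [x]) = (if x = j then p \<gamma> else 0)"
    by (induction \<gamma> arbitrary: p) (auto simp: nc_mult_Cons nc_mult_Nil nc_var_def)
qed (simp add: nc_mult_Nil nc_var_def)

lemma l2_nth_lshift_var: "l2_nth (lshift [j] u) = nc_mult (nc_var j) (l2_nth u)"
proof
  fix \<gamma>
  show "l2_nth (lshift [j] u) \<gamma> = nc_mult (nc_var j) (l2_nth u) \<gamma>"
    by (cases \<gamma>) (auto simp: l2_nth_lshift)
qed

lemma l2_nth_rshift_var: "l2_nth (rshift [j] u) = nc_mult (l2_nth u) (nc_var j)"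
proof
  fix \<gamma>
  show "l2_nth (rshift [j] u) \<gamma> = nc_mult (l2_nth u) (nc_var j) \<gamma>"
  proof (cases \<gamma> rule: rev_cases)
    case (snoc \<alpha> x)
    then show ?thesis
      by (cases "x = j") (auto simp: l2_nth_rshift_eq_0)
  qed (simp add: l2_nth_rshift_eq_0)
qed

lemma nc_word_Nil [simp]: "nc_word f [] = nc_one"
  by (simp add: nc_word_def)

lemma nc_word_Cons [simp]: "nc_word f (j # \<alpha>) = nc_mult (f j) (nc_word f \<alpha>)"
  by (simp add: nc_word_def)

lemma nc_word_snoc: "nc_word f (\<alpha> @ [j]) = nc_mult (nc_word f \<alpha>) (f j)"
  by (induction \<alpha>) (simp_all add: nc_mult_assoc)

lemma nc_word_var: "nc_word nc_var \<alpha> \<gamma> = (if \<gamma> = \<alpha> then 1 else 0)"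
proof (induction \<alpha> arbitrary: \<gamma>)
  case (Cons j \<alpha>)
  then show ?case by (cases \<gamma>) auto
qed (simp add: nc_one_def)

lemma nc_subst_eq:
  assumes "finite A" "\<And>\<alpha>. \<alpha> \<notin> A \<Longrightarrow> c \<alpha> * nc_word f \<alpha> \<gamma> = 0"
  shows "nc_subst c f \<gamma> = (\<Sum>\<alpha>\<in>A. c \<alpha> * nc_word f \<alpha> \<gamma>)"
  unfolding nc_subst_def using assms by (intro sum.mono_neutral_left) auto

text \<open>Local finiteness: up to degree \<open>n\<close> only finitely many words contribute. The
  set \<open>A\<close> serves all words up to that length at once, because a Cauchy product at a
  word involves all its prefixes and suffixes.\<close>

definition nc_substitutable :: "'n ncseries \<Rightarrow> ('n \<Rightarrow> 'n ncseries) \<Rightarrow> bool" where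
  "nc_substitutable c f \<longleftrightarrow> (\<forall>n. \<exists>A. finite A \<and>
     (\<forall>\<alpha>. \<alpha> \<notin> A \<longrightarrow> c \<alpha> = 0 \<or> (\<forall>\<gamma>. length \<gamma> \<le> n \<longrightarrow> nc_word f \<alpha> \<gamma> = 0)))"

lemma nc_substitutableD:
  assumes "nc_substitutable c f"
  obtains A where "finite A"
    "\<And>\<alpha> \<gamma>. \<alpha> \<notin> A \<Longrightarrow> length \<gamma> \<le> n \<Longrightarrow> c \<alpha> \<noteq> 0 \<Longrightarrow> nc_word f \<alpha> \<gamma> = 0"
    "\<And>\<gamma>. length \<gamma> \<le> n \<Longrightarrow> nc_subst c f \<gamma> = (\<Sum>\<alpha>\<in>A. c \<alpha> * nc_word f \<alpha> \<gamma>)"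
proof -
  obtain A where A: "finite A"
    "\<And>\<alpha>. \<alpha> \<notin> A \<Longrightarrow> c \<alpha> = 0 \<or> (\<forall>\<gamma>. length \<gamma> \<le> n \<longrightarrow> nc_word f \<alpha> \<gamma> = 0)"
    using assms unfolding nc_substitutable_def by metis
  show ?thesis
  proof (rule that[OF A(1)])
    show "nc_word f \<alpha> \<gamma> = 0" if "\<alpha> \<notin> A" "length \<gamma> \<le> n" "c \<alpha> \<noteq> 0" for \<alpha> \<gamma>
      using A(2) that by blast
    show "nc_subst c f \<gamma> = (\<Sum>\<alpha>\<in>A. c \<alpha> * nc_word f \<alpha> \<gamma>)" if "length \<gamma> \<le> n" for \<gamma>
      by (rule nc_subst_eq[OF A(1)]) (use A(2) that in auto)
  qed
qed

lemma nc_substitutable_polynomial: "nc_polynomial c \<Longrightarrow> nc_substitutable c f"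
  unfolding nc_substitutable_def nc_polynomial_def
  by (intro allI exI[of _ "{\<alpha>. c \<alpha> \<noteq> 0}"]) simp

text \<open>Without constant terms each factor of a nonzero contribution consumes at least one
  letter.\<close>

lemma nc_word_eq_0:
  assumes "\<And>j. f j [] = 0"
  shows "length \<gamma> < length \<alpha> \<Longrightarrow> nc_word f \<alpha> \<gamma> = 0"
proof (induction \<alpha> arbitrary: \<gamma>)
  case (Cons j \<alpha>)
  have "f j (take k \<gamma>) * nc_word f \<alpha> (drop k \<gamma>) = 0" if "k \<le> length \<gamma>" for k
  proof (cases k)
    case (Suc k')
    then have "length (drop k \<gamma>) < length \<alpha>" using Cons.prems that by simp
    then show ?thesis by (simp add: Cons.IH)
  qed (simp add: assms)
  then show ?case by (auto simp: nc_mult_def intro!: sum.neutral)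
qed simp

lemma nc_substitutable_zero_constant:
  fixes f :: "'n::finite \<Rightarrow> 'n ncseries"
  assumes "\<And>j. f j [] = 0"
  shows "nc_substitutable c f"
  unfolding nc_substitutable_def
proof
  fix n
  show "\<exists>A. finite A \<and> (\<forall>\<alpha>. \<alpha> \<notin> A \<longrightarrow> c \<alpha> = 0 \<or> (\<forall>\<gamma>. length \<gamma> \<le> n \<longrightarrow> nc_word f \<alpha> \<gamma> = 0))"
    using finite_lists_length_le[of "UNIV :: 'n set" n]
    by (intro exI[of _ "{\<alpha>. length \<alpha> \<le> n}"]) (auto intro!: nc_word_eq_0[of f, OF assms])
qed

text \<open>Substitution turns left creation into left multiplication by \<open>f j\<close>;
  \<open>nc_subst_mult_var\<close> does the same for right creation. As \<open>MZ i\<close> becomes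
  left multiplication by a variable, its commutation with \<open>rshift [j]\<close> is associativity
  once substitution is injective.\<close>

lemma nc_subst_var_mult:
  fixes f :: "'n \<Rightarrow> 'n ncseries"
  assumes "nc_substitutable c f"
  shows "nc_subst (nc_mult (nc_var j) c) f = nc_mult (f j) (nc_subst c f)"
proof
  fix \<gamma> :: "'n list"
  obtain A where A: "finite A"
    "\<And>\<alpha> \<delta>. \<alpha> \<notin> A \<Longrightarrow> length \<delta> \<le> length \<gamma> \<Longrightarrow> c \<alpha> \<noteq> 0 \<Longrightarrow> nc_word f \<alpha> \<delta> = 0"
    "\<And>\<delta>. length \<delta> \<le> length \<gamma> \<Longrightarrow> nc_subst c f \<delta> = (\<Sum>\<alpha>\<in>A. c \<alpha> * nc_word f \<alpha> \<delta>)"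
    by (rule nc_substitutableD[OF assms, where n = "length \<gamma>"]) (rule that; blast)
  have "nc_subst (nc_mult (nc_var j) c) f \<gamma>
      = (\<Sum>\<beta>\<in>(#) j ` A. nc_mult (nc_var j) c \<beta> * nc_word f \<beta> \<gamma>)"
  proof (rule nc_subst_eq)
    fix \<beta> assume \<beta>: "\<beta> \<notin> (#) j ` A"
    show "nc_mult (nc_var j) c \<beta> * nc_word f \<beta> \<gamma> = 0"
    proof (cases \<beta>)
      case (Cons i \<alpha>)
      have "nc_mult (f j) (nc_word f \<alpha>) \<gamma> = 0" if "i = j" "c \<alpha> \<noteq> 0"
      proof -
        have "\<alpha> \<notin> A" using \<beta> Cons that by auto
        then show ?thesis
          unfolding nc_mult_def by (intro sum.neutral) (simp add: A(2) that)
      qed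
      then show ?thesis using Cons by auto
    qed simp
  qed (use A in simp)
  also have "\<dots> = (\<Sum>\<alpha>\<in>A. c \<alpha> * nc_mult (f j) (nc_word f \<alpha>) \<gamma>)"
    by (subst sum.reindex) simp_all
  also have "\<dots> = nc_mult (f j) (\<lambda>\<delta>. \<Sum>\<alpha>\<in>A. c \<alpha> * nc_word f \<alpha> \<delta>) \<gamma>"
    by (rule nc_mult_sum_right[symmetric])
  also have "\<dots> = nc_mult (f j) (nc_subst c f) \<gamma>"
    by (rule nc_mult_cong) (simp_all add: A(3))
  finally show "nc_subst (nc_mult (nc_var j) c) f \<gamma> = nc_mult (f j) (nc_subst c f) \<gamma>" .
qed

lemma nc_subst_mult_var:
  fixes f :: "'n \<Rightarrow> 'n ncseries"
  assumes "nc_substitutable c f"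
  shows "nc_subst (nc_mult c (nc_var j)) f = nc_mult (nc_subst c f) (f j)"
proof
  fix \<gamma> :: "'n list"
  obtain A where A: "finite A"
    "\<And>\<alpha> \<delta>. \<alpha> \<notin> A \<Longrightarrow> length \<delta> \<le> length \<gamma> \<Longrightarrow> c \<alpha> \<noteq> 0 \<Longrightarrow> nc_word f \<alpha> \<delta> = 0"
    "\<And>\<delta>. length \<delta> \<le> length \<gamma> \<Longrightarrow> nc_subst c f \<delta> = (\<Sum>\<alpha>\<in>A. c \<alpha> * nc_word f \<alpha> \<delta>)"
    by (rule nc_substitutableD[OF assms, where n = "length \<gamma>"]) (rule that; blast)
  have "nc_subst (nc_mult c (nc_var j)) f \<gamma>
      = (\<Sum>\<beta>\<in>(\<lambda>\<alpha>. \<alpha> @ [j]) ` A. nc_mult c (nc_var j) \<beta> * nc_word f \<beta> \<gamma>)"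
  proof (rule nc_subst_eq)
    fix \<beta> assume \<beta>: "\<beta> \<notin> (\<lambda>\<alpha>. \<alpha> @ [j]) ` A"
    show "nc_mult c (nc_var j) \<beta> * nc_word f \<beta> \<gamma> = 0"
    proof (cases \<beta> rule: rev_cases)
      case (snoc \<alpha> i)
      have "nc_mult (nc_word f \<alpha>) (f j) \<gamma> = 0" if "i = j" "c \<alpha> \<noteq> 0"
      proof -
        have "\<alpha> \<notin> A" using \<beta> snoc that by auto
        then show ?thesis
          unfolding nc_mult_def by (intro sum.neutral) (simp add: A(2) that)
      qed
      then show ?thesis using snoc by (auto simp: nc_word_snoc)
    qed simp
  qed (use A in simp)
  also have "\<dots> = (\<Sum>\<alpha>\<in>A. c \<alpha> * nc_mult (nc_word f \<alpha>) (f j) \<gamma>)"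
    by (subst sum.reindex) (simp_all add: inj_on_def nc_word_snoc)
  also have "\<dots> = nc_mult (\<lambda>\<delta>. \<Sum>\<alpha>\<in>A. c \<alpha> * nc_word f \<alpha> \<delta>) (f j) \<gamma>"
    by (rule nc_mult_sum_left[symmetric])
  also have "\<dots> = nc_mult (nc_subst c f) (f j) \<gamma>"
    by (rule nc_mult_cong) (simp_all add: A(3))
  finally show "nc_subst (nc_mult c (nc_var j)) f \<gamma> = nc_mult (nc_subst c f) (f j) \<gamma>" .
qed

lemma nc_subst_diff:
  assumes "nc_substitutable c f" "nc_substitutable d f"
  shows "nc_subst (\<lambda>\<alpha>. c \<alpha> - d \<alpha>) f \<gamma> = nc_subst c f \<gamma> - nc_subst d f \<gamma>"
proof -
  obtain A where A: "finite A"
    "\<And>\<alpha> \<delta>. \<alpha> \<notin> A \<Longrightarrow> length \<delta> \<le> length \<gamma> \<Longrightarrow> c \<alpha> \<noteq> 0 \<Longrightarrow> nc_word f \<alpha> \<delta> = 0"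
    "\<And>\<delta>. length \<delta> \<le> length \<gamma> \<Longrightarrow> nc_subst c f \<delta> = (\<Sum>\<alpha>\<in>A. c \<alpha> * nc_word f \<alpha> \<delta>)"
    by (rule nc_substitutableD[OF assms(1), where n = "length \<gamma>"]) (rule that; blast)
  obtain B where B: "finite B"
    "\<And>\<alpha> \<delta>. \<alpha> \<notin> B \<Longrightarrow> length \<delta> \<le> length \<gamma> \<Longrightarrow> d \<alpha> \<noteq> 0 \<Longrightarrow> nc_word f \<alpha> \<delta> = 0"
    "\<And>\<delta>. length \<delta> \<le> length \<gamma> \<Longrightarrow> nc_subst d f \<delta> = (\<Sum>\<alpha>\<in>B. d \<alpha> * nc_word f \<alpha> \<delta>)"
    by (rule nc_substitutableD[OF assms(2), where n = "length \<gamma>"]) (rule that; blast)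
  have c: "c \<alpha> * nc_word f \<alpha> \<gamma> = 0" if "\<alpha> \<notin> A \<union> B" for \<alpha> using A(2)[of \<alpha> \<gamma>] that by auto
  have d: "d \<alpha> * nc_word f \<alpha> \<gamma> = 0" if "\<alpha> \<notin> A \<union> B" for \<alpha> using B(2)[of \<alpha> \<gamma>] that by auto
  have fin: "finite (A \<union> B)" using A(1) B(1) by simp
  have "(c \<alpha> - d \<alpha>) * nc_word f \<alpha> \<gamma> = 0" if "\<alpha> \<notin> A \<union> B" for \<alpha>
    using c[OF that] d[OF that] by auto
  then have "nc_subst (\<lambda>\<alpha>. c \<alpha> - d \<alpha>) f \<gamma> = (\<Sum>\<alpha>\<in>A \<union> B. (c \<alpha> - d \<alpha>) * nc_word f \<alpha> \<gamma>)"
    by (rule nc_subst_eq[OF fin])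
  also have "\<dots> = (\<Sum>\<alpha>\<in>A \<union> B. c \<alpha> * nc_word f \<alpha> \<gamma>) - (\<Sum>\<alpha>\<in>A \<union> B. d \<alpha> * nc_word f \<alpha> \<gamma>)"
    by (simp add: left_diff_distrib sum_subtractf)
  also have "\<dots> = nc_subst c f \<gamma> - nc_subst d f \<gamma>"
    using nc_subst_eq[OF fin, of c f \<gamma>] nc_subst_eq[OF fin, of d f \<gamma>] c d by simp
  finally show ?thesis .
qed

section \<open>Injectivity of substitution when the Jacobian is invertible\<close>

lemma sum_words_Suc:
  fixes F :: "'n::finite list \<Rightarrow> 'a::comm_monoid_add"
  shows "(\<Sum>\<alpha> | length \<alpha> = Suc k. F \<alpha>) = (\<Sum>j\<in>UNIV. \<Sum>\<alpha> | length \<alpha> = k. F (j # \<alpha>))"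
proof -
  have "{\<alpha> :: 'n list. length \<alpha> = Suc k} = (\<lambda>(j, \<alpha>). j # \<alpha>) ` (UNIV \<times> {\<alpha>. length \<alpha> = k})"
    by (auto simp: length_Suc_conv image_iff)
  then show ?thesis
    by (simp add: sum.reindex inj_on_def sum.cartesian_product case_prod_unfold)
qed

text \<open>With as many factors as letters and no constant terms, every factor must take exactly
  one letter, so only the linear parts of \<open>f\<close> survive.\<close>

lemma nc_word_same_length:
  assumes "\<And>j. f j [] = 0" "length \<alpha> = length \<gamma>"
  shows "nc_word f (a # \<alpha>) (x # \<gamma>) = f a [x] * nc_word f \<alpha> \<gamma>"
proof -
  have "nc_mult (\<lambda>\<delta>. f a (x # \<delta>)) (nc_word f \<alpha>) \<gamma>
      = (\<Sum>k\<in>{0}. f a (x # take k \<gamma>) * nc_word f \<alpha> (drop k \<gamma>))"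
    unfolding nc_mult_def
    by (rule sum.mono_neutral_right) (auto intro!: nc_word_eq_0[of f, OF assms(1)] simp: assms(2))
  then show ?thesis by (simp add: nc_mult_Cons assms(1))
qed

text \<open>The matrix \<open>(nc_word f \<alpha> \<gamma>)\<close> with \<open>|\<alpha>| = |\<gamma>| = k\<close> is the \<open>k\<close>-th tensor power of the Jacobian at \<open>0\<close>.\<close>

lemma nc_word_tensor_power_injective:
  fixes f :: "'n::finite \<Rightarrow> 'n ncseries"
  assumes f0: "\<And>j. f j [] = 0" and det: "det (\<chi> i j. f i [j]) \<noteq> 0"
    and zero: "\<And>\<gamma>. length \<gamma> = k \<Longrightarrow> (\<Sum>\<alpha> | length \<alpha> = k. c \<alpha> * nc_word f \<alpha> \<gamma>) = 0"
    and \<alpha>: "length \<alpha> = k"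
  shows "c \<alpha> = 0"
  using zero \<alpha>
proof (induction k arbitrary: c \<alpha>)
  case 0
  then show ?case using "0.prems"(1)[of "[]"] by (simp add: nc_one_def)
next
  case (Suc k)
  let ?J = "\<chi> i j. f i [j]"
  have "invertible (transpose ?J)" using det by (simp add: invertible_det_nz)
  then have ker: "transpose ?J *v v = 0 \<Longrightarrow> v = 0" for v
    unfolding invertible_def by (metis matrix_left_invertible_ker)
  have inner: "(\<Sum>\<alpha> | length \<alpha> = k. c (a # \<alpha>) * nc_word f \<alpha> \<gamma>) = 0" if \<gamma>: "length \<gamma> = k" for a \<gamma>
  proof -
    \<comment> \<open>Indexed by the first letter of the summation word. Splitting off that letter
      shows that the transposed Jacobian annihilates \<open>v\<close>, which removes one tensor
      factor.\<close>
    define v :: "complex ^ 'n" where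
      "v = (\<chi> a. \<Sum>\<alpha> | length \<alpha> = k. c (a # \<alpha>) * nc_word f \<alpha> \<gamma>)"
    have "(transpose ?J *v v) $ x = 0" for x
    proof -
      have "(transpose ?J *v v) $ x
          = (\<Sum>a\<in>UNIV. \<Sum>\<alpha> | length \<alpha> = k. c (a # \<alpha>) * nc_word f (a # \<alpha>) (x # \<gamma>))"
        using \<gamma> by (auto simp: matrix_vector_mult_def transpose_def v_def sum_distrib_left mult_ac
            nc_word_same_length[of f, OF f0] simp del: nc_word_Cons intro!: sum.cong)
      also have "\<dots> = 0" using Suc.prems(1)[of "x # \<gamma>"] \<gamma> by (simp add: sum_words_Suc)
      finally show ?thesis .
    qed
    then have "transpose ?J *v v = 0" by (simp add: vec_eq_iff)
    then have "v = 0" by (rule ker)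
    then show ?thesis by (simp add: v_def vec_eq_iff)
  qed
  obtain a \<alpha>' where "\<alpha> = a # \<alpha>'" "length \<alpha>' = k"
    using Suc.prems(2) by (auto simp: length_Suc_conv)
  then show ?case using Suc.IH[of "\<lambda>\<alpha>. c (a # \<alpha>)", OF inner] by simp
qed

text \<open>The coefficient matrix is triangular by degree: at a word of length \<open>k\<close>,
  longer words contribute nothing and shorter ones have zero coefficient by induction. What remains
  is the invertible tensor power of the Jacobian.\<close>

lemma nc_subst_injective_jacobian:
  fixes f :: "'n::finite \<Rightarrow> 'n ncseries"
  assumes f0: "\<And>j. f j [] = 0" and det: "det (\<chi> i j. f i [j]) \<noteq> 0"
    and eq: "nc_subst c f = nc_subst d f"
  shows "c = d"
proof -
  define b where "b \<alpha> = c \<alpha> - d \<alpha>" for \<alpha>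
  have zero: "nc_subst b f \<gamma> = 0" for \<gamma>
    unfolding b_def using nc_subst_diff[OF nc_substitutable_zero_constant nc_substitutable_zero_constant, of f, OF f0 f0] eq
    by simp
  have "b \<alpha> = 0" for \<alpha>
  proof (induction "length \<alpha>" arbitrary: \<alpha> rule: less_induct)
    case less
    show ?case
    proof (rule nc_word_tensor_power_injective[OF f0 det _ refl])
      fix \<gamma> :: "'n list" assume \<gamma>: "length \<gamma> = length \<alpha>"
      have "nc_subst b f \<gamma> = (\<Sum>\<beta> | length \<beta> = length \<alpha>. b \<beta> * nc_word f \<beta> \<gamma>)"
      proof (rule nc_subst_eq)
        show "finite {\<beta> :: 'n list. length \<beta> = length \<alpha>}"
          using finite_lists_length_eq[of "UNIV :: 'n set"] by simp
        fix \<beta> :: "'n list" assume "\<beta> \<notin> {\<beta>. length \<beta> = length \<alpha>}"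
        then show "b \<beta> * nc_word f \<beta> \<gamma> = 0"
          using less nc_word_eq_0[of f \<gamma> \<beta>, OF f0] \<gamma> by (cases "length \<beta> < length \<alpha>") auto
      qed
      then show "(\<Sum>\<beta> | length \<beta> = length \<alpha>. b \<beta> * nc_word f \<beta> \<gamma>) = 0" using zero by simp
    qed
  qed
  then show ?thesis by (auto simp: b_def fun_eq_iff)
qed

section \<open>Polynomial substitution and its inverse\<close>

lemma nc_polynomial_mult:
  assumes "nc_polynomial p" "nc_polynomial q"
  shows "nc_polynomial (nc_mult p q)"
  unfolding nc_polynomial_def
proof (rule finite_subset)
  show "{\<alpha>. nc_mult p q \<alpha> \<noteq> 0} \<subseteq> (\<lambda>(\<alpha>, \<beta>). \<alpha> @ \<beta>) ` ({\<alpha>. p \<alpha> \<noteq> 0} \<times> {\<beta>. q \<beta> \<noteq> 0})"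
  proof
    fix \<gamma> assume "\<gamma> \<in> {\<alpha>. nc_mult p q \<alpha> \<noteq> 0}"
    then obtain k where "p (take k \<gamma>) * q (drop k \<gamma>) \<noteq> 0"
      unfolding nc_mult_def mem_Collect_eq by (meson sum.not_neutral_contains_not_neutral)
    then show "\<gamma> \<in> (\<lambda>(\<alpha>, \<beta>). \<alpha> @ \<beta>) ` ({\<alpha>. p \<alpha> \<noteq> 0} \<times> {\<beta>. q \<beta> \<noteq> 0})"
      by (intro image_eqI[of _ _ "(take k \<gamma>, drop k \<gamma>)"]) auto
  qed
qed (use assms in \<open>simp add: nc_polynomial_def\<close>)

lemma nc_polynomial_var: "nc_polynomial (nc_var j)"
  unfolding nc_polynomial_def by (rule finite_subset[of _ "{[j]}"]) (auto simp: nc_var_def)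

lemma nc_polynomial_one: "nc_polynomial nc_one"
  unfolding nc_polynomial_def by (rule finite_subset[of _ "{[]}"]) (auto simp: nc_one_def)

lemma nc_polynomial_word: "(\<And>j. nc_polynomial (f j)) \<Longrightarrow> nc_polynomial (nc_word f \<alpha>)"
  by (induction \<alpha>) (simp_all add: nc_polynomial_one nc_polynomial_mult)

lemma nc_polynomial_sum:
  assumes "finite F" "\<And>i. i \<in> F \<Longrightarrow> nc_polynomial (p i)"
  shows "nc_polynomial (\<lambda>\<alpha>. \<Sum>i\<in>F. c i * p i \<alpha>)"
  unfolding nc_polynomial_def
proof (rule finite_subset)
  show "{\<alpha>. (\<Sum>i\<in>F. c i * p i \<alpha>) \<noteq> 0} \<subseteq> (\<Union>i\<in>F. {\<alpha>. p i \<alpha> \<noteq> 0})"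
    by (auto intro: sum.neutral)
qed (use assms in \<open>auto simp: nc_polynomial_def\<close>)

lemma nc_subst_sum:
  assumes "finite F" "\<And>i. i \<in> F \<Longrightarrow> nc_polynomial (p i)"
  shows "nc_subst (\<lambda>\<alpha>. \<Sum>i\<in>F. c i * p i \<alpha>) f \<gamma> = (\<Sum>i\<in>F. c i * nc_subst (p i) f \<gamma>)"
proof -
  define A where "A = (\<Union>i\<in>F. {\<alpha>. p i \<alpha> \<noteq> 0})"
  have A: "finite A" using assms by (auto simp: A_def nc_polynomial_def)
  have out: "p i \<alpha> = 0" if "\<alpha> \<notin> A" "i \<in> F" for i \<alpha> using that by (auto simp: A_def)
  have "nc_subst (\<lambda>\<alpha>. \<Sum>i\<in>F. c i * p i \<alpha>) f \<gamma> = (\<Sum>\<alpha>\<in>A. (\<Sum>i\<in>F. c i * p i \<alpha>) * nc_word f \<alpha> \<gamma>)"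
    by (rule nc_subst_eq[OF A]) (simp add: out)
  also have "\<dots> = (\<Sum>i\<in>F. c i * (\<Sum>\<alpha>\<in>A. p i \<alpha> * nc_word f \<alpha> \<gamma>))"
    unfolding sum_distrib_left sum_distrib_right by (subst sum.swap) (simp add: mult_ac)
  also have "\<dots> = (\<Sum>i\<in>F. c i * nc_subst (p i) f \<gamma>)"
    by (rule sum.cong) (simp_all add: nc_subst_eq[OF A] out)
  finally show ?thesis .
qed

lemma nc_polynomial_expansion:
  assumes "nc_polynomial p"
  shows "p = (\<lambda>\<gamma>. \<Sum>\<alpha> | p \<alpha> \<noteq> 0. p \<alpha> * nc_word nc_var \<alpha> \<gamma>)"
proof
  fix \<gamma>
  have "(\<Sum>\<alpha> | p \<alpha> \<noteq> 0. p \<alpha> * nc_word nc_var \<alpha> \<gamma>) = (\<Sum>\<alpha> | p \<alpha> \<noteq> 0. if \<gamma> = \<alpha> then p \<alpha> else 0)"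
    by (rule sum.cong) (simp_all add: nc_word_var)
  then show "p \<gamma> = (\<Sum>\<alpha> | p \<alpha> \<noteq> 0. p \<alpha> * nc_word nc_var \<alpha> \<gamma>)"
    using assms by (simp add: nc_polynomial_def)
qed

lemma nc_mult_polynomial_expansion:
  assumes "nc_polynomial p"
  shows "nc_mult p q \<gamma> = (\<Sum>\<alpha> | p \<alpha> \<noteq> 0. p \<alpha> * nc_mult (nc_word nc_var \<alpha>) q \<gamma>)"
  by (subst nc_polynomial_expansion[OF assms]) (rule nc_mult_sum_left)

lemma nc_subst_polynomial:
  assumes "nc_polynomial p"
  shows "nc_subst p f \<gamma> = (\<Sum>\<alpha> | p \<alpha> \<noteq> 0. p \<alpha> * nc_word f \<alpha> \<gamma>)"
  by (rule nc_subst_eq) (use assms in \<open>simp_all add: nc_polynomial_def\<close>)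

text \<open>Both sides are linear in \<open>p\<close>, so monomials suffice, and these are built one
  letter at a time with \<open>nc_subst_var_mult\<close>.\<close>

lemma nc_subst_mult:
  assumes p: "nc_polynomial p" and q: "nc_polynomial q"
  shows "nc_subst (nc_mult p q) g = nc_mult (nc_subst p g) (nc_subst q g)"
proof
  fix \<gamma>
  have poly: "nc_polynomial (nc_mult (nc_word nc_var \<alpha>) q)" for \<alpha>
    by (intro nc_polynomial_mult nc_polynomial_word nc_polynomial_var q)
  have word: "nc_subst (nc_mult (nc_word nc_var \<alpha>) q) g = nc_mult (nc_word g \<alpha>) (nc_subst q g)" for \<alpha>
    by (induction \<alpha>)
       (simp_all add: nc_mult_assoc nc_subst_var_mult nc_substitutable_polynomial poly)
  have fin: "finite {\<alpha>. p \<alpha> \<noteq> 0}" using p by (simp add: nc_polynomial_def)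
  have "nc_subst (nc_mult p q) g \<gamma>
      = (\<Sum>\<alpha> | p \<alpha> \<noteq> 0. p \<alpha> * nc_subst (nc_mult (nc_word nc_var \<alpha>) q) g \<gamma>)"
    unfolding nc_mult_polynomial_expansion[OF p, abs_def] by (rule nc_subst_sum[OF fin poly])
  also have "\<dots> = nc_mult (nc_subst p g) (nc_subst q g) \<gamma>"
    unfolding word nc_subst_polynomial[OF p, abs_def] by (rule nc_mult_sum_left[symmetric])
  finally show "nc_subst (nc_mult p q) g \<gamma> = nc_mult (nc_subst p g) (nc_subst q g) \<gamma>" .
qed

lemma nc_subst_one: "nc_subst nc_one g = nc_one"
proof
  fix \<gamma>
  show "nc_subst nc_one g \<gamma> = nc_one \<gamma>"
    by (subst nc_subst_eq[of "{[]}"]) (auto simp: nc_one_def)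
qed

text \<open>Substituting \<open>g\<close> is a left inverse: by multiplicativity it takes the
  product of \<open>f\<close> along a word to the monomial of that word.\<close>

lemma nc_subst_injective_polynomial:
  assumes f: "\<And>j. nc_polynomial (f j)" and fg: "\<And>j. nc_subst (f j) g = nc_var j"
    and c: "nc_polynomial c" and d: "nc_polynomial d" and eq: "nc_subst c f = nc_subst d f"
  shows "c = d"
proof -
  have word: "nc_subst (nc_word f \<alpha>) g = nc_word nc_var \<alpha>" for \<alpha>
    by (induction \<alpha>) (simp_all add: nc_subst_one nc_subst_mult f fg nc_polynomial_word)
  have "nc_subst (nc_subst p f) g = p" if p: "nc_polynomial p" for p
  proof
    fix \<gamma>
    have "nc_subst (nc_subst p f) g \<gamma> = (\<Sum>\<alpha> | p \<alpha> \<noteq> 0. p \<alpha> * nc_subst (nc_word f \<alpha>) g \<gamma>)"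
      unfolding nc_subst_polynomial[OF p, abs_def]
      by (rule nc_subst_sum) (use p in \<open>simp_all add: nc_polynomial_def[of p] nc_polynomial_word f\<close>)
    also have "\<dots> = p \<gamma>" unfolding word by (rule fun_cong[OF nc_polynomial_expansion[OF p], symmetric])
    finally show "nc_subst (nc_subst p f) g \<gamma> = p \<gamma>" .
  qed
  then show ?thesis using c d eq by metis
qed

section \<open>The three model cases\<close>

text \<open>Here \<open>f_j(MZ)\<close> being left creation is not part of the assumptions. It is a
  finite sum of words in \<open>MZ\<close>, hence bounded, and on basis vectors it represents the
  polynomial \<open>f j\<close> times the given one, as left creation does; injectivity on
  polynomials and continuity conclude.\<close>

lemma polynomial_hardy_model:
  fixes f :: "'n::finite \<Rightarrow> 'n ncseries"
  assumes "polynomial_model f MZ"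
  shows "hardy_model f MZ"
proof -
  obtain g where f: "\<And>j. nc_polynomial (f j)" and fg: "\<And>j. nc_subst (f j) g = nc_var j"
    and MZ: "\<And>i. bounded_op UNIV (MZ i)"
    and poly: "\<And>i u. nc_polynomial (l2_nth u) \<Longrightarrow> nc_polynomial (l2_nth (MZ i u))"
    and subst: "\<And>i u. nc_polynomial (l2_nth u) \<Longrightarrow>
      nc_subst (l2_nth (MZ i u)) f = nc_mult (nc_var i) (nc_subst (l2_nth u) f)"
    using assms unfolding polynomial_model_def by blast
  have inject: "u = v" if "nc_polynomial (l2_nth u)" "nc_polynomial (l2_nth v)"
      "nc_subst (l2_nth u) f = nc_subst (l2_nth v) f" for u v :: "'n hardy"
    using nc_subst_injective_polynomial[of f, OF f fg that] by (simp add: l2_nth_inject)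
  have poly_single: "nc_polynomial (l2_nth (l2_single \<alpha> 1 :: 'n hardy))" for \<alpha>
    unfolding nc_polynomial_def by (rule finite_subset[of _ "{\<alpha>}"]) (auto simp: l2_single.rep_eq)
  have word: "nc_polynomial (l2_nth (op_word MZ \<alpha> u)) \<and>
      nc_subst (l2_nth (op_word MZ \<alpha> u)) f = nc_mult (nc_word nc_var \<alpha>) (nc_subst (l2_nth u) f)"
    if "nc_polynomial (l2_nth u)" for \<alpha> u
    using that by (induction \<alpha>) (simp_all add: poly subst nc_mult_assoc)
  define supp where "supp j = {\<alpha>. f j \<alpha> \<noteq> 0}" for j
  have fin: "finite (supp j)" for j using f[of j] by (simp add: supp_def nc_polynomial_def)
  define F where "F j u = (\<Sum>\<alpha>\<in>supp j. f j \<alpha> *\<^sub>C op_word MZ \<alpha> u)" for j u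
  have sums: "hom_part (f j) MZ k u = (\<Sum>\<alpha>\<in>{\<alpha>\<in>supp j. length \<alpha> = k}. f j \<alpha> *\<^sub>C op_word MZ \<alpha> u)" for j k u
    unfolding hom_part_def using finite_lists_length_eq[of "UNIV :: 'n set" k]
    by (intro sum.mono_neutral_right) (auto simp: supp_def)
  have vanish: "hom_part (f j) MZ k u = 0" if "k \<notin> length ` supp j" for j k u
    unfolding sums using that by (intro sum.neutral) auto
  have "summable (\<lambda>k. hom_part (f j) MZ k u)" for j u
    by (rule summable_finite[of "length ` supp j"]) (simp_all add: fin vanish)
  then have conv: "MZ \<in> conv_SOT f UNIV" by (simp add: conv_SOT_def MZ)
  have series: "series_at (f j) MZ u = F j u" for j u
  proof -
    have "series_at (f j) MZ u = (\<Sum>k\<in>length ` supp j. hom_part (f j) MZ k u)"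
      unfolding series_at_def by (rule suminf_finite) (simp_all add: fin vanish)
    also have "\<dots> = F j u"
      unfolding sums F_def by (rule sum.group) (simp_all add: fin)
    finally show ?thesis .
  qed
  have F: "bounded_op UNIV (F j)" for j
    unfolding F_def[abs_def] by (intro bounded_op_lincomb bounded_op_op_word MZ)
  have F_eq: "F j u = lshift [j] u" for j u
  proof (rule bounded_op_eqI[OF F])
    show "bounded_op UNIV (lshift [j])" by (rule bounded_op_lshift) simp
    fix \<alpha>
    let ?e = "l2_single \<alpha> 1 :: 'n hardy"
    note e = poly_single[of \<alpha>]
    have nth: "l2_nth (F j ?e) = (\<lambda>\<gamma>. \<Sum>\<beta>\<in>supp j. f j \<beta> * l2_nth (op_word MZ \<beta> ?e) \<gamma>)"
      by (rule ext) (simp add: F_def l2_nth_sum scaleC_l2.rep_eq scaleC_complex_def)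
    show "F j ?e = lshift [j] ?e"
    proof (rule inject)
      show "nc_polynomial (l2_nth (F j ?e))"
        unfolding nth by (intro nc_polynomial_sum fin) (simp add: word e)
      show "nc_polynomial (l2_nth (lshift [j] ?e))"
        by (simp add: lshift_single poly_single)
      show "nc_subst (l2_nth (F j ?e)) f = nc_subst (l2_nth (lshift [j] ?e)) f"
      proof
        fix \<gamma>
        have "nc_subst (l2_nth (F j ?e)) f \<gamma>
            = (\<Sum>\<beta>\<in>supp j. f j \<beta> * nc_mult (nc_word nc_var \<beta>) (nc_subst (l2_nth ?e) f) \<gamma>)"
          unfolding nth using word[OF e] by (subst nc_subst_sum[OF fin]) simp_all
        also have "\<dots> = nc_mult (f j) (nc_subst (l2_nth ?e) f) \<gamma>"
          unfolding supp_def by (rule nc_mult_polynomial_expansion[OF f, symmetric])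
        also have "\<dots> = nc_subst (l2_nth (lshift [j] ?e)) f \<gamma>"
          unfolding l2_nth_lshift_var
          by (simp add: nc_subst_var_mult nc_substitutable_polynomial[OF e])
        finally show "nc_subst (l2_nth (F j ?e)) f \<gamma> = nc_subst (l2_nth (lshift [j] ?e)) f \<gamma>" .
      qed
    qed
  qed
  show ?thesis
  proof
    show "MZ i (rshift [j] u) = rshift [j] (MZ i u)" for i j u
    proof (rule bounded_op_eqI[of "\<lambda>u. MZ i (rshift [j] u)" "\<lambda>u. rshift [j] (MZ i u)"])
      fix \<alpha>
      let ?e = "l2_single \<alpha> 1 :: 'n hardy"
      have e': "nc_polynomial (l2_nth (rshift [j] ?e))"
        by (simp add: rshift_single poly_single)
      show "MZ i (rshift [j] ?e) = rshift [j] (MZ i ?e)"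
      proof (rule inject)
        show "nc_polynomial (l2_nth (rshift [j] (MZ i ?e)))"
          unfolding l2_nth_rshift_var
          by (intro nc_polynomial_mult nc_polynomial_var poly poly_single)
        show "nc_subst (l2_nth (MZ i (rshift [j] ?e))) f = nc_subst (l2_nth (rshift [j] (MZ i ?e))) f"
          unfolding subst[OF e'] l2_nth_rshift_var
          by (simp add: nc_subst_mult_var nc_substitutable_polynomial poly poly_single subst nc_mult_assoc)
      qed (rule poly[OF e'])
    next
      show "bounded_op UNIV (\<lambda>u. MZ i (rshift [j] u))"
        by (rule bounded_op_compose[OF MZ bounded_op_rshift])
      show "bounded_op UNIV (\<lambda>u. rshift [j] (MZ i u))"
        by (rule bounded_op_compose[OF bounded_op_rshift MZ])
    qed
    show "eval_tuple f UNIV MZ j u = lshift [j] u" for j u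
      unfolding eval_tuple_def if_P[OF conv] series by (rule F_eq)
  qed (use MZ conv in auto)
qed

lemma series_hardy_model:
  fixes f :: "'n::finite \<Rightarrow> 'n ncseries"
  assumes "series_model f MZ"
  shows "hardy_model f MZ"
proof -
  have f0: "\<And>j. f j [] = 0" and det: "det (\<chi> i j. f i [j]) \<noteq> 0"
    and MZ: "\<And>i. bounded_op UNIV (MZ i)"
    and subst: "\<And>i u. nc_subst (l2_nth (MZ i u)) f = nc_mult (nc_var i) (nc_subst (l2_nth u) f)"
    and conv: "MZ \<in> conv_SOT f UNIV \<union> conv_rad f UNIV"
    and eval: "\<And>j u. nc_subst (l2_nth (eval_tuple f UNIV MZ j u)) f
      = nc_mult (f j) (nc_subst (l2_nth u) f)"
    using assms unfolding series_model_def by blast+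
  have inject: "u = v" if "nc_subst (l2_nth u) f = nc_subst (l2_nth v) f" for u v :: "'n hardy"
    using nc_subst_injective_jacobian[of f, OF f0 det that] by (simp add: l2_nth_inject)
  note ok = nc_substitutable_zero_constant[of f, OF f0]
  show ?thesis
  proof
    show "MZ i (rshift [j] u) = rshift [j] (MZ i u)" for i j u
      by (rule inject) (simp add: subst l2_nth_rshift_var nc_subst_mult_var[OF ok] nc_mult_assoc)
    show "eval_tuple f UNIV MZ j u = lshift [j] u" for j u
      by (rule inject) (simp add: eval l2_nth_lshift_var nc_subst_var_mult[OF ok])
  qed (use MZ conv in auto)
qed

section \<open>Free holomorphic functions evaluated at strict row contractions\<close>

lemma op_ball_row_contraction:
  assumes "Y \<in> op_ball 1"
  shows "\<exists>\<rho>. 0 \<le> \<rho> \<and> \<rho> < 1 \<and> (\<forall>h. (\<Sum>i\<in>UNIV. (norm (adj UNIV (Y i) h))\<^sup>2) \<le> \<rho> * (norm h)\<^sup>2)"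
proof -
  define T where "T h = (\<Sum>i\<in>UNIV. Y i (adj UNIV (Y i) h))" for h
  have Y: "bounded_op UNIV (Y i)" for i using assms by (simp add: op_ball_def)
  have T: "bounded_linear T"
    unfolding T_def[abs_def]
    by (intro bounded_linear_sum bounded_linear_compose[of "Y _" "adj UNIV (Y _)"]
        bounded_op_UNIV_bounded_linear bounded_op_adj Y)
  have "sqrt (onorm T) < 1" using assms by (simp add: op_ball_def row_norm_def T_def[abs_def])
  then have "onorm T < 1" by simp
  moreover have "(\<Sum>i\<in>UNIV. (norm (adj UNIV (Y i) h))\<^sup>2) \<le> onorm T * (norm h)\<^sup>2" for h
  proof -
    have "(norm (adj UNIV (Y i) h))\<^sup>2 = inner (Y i (adj UNIV (Y i) h)) h" for i
      using cinner_adj[OF _ _ Y[of i], of "adj UNIV (Y i) h" h] by (simp add: inner_cinner cinner_self)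
    then have "(\<Sum>i\<in>UNIV. (norm (adj UNIV (Y i) h))\<^sup>2) = inner (T h) h"
      by (simp add: T_def inner_sum_left)
    also have "\<dots> \<le> norm (T h) * norm h" by (rule norm_cauchy_schwarz)
    also have "\<dots> \<le> onorm T * norm h * norm h" by (intro mult_right_mono onorm T) simp
    finally show ?thesis by (simp add: power2_eq_square mult_ac)
  qed
  ultimately show ?thesis using onorm_pos_le[OF T] by blast
qed

text \<open>Iterating the row bound controls the adjoints of all words of length \<open>k\<close>
  together by \<open>\<rho> ^ k\<close>. Pairing the homogeneous part with itself and applying
  Cauchy-Schwarz over these words gives the estimate; the factor 2 is inherited from
  \<open>norm_cinner_le\<close>.\<close>

lemma hom_part_bound:
  fixes u :: "'n::finite hardy"
  assumes Y: "\<And>i. bounded_op UNIV (Y i)" and \<rho>: "0 \<le> \<rho>"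
    and row: "\<And>h. (\<Sum>i\<in>UNIV. (norm (adj UNIV (Y i) h))\<^sup>2) \<le> \<rho> * (norm h)\<^sup>2"
  shows "norm (hom_part (l2_nth u) Y k h) \<le> 2 * norm h * norm u * sqrt \<rho> ^ k"
proof -
  have adj: "cinner (op_word Y \<alpha> g) y = cinner g (adj UNIV (op_word Y \<alpha>) y)" for \<alpha> g y
    by (rule cinner_adj[OF _ _ bounded_op_op_word[OF Y]]) simp_all
  have adj_Cons: "adj UNIV (op_word Y (i # \<alpha>)) y = adj UNIV (op_word Y \<alpha>) (adj UNIV (Y i) y)" for i \<alpha> y
    using cinner_adj[OF _ _ Y[of i]] by (intro adj_eqI) (simp_all add: adj)
  have words: "(\<Sum>\<alpha> | length \<alpha> = k. (norm (adj UNIV (op_word Y \<alpha>) y))\<^sup>2) \<le> \<rho> ^ k * (norm y)\<^sup>2" for k y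
  proof (induction k arbitrary: y)
    case 0
    have "adj UNIV (op_word Y []) y = y" by (rule adj_eqI) simp_all
    then show ?case by (simp del: op_word_Nil)
  next
    case (Suc k)
    have "(\<Sum>\<alpha> | length \<alpha> = Suc k. (norm (adj UNIV (op_word Y \<alpha>) y))\<^sup>2)
        = (\<Sum>i\<in>UNIV. \<Sum>\<alpha> | length \<alpha> = k. (norm (adj UNIV (op_word Y \<alpha>) (adj UNIV (Y i) y)))\<^sup>2)"
      by (simp only: sum_words_Suc adj_Cons)
    also have "\<dots> \<le> (\<Sum>i\<in>UNIV. \<rho> ^ k * (norm (adj UNIV (Y i) y))\<^sup>2)"
      by (intro sum_mono Suc.IH)
    also have "\<dots> \<le> \<rho> ^ k * (\<rho> * (norm y)\<^sup>2)"
      unfolding sum_distrib_left[symmetric] using \<rho> by (intro mult_left_mono row) simp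
    finally show ?case by (simp add: mult_ac)
  qed
  let ?W = "{\<alpha> :: 'n list. length \<alpha> = k}"
  have fin: "finite ?W" using finite_lists_length_eq[of "UNIV :: 'n set" k] by simp
  define v where "v = hom_part (l2_nth u) Y k h"
  have "(norm v)\<^sup>2 = cmod (cinner v v)" by (simp add: cinner_self norm_power)
  also have "cinner v v = (\<Sum>\<alpha>\<in>?W. l2_nth u \<alpha> * cinner h (adj UNIV (op_word Y \<alpha>) v))"
    by (subst (1) v_def) (simp add: hom_part_def cinner_sum_left cinner_scaleC_left adj)
  also have "cmod \<dots> \<le> (\<Sum>\<alpha>\<in>?W. cmod (l2_nth u \<alpha>) * (2 * (norm h * norm (adj UNIV (op_word Y \<alpha>) v))))"
    by (rule sum_norm_le) (simp add: norm_mult mult_left_mono norm_cinner_le)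
  also have "\<dots> = 2 * norm h * (\<Sum>\<alpha>\<in>?W. \<bar>cmod (l2_nth u \<alpha>)\<bar> * \<bar>norm (adj UNIV (op_word Y \<alpha>) v)\<bar>)"
    by (simp add: sum_distrib_left mult_ac)
  also have "\<dots> \<le> 2 * norm h * (L2_set (\<lambda>\<alpha>. cmod (l2_nth u \<alpha>)) ?W
      * L2_set (\<lambda>\<alpha>. norm (adj UNIV (op_word Y \<alpha>) v)) ?W)"
    by (intro mult_left_mono L2_set_mult_ineq) simp
  also have "\<dots> \<le> 2 * norm h * (norm u * (sqrt \<rho> ^ k * norm v))"
  proof (intro mult_left_mono mult_mono)
    show "L2_set (\<lambda>\<alpha>. cmod (l2_nth u \<alpha>)) ?W \<le> norm u"
      unfolding L2_set_def by (rule real_le_lsqrt) (simp_all add: l2_sum_le_norm_sq[OF fin] sum_nonneg)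
    show "L2_set (\<lambda>\<alpha>. norm (adj UNIV (op_word Y \<alpha>) v)) ?W \<le> sqrt \<rho> ^ k * norm v"
      unfolding L2_set_def
    proof (rule real_le_lsqrt)
      have "(sqrt \<rho> ^ k)\<^sup>2 = (sqrt \<rho>)\<^sup>2 ^ k" by (simp only: power_mult[symmetric] mult.commute)
      then show "(\<Sum>\<alpha>\<in>?W. (norm (adj UNIV (op_word Y \<alpha>) v))\<^sup>2) \<le> (sqrt \<rho> ^ k * norm v)\<^sup>2"
        using words[of v k] \<rho> by (simp add: power_mult_distrib)
    qed (use \<rho> in simp)
  qed (simp_all add: L2_set_nonneg \<rho>)
  finally have "norm v * norm v \<le> (2 * norm h * norm u * sqrt \<rho> ^ k) * norm v"
    by (simp add: power2_eq_square mult_ac)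
  then show ?thesis
    unfolding v_def[symmetric] using \<rho> by (cases "norm v = 0") (auto simp: mult_le_cancel_right)
qed

lemma summable_hom_part_op_ball:
  assumes "Y \<in> op_ball 1"
  shows "summable (\<lambda>k. hom_part (l2_nth u) Y k h)"
proof -
  obtain \<rho> where \<rho>: "0 \<le> \<rho>" "\<rho> < 1"
    and row: "\<And>h. (\<Sum>i\<in>UNIV. (norm (adj UNIV (Y i) h))\<^sup>2) \<le> \<rho> * (norm h)\<^sup>2"
    using op_ball_row_contraction[OF assms] by blast
  have Y: "bounded_op UNIV (Y i)" for i using assms by (simp add: op_ball_def)
  have geo: "summable (\<lambda>k. 2 * norm h * norm u * sqrt \<rho> ^ k)"
    using \<rho> by (intro summable_mult summable_geometric) (simp add: real_sqrt_lt_1_iff)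
  show ?thesis
    by (rule summable_comparison_test'[OF geo]) (rule hom_part_bound[OF Y \<rho>(1) row])
qed

text \<open>The norms of the homogeneous coefficient blocks are bounded by \<open>norm u\<close>, so
  comparison with a geometric series gives radius at least 1. This makes differences of Hardy space
  elements eligible for the nondegeneracy hypothesis.\<close>

lemma free_holomorphic_l2: "free_holomorphic 1 (l2_nth (u :: 'n::finite hardy))"
  unfolding free_holomorphic_def nc_radius_def
proof (rule conv_radius_geI_ex')
  fix r :: real assume r: "0 < r" "ereal r < ereal 1"
  have "sqrt (\<Sum>\<alpha> | length \<alpha> = k. (cmod (l2_nth u \<alpha>))\<^sup>2) \<le> norm u" for k
    using finite_lists_length_eq[of "UNIV :: 'n set" k]
    by (intro real_le_lsqrt) (simp_all add: sum_nonneg l2_sum_le_norm_sq)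
  then have "norm (sqrt (\<Sum>\<alpha> | length \<alpha> = k. (cmod (l2_nth u \<alpha>))\<^sup>2) * of_real r ^ k) \<le> norm u * r ^ k" for k
    using r by (simp add: abs_mult sum_nonneg mult_right_mono)
  moreover have "summable (\<lambda>k. norm u * r ^ k)"
    using r by (intro summable_mult summable_geometric) simp
  ultimately show "summable (\<lambda>k. sqrt (\<Sum>\<alpha> | length \<alpha> = k. (cmod (l2_nth u \<alpha>))\<^sup>2) * of_real r ^ k)"
    by (rule summable_comparison_test'[of "\<lambda>k. norm u * r ^ k" 0, rotated])
qed

lemma hom_part_0: "hom_part c Y 0 h = c [] *\<^sub>C h"
  by (simp add: hom_part_def)

lemma hom_part_lshift:
  assumes "bounded_op UNIV (Y j)"
  shows "hom_part (l2_nth (lshift [j] u)) Y (Suc k) h = Y j (hom_part (l2_nth u) Y k h)"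
proof -
  have "hom_part (l2_nth (lshift [j] u)) Y (Suc k) h
      = (\<Sum>i\<in>UNIV. if i = j then \<Sum>\<alpha> | length \<alpha> = k. l2_nth u \<alpha> *\<^sub>C Y j (op_word Y \<alpha> h) else 0)"
    unfolding hom_part_def sum_words_Suc by (rule sum.cong) (auto simp: l2_nth_lshift)
  then show ?thesis
    by (simp add: hom_part_def linear_sum[OF bounded_linear.linear[OF bounded_op_UNIV_bounded_linear[OF assms]]]
        bounded_op_scaleC[OF assms])
qed

lemma hom_part_rshift:
  fixes u :: "'n::finite hardy"
  shows "hom_part (l2_nth (rshift [j] u)) Y (Suc k) h = hom_part (l2_nth u) Y k (Y j h)"
proof -
  have "hom_part (l2_nth (rshift [j] u)) Y (Suc k) h
      = (\<Sum>\<beta>\<in>(\<lambda>\<alpha>. \<alpha> @ [j]) ` {\<alpha>. length \<alpha> = k}. l2_nth (rshift [j] u) \<beta> *\<^sub>C op_word Y \<beta> h)"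
    unfolding hom_part_def
  proof (rule sum.mono_neutral_right)
    show "finite {\<alpha> :: 'n list. length \<alpha> = Suc k}"
      using finite_lists_length_eq[of "UNIV :: 'n set" "Suc k"] by simp
    show "\<forall>\<beta>\<in>{\<alpha>. length \<alpha> = Suc k} - (\<lambda>\<alpha>. \<alpha> @ [j]) ` {\<alpha>. length \<alpha> = k}.
        l2_nth (rshift [j] u) \<beta> *\<^sub>C op_word Y \<beta> h = 0"
    proof
      fix \<beta> assume \<beta>: "\<beta> \<in> {\<alpha>. length \<alpha> = Suc k} - (\<lambda>\<alpha>. \<alpha> @ [j]) ` {\<alpha>. length \<alpha> = k}"
      then have "\<beta> \<noteq> \<alpha> @ [j]" for \<alpha> by auto
      then show "l2_nth (rshift [j] u) \<beta> *\<^sub>C op_word Y \<beta> h = 0" by (simp add: l2_nth_rshift_eq_0)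
    qed
  qed auto
  also have "\<dots> = hom_part (l2_nth u) Y k (Y j h)"
    by (subst sum.reindex) (auto simp: inj_on_def hom_part_def op_word_snoc)
  finally show ?thesis .
qed

text \<open>Both shifts raise the degree by one and leave no constant term, so dropping the zeroth
  term of the sum reindexes it. Appending a letter makes \<open>Y j\<close> act first, prepending
  makes it act last.\<close>

lemma series_at_op_ball:
  fixes u :: "'n::finite hardy"
  assumes Y: "Y \<in> op_ball 1"
  shows series_at_lshift: "series_at (l2_nth (lshift [j] u)) Y h = Y j (series_at (l2_nth u) Y h)"
    and series_at_rshift: "series_at (l2_nth (rshift [j] u)) Y h = series_at (l2_nth u) Y (Y j h)"
    and series_at_diff: "series_at (l2_nth (u - v)) Y h = series_at (l2_nth u) Y h - series_at (l2_nth v) Y h"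
proof -
  note s = summable_hom_part_op_ball[OF Y]
  have B: "bounded_op UNIV (Y j)" using Y by (simp add: op_ball_def)
  have shift: "series_at (l2_nth w) Y h = (\<Sum>k. hom_part (l2_nth w) Y (Suc k) h)"
    if "l2_nth w [] = 0" for w :: "'n hardy"
    unfolding series_at_def using suminf_split_head[OF s[of w h]] that by (simp add: hom_part_0)
  have "l2_nth (lshift [j] u) [] = 0" by (simp add: l2_nth_lshift)
  then show "series_at (l2_nth (lshift [j] u)) Y h = Y j (series_at (l2_nth u) Y h)"
    using bounded_linear.suminf[OF bounded_op_UNIV_bounded_linear[OF B] s, of u h]
    by (simp add: shift hom_part_lshift[of Y j, OF B]) (simp add: series_at_def)
  have "l2_nth (rshift [j] u) [] = 0" by (simp add: l2_nth_rshift_eq_0)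
  then show "series_at (l2_nth (rshift [j] u)) Y h = series_at (l2_nth u) Y (Y j h)"
    by (simp add: shift hom_part_rshift) (simp add: series_at_def)
  have "hom_part (l2_nth (u - v)) Y k h = hom_part (l2_nth u) Y k h - hom_part (l2_nth v) Y k h" for k
    by (simp add: hom_part_def minus_l2.rep_eq complex_vector.scale_left_diff_distrib sum_subtractf)
  then show "series_at (l2_nth (u - v)) Y h = series_at (l2_nth u) Y h - series_at (l2_nth v) Y h"
    unfolding series_at_def by (simp add: suminf_diff[OF s s])
qed

text \<open>Injectivity is nondegeneracy of \<open>f\<close> applied to the difference of two Hardy
  space elements. Both identities then hold pointwise on the ball, since \<open>MZ i\<close> and
  left creation compose on the left of the evaluation and right creation on its right.\<close>

lemma holomorphic_hardy_model:
  fixes f :: "'n::finite \<Rightarrow> 'n ncseries"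
  assumes "holomorphic_model f MZ"
  shows "hardy_model f MZ"
proof -
  obtain \<gamma> where ball: "\<And>X. X \<in> op_ball \<gamma> \<Longrightarrow> tuple_at f X \<in> op_ball 1"
    and nonzero: "\<And>G \<alpha>. free_holomorphic 1 G \<Longrightarrow> G \<alpha> \<noteq> 0 \<Longrightarrow>
      \<exists>X\<in>op_ball \<gamma>. \<exists>h. series_at G (tuple_at f X) h \<noteq> 0"
    and MZ: "\<And>i. bounded_op UNIV (MZ i)"
    and mult: "\<And>i u X. X \<in> op_ball \<gamma> \<Longrightarrow>
      series_at (l2_nth (MZ i u)) (tuple_at f X) = X i \<circ> series_at (l2_nth u) (tuple_at f X)"
    and conv: "MZ \<in> conv_SOT f UNIV \<union> conv_rad f UNIV"
    and eval: "\<And>j u X. X \<in> op_ball \<gamma> \<Longrightarrow>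
      series_at (l2_nth (eval_tuple f UNIV MZ j u)) (tuple_at f X) =
        tuple_at f X j \<circ> series_at (l2_nth u) (tuple_at f X)"
    using assms unfolding holomorphic_model_def by (elim exE conjE) (rule that; blast)
  have inject: "u = v"
    if "\<And>X h. X \<in> op_ball \<gamma> \<Longrightarrow> series_at (l2_nth u) (tuple_at f X) h = series_at (l2_nth v) (tuple_at f X) h"
    for u v :: "'n hardy"
  proof -
    have "l2_nth (u - v) \<alpha> = 0" for \<alpha>
      using nonzero[OF free_holomorphic_l2, of "u - v" \<alpha>] by (auto simp: series_at_diff[OF ball] that)
    then have "u - v = 0" by (intro l2_eqI) (simp add: zero_l2.rep_eq)
    then show ?thesis by simp
  qed
  show ?thesis
  proof
    show "MZ i (rshift [j] u) = rshift [j] (MZ i u)" for i j u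
      by (rule inject) (simp add: mult series_at_rshift[OF ball])
    show "eval_tuple f UNIV MZ j u = lshift [j] u" for j u
      by (rule inject) (simp add: eval series_at_lshift[OF ball])
  qed (use MZ conv in auto)
qed

lemma universal_hardy_model: "universal_model f MZ \<Longrightarrow> hardy_model f MZ"
  unfolding universal_model_def
  using polynomial_hardy_model series_hardy_model holomorphic_hardy_model by blast

theorem theorem8p4:
  fixes f :: "'n::finite \<Rightarrow> 'n ncseries"
    and MZ :: "'n \<Rightarrow> 'n hardy \<Rightarrow> 'n hardy"
    and M N :: "'n hardy set"
  assumes "universal_model f MZ"
    and "invariant_subspace MZ M"
    and "invariant_subspace MZ N"
  shows "(rank_f f M MZ < \<infinity> \<longrightarrow> ereal (curv_f f MZ M MZ) = ereal_of_enat (rank_f f M MZ)) \<and>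
    (rank_f f M MZ < \<infinity> \<and> rank_f f N MZ < \<infinity> \<longrightarrow>
      (unitarily_equivalent M MZ N MZ \<longleftrightarrow> curv_f f MZ M MZ = curv_f f MZ N MZ))"
proof -
  interpret hardy_model f MZ by (rule universal_hardy_model[OF assms(1)])
  show ?thesis by (rule rank_curvature_unitary_equivalence[OF assms(2,3)])
qed

end
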